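(* Let $p$ be a prime number (including possibly $p=2$). For any unramified $\mathbb{Z}_p$-covering $X_\infty/X$ of connected graphs, $\lambda(X_\infty/X)$ is odd.
   Context: Graphs (Serre's formalism): a graph $X$ consists of finite sets $V_X$ (vertices) and $\mathbb{E}_X$ (edges, oriented), an involution $e \mapsto \overline{e}$ of $\mathbb{E}_X$ without fixed elements, and maps $s,t:\mathbb{E}_X \to V_X$ with $s(\overline{e}) = t(e)$, $t(\overline{e}) = s(e)$. So multi-edges and loops are allowed, and each pair $\{e,\overline{e}\}$ is one undirected edge. $\kappa_X$ denotes the number of spanning trees of $X$ (as an undirected multigraph, undirected edges being the pairs $\{e,\overline e\}$). Unramified $\mathbb{Z}_p$-coverings: let $\Gamma$ be a profinite group, written multiplicatively, isomorphic to $\mathbb{Z}_p$, and $\Gamma_n = \Gamma/\Gamma^{p^n}$ for $n \ge 0$. A voltage assignment is a map $\alpha: \mathbb{E}_X \to \Gamma$ with $\alpha(\overline{e}) = \alpha(e)^{-1}$ for all $e$. The derived graph $X_n$ has $V_{X_n} = \Gamma_n \times V_X$, $\mathbb{E}_{X_n} = \Gamma_n \times \mathbb{E}_X$, with $\overline{(\gamma,e)} = (\gamma\cdot\alpha(e),\overline{e})$, $s((\gamma,e)) = (\gamma,s(e))$, $t((\gamma,e)) = (\gamma\cdot\alpha(e),t(e))$. The tower $X = X_0 \leftarrow X_1 \leftarrow X_2 \leftarrow\cdots$ (with maps induced by the projections $\Gamma_{n'} \to \Gamma_n$), provided all $X_n$ are connected, is an unramified $\mathbb{Z}_p$-covering of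 connected graphs, written $X_\infty/X$; every unramified $\mathbb{Z}_p$-covering of connected graphs is, up to isomorphism, of this form, and this may be taken as the definition. Iwasawa invariants: for such $X_\infty/X$ it is known that there are unique non-negative integers $\lambda(X_\infty/X)$, $\mu(X_\infty/X)$ and an integer $\nu$ such that $\operatorname{ord}_p(\kappa_{X_n}) = \lambda(X_\infty/X)\, n + \mu(X_\infty/X)\, p^n + \nu$ for all sufficiently large $n$, where $\operatorname{ord}_p$ is the $p$-adic valuation with $\operatorname{ord}_p(p)=1$. *)

theory Defs
  imports
    "HOL-Analysis.Analysis"
    "HOL-Algebra.Coset"
    "HOL-Computational_Algebra.Primes"
    "Graph_Theory.Bidirected_Digraph"
    "Graph_Theory.Digraph_Component"
begin

text \<open>
  A graph in the sense of Serre is a \<^locale>\<open>fin_digraph\<close> \<open>X\<close> that is a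
  \<^locale>\<open>bidirected_digraph\<close> with respect to the edge inversion \<open>arev\<close>. That locale asks
  \<open>arev\<close> to be the identity outside the set of edges; on the edges it is an involution
  without fixed elements that exchanges tail (source) and head (target).
\<close>


subsection \<open>Spanning trees\<close>

text \<open>
  The library predicate \<open>tree\<close> forbids every directed cycle, in particular \<open>[e, arev e]\<close>, so
  it does not apply to graphs whose edges are pairs \<open>{e, arev e}\<close>. A circuit of the
  undirected multigraph is a directed cycle (closed, non-empty, no repeated vertex) that is
  not of this form: loops are circuits of length 1, and two different parallel undirected
  edges form a circuit of length 2.
\<close>

definition circuit :: "('b \<Rightarrow> 'b) \<Rightarrow> ('a, 'b) pre_digraph \<Rightarrow> 'b list \<Rightarrow> bool" where
  "circuit arev G q \<longleftrightarrow> pre_digraph.cycle G q \<and> \<not> (\<exists>e. q = [e, arev e])"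

definition undirected_tree :: "('b \<Rightarrow> 'b) \<Rightarrow> ('a, 'b) pre_digraph \<Rightarrow> bool" where
  "undirected_tree arev H \<longleftrightarrow>
     arev ` arcs H \<subseteq> arcs H \<and> Digraph_Component.connected H \<and> \<not> (\<exists>q. circuit arev H q)"

text \<open>
  \<open>spanning H G\<close> forces \<open>H\<close> to have the vertices and the tail and head maps of \<open>G\<close>, so that
  \<open>H\<close> is determined by its set of edges.
\<close>

definition num_spanning_trees :: "('b \<Rightarrow> 'b) \<Rightarrow> ('a, 'b) pre_digraph \<Rightarrow> nat" where
  "num_spanning_trees arev G = card {H. spanning H G \<and> undirected_tree arev H}"


subsection \<open>Groups isomorphic to the p-adic integers\<close>

text \<open>
  The additive group of p-adic integers as the inverse limit of the groups of integers
  modulo \<open>p ^ n\<close>, the n-th component being the representative in \<open>{0..<p ^ n}\<close>, with the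
  inverse limit topology.
\<close>

definition Zp :: "nat \<Rightarrow> (nat \<Rightarrow> int) monoid" where
  "Zp p = \<lparr>carrier = {x. \<forall>n. x n \<in> {0..<int p ^ n} \<and> x (Suc n) mod int p ^ n = x n},
           mult = (\<lambda>x y n. (x n + y n) mod int p ^ n),
           one = (\<lambda>n. 0)\<rparr>"

definition Zp_topology :: "nat \<Rightarrow> (nat \<Rightarrow> int) topology" where
  "Zp_topology p =
     subtopology (product_topology (\<lambda>_. discrete_topology UNIV) UNIV) (carrier (Zp p))"

text \<open>
  That \<open>\<Gamma>\<close> with the topology \<open>T\<close> is a profinite group follows from the existence of an
  isomorphism of groups onto \<open>Zp p\<close> that is a homeomorphism.
\<close>

definition isomorphic_to_Zp :: "nat \<Rightarrow> 'g monoid \<Rightarrow> 'g topology \<Rightarrow> bool" where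
  "isomorphic_to_Zp p \<Gamma> T \<longleftrightarrow>
     group \<Gamma> \<and> topspace T = carrier \<Gamma> \<and>
     (\<exists>\<phi>\<in>iso \<Gamma> (Zp p). homeomorphic_map T (Zp_topology p) \<phi>)"

definition power_subgroup :: "'g monoid \<Rightarrow> nat \<Rightarrow> 'g set" where
  "power_subgroup \<Gamma> k = (\<lambda>\<gamma>. \<gamma> [^]\<^bsub>\<Gamma>\<^esub> k) ` carrier \<Gamma>"

definition layer_group :: "nat \<Rightarrow> 'g monoid \<Rightarrow> nat \<Rightarrow> 'g set monoid" where
  "layer_group p \<Gamma> n = \<Gamma> Mod power_subgroup \<Gamma> (p ^ n)"


subsection \<open>Derived graphs\<close>

text \<open>The product of \<open>\<gamma>\<close>, an element of the n-th layer group, with the class of \<open>g\<close>.\<close>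

definition layer_act :: "nat \<Rightarrow> 'g monoid \<Rightarrow> nat \<Rightarrow> 'g set \<Rightarrow> 'g \<Rightarrow> 'g set" where
  "layer_act p \<Gamma> n \<gamma> g =
     \<gamma> \<otimes>\<^bsub>layer_group p \<Gamma> n\<^esub> (power_subgroup \<Gamma> (p ^ n) #>\<^bsub>\<Gamma>\<^esub> g)"

definition derived_graph ::
  "nat \<Rightarrow> 'g monoid \<Rightarrow> ('v, 'e) pre_digraph \<Rightarrow> ('e \<Rightarrow> 'g) \<Rightarrow> nat
     \<Rightarrow> ('g set \<times> 'v, 'g set \<times> 'e) pre_digraph" where
  "derived_graph p \<Gamma> X \<alpha> n =
     \<lparr>verts = carrier (layer_group p \<Gamma> n) \<times> verts X,
      arcs = carrier (layer_group p \<Gamma> n) \<times> arcs X,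
      tail = (\<lambda>(\<gamma>, e). (\<gamma>, tail X e)),
      head = (\<lambda>(\<gamma>, e). (layer_act p \<Gamma> n \<gamma> (\<alpha> e), head X e))\<rparr>"

definition derived_arev ::
  "nat \<Rightarrow> 'g monoid \<Rightarrow> ('v, 'e) pre_digraph \<Rightarrow> ('e \<Rightarrow> 'e) \<Rightarrow> ('e \<Rightarrow> 'g) \<Rightarrow> nat
     \<Rightarrow> 'g set \<times> 'e \<Rightarrow> 'g set \<times> 'e" where
  "derived_arev p \<Gamma> X arev \<alpha> n =
     (\<lambda>(\<gamma>, e). if (\<gamma>, e) \<in> arcs (derived_graph p \<Gamma> X \<alpha> n)
               then (layer_act p \<Gamma> n \<gamma> (\<alpha> e), arev e) else (\<gamma>, e))"


subsection \<open>Unramified coverings and Iwasawa invariants\<close>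

text \<open>
  Unramified coverings of connected graphs with group \<open>\<Gamma>\<close>, given by a voltage assignment
  \<open>\<alpha>\<close>. Since \<open>X\<close> is isomorphic to the 0-th derived graph, its connectedness is part of the
  last condition.
\<close>

definition unramified_Zp_covering ::
  "nat \<Rightarrow> 'g monoid \<Rightarrow> 'g topology \<Rightarrow> ('v, 'e) pre_digraph \<Rightarrow> ('e \<Rightarrow> 'e) \<Rightarrow> ('e \<Rightarrow> 'g)
     \<Rightarrow> bool" where
  "unramified_Zp_covering p \<Gamma> T X arev \<alpha> \<longleftrightarrow>
     fin_digraph X \<and> bidirected_digraph X arev \<and>
     isomorphic_to_Zp p \<Gamma> T \<and>
     (\<forall>e\<in>arcs X. \<alpha> e \<in> carrier \<Gamma>) \<and>
     (\<forall>e\<in>arcs X. \<alpha> (arev e) = inv\<^bsub>\<Gamma>\<^esub> (\<alpha> e)) \<and>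
     (\<forall>n. Digraph_Component.connected (derived_graph p \<Gamma> X \<alpha> n))"

definition covering_kappa ::
  "nat \<Rightarrow> 'g monoid \<Rightarrow> ('v, 'e) pre_digraph \<Rightarrow> ('e \<Rightarrow> 'e) \<Rightarrow> ('e \<Rightarrow> 'g) \<Rightarrow> nat \<Rightarrow> nat" where
  "covering_kappa p \<Gamma> X arev \<alpha> n =
     num_spanning_trees (derived_arev p \<Gamma> X arev \<alpha> n) (derived_graph p \<Gamma> X \<alpha> n)"

definition iwasawa_invariants ::
  "nat \<Rightarrow> 'g monoid \<Rightarrow> ('v, 'e) pre_digraph \<Rightarrow> ('e \<Rightarrow> 'e) \<Rightarrow> ('e \<Rightarrow> 'g)
     \<Rightarrow> nat \<Rightarrow> nat \<Rightarrow> int \<Rightarrow> bool" where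
  "iwasawa_invariants p \<Gamma> X arev \<alpha> l m \<nu> \<longleftrightarrow>
     (\<forall>\<^sub>F n in sequentially.
        int (multiplicity p (covering_kappa p \<Gamma> X arev \<alpha> n))
          = int l * int n + int m * int p ^ n + \<nu>)"

definition iwasawa_lambda ::
  "nat \<Rightarrow> 'g monoid \<Rightarrow> ('v, 'e) pre_digraph \<Rightarrow> ('e \<Rightarrow> 'e) \<Rightarrow> ('e \<Rightarrow> 'g) \<Rightarrow> nat" where
  "iwasawa_lambda p \<Gamma> X arev \<alpha> = (THE l. \<exists>m \<nu>. iwasawa_invariants p \<Gamma> X arev \<alpha> l m \<nu>)"

end

theory Submission
  imports Defs "Jordan_Normal_Form.Char_Poly"
begin

text \<open>
  Write \<open>\<kappa> n\<close> for the number of spanning trees of the \<open>n\<close>-th derived graph and \<open>a e\<close> for the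
  voltage of \<open>e\<close> modulo \<open>p ^ n\<close>. Let \<open>d n\<close> be the integer polynomial in \<open>T\<close> obtained as the
  determinant of \<open>D - A\<close>, where \<open>D\<close> is the degree matrix of \<open>X\<close> and every arc \<open>e\<close> contributes
  \<open>(1 + T) ^ a e\<close> to \<open>A\<close>. The Laplacian of the \<open>n\<close>-th derived graph is block circulant, and the
  Fourier transform on the integers modulo \<open>p ^ n\<close> turns the matrix-tree theorem into
  \<open>p ^ n * \<kappa> n = \<kappa> X * (\<Prod>z. d n (z - 1))\<close>, the product running over the \<open>p ^ n\<close>-th roots of
  unity \<open>z \<noteq> 1\<close> (\<open>spanning_trees_of_derived_graph\<close>).

  The polynomials \<open>d n\<close> agree modulo \<open>\<omega> n = (1 + T) ^ p ^ n - 1\<close>; together they are one power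
  series with p-adic coefficients. Instead of passing to the limit one uses that \<open>\<omega> n\<close> is monic
  and congruent to \<open>T ^ p ^ n\<close> modulo \<open>p\<close>: the largest power \<open>p ^ \<mu>\<close> dividing \<open>d n\<close> modulo \<open>\<omega> n\<close>,
  and the order \<open>l\<close> at \<open>T = 0\<close> of the quotient modulo \<open>p\<close>, do not depend on \<open>n\<close> once \<open>n\<close> is large
  (\<open>iwasawa_invariants_of_compatible_polys\<close>). Since \<open>p\<close> is, up to a unit, the product of all
  \<open>z - 1\<close> with \<open>z\<close> primitive of order \<open>p ^ (n + 1)\<close>, the product of \<open>d (n + 1) (z - 1)\<close> over these
  \<open>z\<close> has p-adic valuation \<open>l + \<mu> * (p ^ (n + 1) - p ^ n)\<close> (\<open>prod_primitive_ev_valuation\<close>).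
  Dividing the formulas for \<open>n + 1\<close> and \<open>n\<close>, the factor \<open>p\<close> on the left costs one, so that
  \<open>\<lambda> = l - 1\<close> (\<open>iwasawa_formula_of_polys\<close>). As \<open>\<lambda>\<close> is defined by a description, one needs besides
  the growth formula that it determines \<open>\<lambda>\<close> (\<open>iwasawa_lambda_unique\<close>).

  It remains to see that \<open>l\<close> is even and positive. It is positive because \<open>d n\<close> vanishes at
  \<open>T = 0\<close>, where the matrix is the Laplacian of \<open>X\<close>. The voltage of the reversed arc is the
  inverse, so \<open>D - A\<close> is transposed by the substitution \<open>1 + T \<mapsto> 1 / (1 + T)\<close>, and \<open>d n\<close> is
  invariant under it modulo \<open>\<omega> n\<close>. The substitution is \<open>T \<mapsto> - T + T ^ 2 - \<dots>\<close>. Comparing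
  leading coefficients shows that \<open>l\<close> is even if \<open>p\<close> is odd; the coefficients that follow them
  show it for \<open>p = 2\<close> as well (\<open>even_if_symmetric\<close>).
\<close>


section \<open>Determinants indexed by finite sets\<close>

text \<open>
  The rows and columns of the matrices below are indexed by sets of vertices, or by pairs of a
  residue and a vertex, so the Leibniz formula is taken over an arbitrary finite index set.
\<close>

definition fdet :: "'i set \<Rightarrow> ('i \<Rightarrow> 'i \<Rightarrow> 'a) \<Rightarrow> 'a :: comm_ring_1" where
  "fdet S A = (\<Sum>\<pi> | \<pi> permutes S. of_int (sign \<pi>) * (\<Prod>i\<in>S. A i (\<pi> i)))"

lemma fdet_cong:
  assumes "\<And>i j. i \<in> S \<Longrightarrow> j \<in> S \<Longrightarrow> A i j = B i j"
  shows "fdet S A = fdet S B"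
proof -
  have "(\<Prod>i\<in>S. A i (\<pi> i)) = (\<Prod>i\<in>S. B i (\<pi> i))" if p: "\<pi> permutes S" for \<pi>
    by (intro prod.cong refl assms) (simp_all add: permutes_in_image[OF p])
  then show ?thesis by (simp add: fdet_def)
qed

lemma fdet_reindex:
  assumes h: "bij_betw h S T" and "finite S"
  shows "fdet T A = fdet S (\<lambda>i j. A (h i) (h j))"
proof -
  have inj: "inj_on h S" and T: "T = h ` S"
    using h by (auto simp: bij_betw_def)
  have g: "bij_betw (inv_into S h) T S"
    using h by (rule bij_betw_inv_into)
  show ?thesis
    unfolding fdet_def
  proof (rule sum.reindex_bij_witness[where i = "map_permutation S h"
        and j = "map_permutation T (inv_into S h)"])
    fix \<pi> assume "\<pi> \<in> {\<pi>. \<pi> permutes T}"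
    then have p: "\<pi> permutes T" by simp
    show *: "map_permutation S h (map_permutation T (inv_into S h) \<pi>) = \<pi>"
      by (rule map_permutation_compose_inv[OF g p]) (auto simp: T f_inv_into_f)
    show q: "map_permutation T (inv_into S h) \<pi> \<in> {\<pi>. \<pi> permutes S}"
      using map_permutation_permutes[OF g p] by simp
    have "sign (map_permutation T (inv_into S h) \<pi>) = sign \<pi>"
      using g p \<open>finite S\<close> by (intro sign_map_permutation) (auto simp: T bij_betw_def)
    moreover have "h (map_permutation T (inv_into S h) \<pi> i) = \<pi> (h i)" if "i \<in> S" for i
      by (subst * [symmetric]) (simp add: map_permutation_apply[OF inj that])
    then have "(\<Prod>i\<in>S. A (h i) (h (map_permutation T (inv_into S h) \<pi> i)))
        = (\<Prod>i\<in>T. A i (\<pi> i))"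
      by (simp add: T prod.reindex[OF inj])
    ultimately show "of_int (sign (map_permutation T (inv_into S h) \<pi>)) *
         (\<Prod>i\<in>S. A (h i) (h (map_permutation T (inv_into S h) \<pi> i))) =
         of_int (sign \<pi>) * (\<Prod>i\<in>T. A i (\<pi> i))" by simp
  next
    fix \<pi> assume "\<pi> \<in> {\<pi>. \<pi> permutes S}"
    then have p: "\<pi> permutes S" by simp
    show "map_permutation T (inv_into S h) (map_permutation S h \<pi>) = \<pi>"
      by (rule map_permutation_compose_inv[OF h p]) (auto simp: inj)
    show "map_permutation S h \<pi> \<in> {\<pi>. \<pi> permutes T}"
      using map_permutation_permutes[OF h p] by simp
  qed
qed

lemma fdet_eq_det:
  "fdet {0..<n} A = Determinant.det (Matrix.mat n n (\<lambda>(i, j). A i j))"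
proof -
  have "(\<Prod>i\<in>{0..<n}. A i (\<pi> i)) = (\<Prod>i = 0..<n. Matrix.mat n n (\<lambda>(i, j). A i j) $$ (i, \<pi> i))"
    if p: "\<pi> permutes {0..<n}" for \<pi>
  proof (rule prod.cong)
    fix i assume "i \<in> {0..<n}"
    then have "i < n" "\<pi> i < n" using permutes_in_image[OF p, of i] by auto
    then show "A i (\<pi> i) = Matrix.mat n n (\<lambda>(i, j). A i j) $$ (i, \<pi> i)" by simp
  qed simp
  then show ?thesis
    unfolding fdet_def by (simp add: det_def'[where n = n])
qed

lemma fdet_mult:
  fixes A B :: "'i \<Rightarrow> 'i \<Rightarrow> 'a :: comm_ring_1"
  assumes "finite S"
  shows "fdet S (\<lambda>i j. \<Sum>k\<in>S. A i k * B k j) = fdet S A * fdet S B"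
proof -
  obtain h where h: "bij_betw h {0..<card S} S"
    using ex_bij_betw_nat_finite[OF assms] by blast
  define n where "n = card S"
  define M where "M C = Matrix.mat n n (\<lambda>(i, j). C (h i) (h j))" for C :: "_ \<Rightarrow> _ \<Rightarrow> 'a"
  have fdet_M: "fdet S C = Determinant.det (M C)" for C
    unfolding M_def n_def fdet_eq_det[symmetric] by (rule fdet_reindex[OF h]) simp
  have "M (\<lambda>i j. \<Sum>k\<in>S. A i k * B k j) = M A * M B"
  proof (rule eq_matI)
    fix i j assume "i < dim_row (M A * M B)" "j < dim_col (M A * M B)"
    then have ij: "i < n" "j < n" by (auto simp: M_def)
    have "(\<Sum>k\<in>S. A (h i) k * B k (h j)) = (\<Sum>k = 0..<n. A (h i) (h k) * B (h k) (h j))"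
      using sum.reindex_bij_betw[OF h, symmetric] by (simp add: n_def)
    then show "M (\<lambda>i j. \<Sum>k\<in>S. A i k * B k j) $$ (i, j) = (M A * M B) $$ (i, j)"
      using ij by (simp add: M_def scalar_prod_def)
  qed (auto simp: M_def)
  moreover have "M A \<in> carrier_mat n n" "M B \<in> carrier_mat n n"
    by (auto simp: M_def)
  ultimately show ?thesis
    unfolding fdet_M by (simp add: det_mult)
qed

lemma fdet_transpose:
  fixes A :: "'i \<Rightarrow> 'i \<Rightarrow> 'a :: comm_ring_1"
  assumes "finite S"
  shows "fdet S (\<lambda>i j. A j i) = fdet S A"
proof -
  have "(\<Sum>\<pi> | \<pi> permutes S. of_int (sign \<pi>) * (\<Prod>i\<in>S. A (\<pi> i) i))
      = (\<Sum>\<pi> | \<pi> permutes S. of_int (sign (inv_into UNIV \<pi>)) * (\<Prod>i\<in>S. A (inv_into UNIV \<pi> i) i))"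
    by (rule sum_permutations_inverse)
  also have "\<dots> = (\<Sum>\<pi> | \<pi> permutes S. of_int (sign \<pi>) * (\<Prod>i\<in>S. A i (\<pi> i)))"
  proof (intro sum.cong refl arg_cong2[where f = "(*)"])
    fix \<pi> assume "\<pi> \<in> {\<pi>. \<pi> permutes S}"
    then have p: "\<pi> permutes S" by simp
    show "of_int (sign (inv_into UNIV \<pi>)) = (of_int (sign \<pi>) :: 'a)"
    proof -
      have "permutation \<pi>" using p assms by (auto simp: permutation_permutes)
      then show ?thesis by (simp add: sign_inverse)
    qed
    have "(\<Prod>i\<in>S. A (inv_into UNIV \<pi> i) i) = (\<Prod>i\<in>S. A (inv_into UNIV \<pi> (\<pi> i)) (\<pi> i))"
      using p by (subst prod.permute[OF p]) (simp add: o_def)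
    then show "(\<Prod>i\<in>S. A (inv_into UNIV \<pi> i) i) = (\<Prod>i\<in>S. A i (\<pi> i))"
      using p by (simp add: permutes_inverses)
  qed
  finally show ?thesis unfolding fdet_def .
qed

lemma fdet_row_sums:
  assumes "finite S" and "\<And>i. i \<in> S \<Longrightarrow> finite (E i)"
  shows "fdet S (\<lambda>i j. \<Sum>e\<in>E i. R i e j) = (\<Sum>f\<in>Pi\<^sub>E S E. fdet S (\<lambda>i j. R i (f i) j))"
proof -
  have "fdet S (\<lambda>i j. \<Sum>e\<in>E i. R i e j)
      = (\<Sum>\<pi> | \<pi> permutes S. \<Sum>f\<in>Pi\<^sub>E S E. of_int (sign \<pi>) * (\<Prod>i\<in>S. R i (f i) (\<pi> i)))"
    unfolding fdet_def using assms by (simp add: prod_sum_PiE sum_distrib_left)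
  also have "\<dots> = (\<Sum>f\<in>Pi\<^sub>E S E. fdet S (\<lambda>i j. R i (f i) j))"
    unfolding fdet_def by (rule sum.swap)
  finally show ?thesis .
qed

text \<open>
  A permutation \<open>\<pi>\<close> other than the identity cannot lower the rank \<open>h\<close> at every point that it
  moves, since the sum of \<open>h\<close> over \<open>S\<close> is invariant under \<open>\<pi>\<close>. This covers triangular matrices
  without choosing a linear order on the indices.
\<close>

lemma fdet_ranked:
  fixes h :: "'i \<Rightarrow> nat" and A :: "'i \<Rightarrow> 'i \<Rightarrow> 'a :: comm_ring_1"
  assumes "finite S"
    and lower: "\<And>i j. i \<in> S \<Longrightarrow> j \<in> S \<Longrightarrow> i \<noteq> j \<Longrightarrow> h i \<le> h j \<Longrightarrow> A i j = 0"
  shows "fdet S A = (\<Prod>i\<in>S. A i i)"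
proof -
  have "of_int (sign \<pi>) * (\<Prod>i\<in>S. A i (\<pi> i)) = 0" if p: "\<pi> permutes S" and "\<pi> \<noteq> id" for \<pi>
  proof -
    have "\<exists>i\<in>S. \<pi> i \<noteq> i \<and> h i \<le> h (\<pi> i)"
    proof (rule ccontr)
      assume *: "\<not> ?thesis"
      obtain i where i: "\<pi> i \<noteq> i" using \<open>\<pi> \<noteq> id\<close> by (auto simp: fun_eq_iff)
      then have "i \<in> S" using p by (meson permutes_not_in)
      have "(\<Sum>i\<in>S. h (\<pi> i)) < (\<Sum>i\<in>S. h i)"
      proof (rule sum_strict_mono_ex1[OF \<open>finite S\<close>])
        show "\<forall>i\<in>S. h (\<pi> i) \<le> h i" using * by (metis nat_le_linear)
        show "\<exists>i\<in>S. h (\<pi> i) < h i" using * i \<open>i \<in> S\<close> by (meson not_le)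
      qed
      moreover have "(\<Sum>i\<in>S. h (\<pi> i)) = (\<Sum>i\<in>S. h i)"
        using sum.permute[OF p, of h] by (simp add: o_def)
      ultimately show False by simp
    qed
    then obtain i where "i \<in> S" "\<pi> i \<noteq> i" "h i \<le> h (\<pi> i)" by blast
    then have "A i (\<pi> i) = 0" using lower p by (metis permutes_in_image)
    then have "(\<Prod>i\<in>S. A i (\<pi> i)) = 0"
      using \<open>finite S\<close> \<open>i \<in> S\<close> by (intro prod_zero) auto
    then show ?thesis by simp
  qed
  then have "fdet S A = (\<Sum>\<pi>\<in>{id}. of_int (sign \<pi>) * (\<Prod>i\<in>S. A i (\<pi> i)))"
    unfolding fdet_def using assms(1)
    by (intro sum.mono_neutral_right) (auto simp: finite_permutations permutes_id)
  then show ?thesis by simp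
qed

lemma fdet_zero_column:
  assumes "finite S" "j \<in> S" and "\<And>i. i \<in> S \<Longrightarrow> A i j = 0"
  shows "fdet S A = 0"
proof -
  have "of_int (sign \<pi>) * (\<Prod>i\<in>S. A i (\<pi> i)) = 0" if p: "\<pi> permutes S" for \<pi>
  proof -
    obtain i where "\<pi> i = j" "i \<in> S"
      using p assms(2) by (metis permutes_in_image permutes_surj surjD)
    then have "(\<Prod>i\<in>S. A i (\<pi> i)) = 0"
      using assms by (intro prod_zero) auto
    then show ?thesis by simp
  qed
  then show ?thesis by (simp add: fdet_def)
qed

text \<open>
  The indicator function of \<open>C\<close> is a kernel vector. Adding the columns of \<open>C\<close> to one of them,
  which is multiplication by a triangular matrix with unit diagonal, produces a zero column;
  unlike the usual argument this needs no division.
\<close>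

lemma fdet_vanishing_row_sums:
  fixes A :: "'i \<Rightarrow> 'i \<Rightarrow> 'a :: comm_ring_1"
  assumes "finite S" "C \<subseteq> S" "C \<noteq> {}"
    and zero: "\<And>i. i \<in> S \<Longrightarrow> (\<Sum>j\<in>C. A i j) = 0"
  shows "fdet S A = 0"
proof -
  obtain c where "c \<in> C" using assms by blast
  define Q where "Q i j = (if i = j \<or> (j = c \<and> i \<in> C) then 1 else 0 :: 'a)" for i j
  have "fdet S Q = (\<Prod>i\<in>S. Q i i)"
    by (rule fdet_ranked[where h = "\<lambda>j. if j = c then 0 else 1"])
       (use assms in \<open>auto simp: Q_def\<close>)
  then have "fdet S Q = 1" by (simp add: Q_def)
  then have "fdet S A = fdet S (\<lambda>i j. \<Sum>k\<in>S. A i k * Q k j)"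
    by (simp add: fdet_mult[OF assms(1)])
  also have "\<dots> = 0"
  proof (rule fdet_zero_column[where j = c])
    show "finite S" "c \<in> S" using assms \<open>c \<in> C\<close> by auto
    fix i assume "i \<in> S"
    have "(\<Sum>k\<in>S. A i k * Q k c) = (\<Sum>k\<in>C. A i k)"
      using assms \<open>c \<in> C\<close>
      by (intro sum.mono_neutral_cong_right) (auto simp: Q_def)
    then show "(\<Sum>k\<in>S. A i k * Q k c) = 0" using zero[OF \<open>i \<in> S\<close>] by simp
  qed
  finally show ?thesis .
qed

text \<open>
  Only permutations that preserve \<open>S\<close> contribute, and these are the products of a permutation
  of \<open>S\<close> with a permutation of \<open>T\<close>.
\<close>

lemma fdet_block_triangular:
  fixes A :: "'i \<Rightarrow> 'i \<Rightarrow> 'a :: comm_ring_1"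
  assumes fin: "finite S" "finite T" and disj: "S \<inter> T = {}"
    and zero: "\<And>i j. i \<in> S \<Longrightarrow> j \<in> T \<Longrightarrow> A i j = 0"
  shows "fdet (S \<union> T) A = fdet S A * fdet T A"
proof -
  let ?P = "\<lambda>U. {\<pi>. \<pi> permutes U}"
  let ?t = "\<lambda>U \<pi>. of_int (sign \<pi>) * (\<Prod>i\<in>U. A i (\<pi> i))"
  let ?res = "\<lambda>U \<pi> i. if i \<in> U then \<pi> i else i"
  have "fdet (S \<union> T) A = (\<Sum>\<pi> | \<pi> permutes (S \<union> T) \<and> \<pi> ` S \<subseteq> S. ?t (S \<union> T) \<pi>)"
    unfolding fdet_def
  proof (rule sum.mono_neutral_right)
    show "\<forall>\<pi>\<in>?P (S \<union> T) - {\<pi>. \<pi> permutes (S \<union> T) \<and> \<pi> ` S \<subseteq> S}. ?t (S \<union> T) \<pi> = 0"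
    proof
      fix \<pi> assume *: "\<pi> \<in> ?P (S \<union> T) - {\<pi>. \<pi> permutes (S \<union> T) \<and> \<pi> ` S \<subseteq> S}"
      then obtain i where i: "i \<in> S" "\<pi> i \<notin> S" by auto
      have "\<pi> permutes (S \<union> T)" using * by simp
      from permutes_in_image[OF this, of i] i have "\<pi> i \<in> T" by auto
      then have "A i (\<pi> i) = 0" using zero i by blast
      then have "(\<Prod>i\<in>S \<union> T. A i (\<pi> i)) = 0"
        using fin i by (intro prod_zero) auto
      then show "?t (S \<union> T) \<pi> = 0" by simp
    qed
  qed (use fin in \<open>auto simp: finite_permutations\<close>)
  also have "\<dots> = (\<Sum>(\<sigma>, \<tau>)\<in>?P S \<times> ?P T. ?t S \<sigma> * ?t T \<tau>)"
  proof (rule sum.reindex_bij_witness[where i = "\<lambda>(\<sigma>, \<tau>). \<sigma> \<circ> \<tau>"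
        and j = "\<lambda>\<pi>. (?res S \<pi>, ?res T \<pi>)"])
    fix \<pi> assume "\<pi> \<in> {\<pi>. \<pi> permutes (S \<union> T) \<and> \<pi> ` S \<subseteq> S}"
    then have p: "\<pi> permutes (S \<union> T)" and sub: "\<pi> ` S \<subseteq> S" by auto
    have inj: "inj \<pi>" using p by (rule permutes_inj)
    have S: "\<pi> ` S = S"
      using sub fin inj by (meson card_image card_subset_eq inj_on_subset subset_UNIV)
    have T: "\<pi> ` T = T"
    proof -
      have "\<pi> ` (S \<union> T) = S \<union> T" using p by (rule permutes_image)
      moreover have "T = (S \<union> T) - S" using disj by auto
      ultimately show ?thesis using S inj by (metis image_set_diff)
    qed
    have pS: "?res S \<pi> permutes S"
      using S inj by (intro bij_imp_permutes) (auto simp: bij_betw_def inj_on_def)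
    have pT: "?res T \<pi> permutes T"
      using T inj by (intro bij_imp_permutes) (auto simp: bij_betw_def inj_on_def)
    have comp: "?res S \<pi> \<circ> ?res T \<pi> = \<pi>"
    proof
      fix i
      have "\<pi> i \<notin> S" if "i \<in> T" using T disj that by blast
      moreover have "\<pi> i = i" if "i \<notin> S" "i \<notin> T" using permutes_not_in[OF p, of i] that by simp
      ultimately show "(?res S \<pi> \<circ> ?res T \<pi>) i = \<pi> i" using disj by auto
    qed
    show "(case (?res S \<pi>, ?res T \<pi>) of (\<sigma>, \<tau>) \<Rightarrow> \<sigma> \<circ> \<tau>) = \<pi>"
      unfolding prod.case by (rule comp)
    show "(?res S \<pi>, ?res T \<pi>) \<in> ?P S \<times> ?P T" using pS pT by simp
    have "permutation (?res S \<pi>)" "permutation (?res T \<pi>)"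
      using pS pT fin unfolding permutation_permutes by blast+
    then have "sign (?res S \<pi> \<circ> ?res T \<pi>) = sign (?res S \<pi>) * sign (?res T \<pi>)"
      by (rule sign_compose)
    then have sign: "sign \<pi> = sign (?res S \<pi>) * sign (?res T \<pi>)"
      unfolding comp .
    have prod: "(\<Prod>i\<in>S \<union> T. A i (\<pi> i))
        = (\<Prod>i\<in>S. A i (?res S \<pi> i)) * (\<Prod>i\<in>T. A i (?res T \<pi> i))"
    proof -
      have "(\<Prod>i\<in>S. A i (?res S \<pi> i)) = (\<Prod>i\<in>S. A i (\<pi> i))"
        by (intro prod.cong) auto
      moreover have "(\<Prod>i\<in>T. A i (?res T \<pi> i)) = (\<Prod>i\<in>T. A i (\<pi> i))"
        by (intro prod.cong) auto
      ultimately show ?thesis by (simp only: prod.union_disjoint[OF fin disj])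
    qed
    show "(case (?res S \<pi>, ?res T \<pi>) of (\<sigma>, \<tau>) \<Rightarrow> ?t S \<sigma> * ?t T \<tau>) = ?t (S \<union> T) \<pi>"
      unfolding prod.case prod sign of_int_mult
      by (rule semiring_normalization_rules(13))
  next
    fix x assume "x \<in> ?P S \<times> ?P T"
    then obtain \<sigma> \<tau> where x: "x = (\<sigma>, \<tau>)" and p: "\<sigma> permutes S" "\<tau> permutes T" by auto
    have s: "(\<sigma> \<circ> \<tau>) i = \<sigma> i" if "i \<in> S" for i
    proof -
      have "i \<notin> T" using that disj by blast
      then show ?thesis using permutes_not_in[OF p(2), of i] by simp
    qed
    have t: "(\<sigma> \<circ> \<tau>) i = \<tau> i" if "i \<in> T" for i
    proof -
      have "\<tau> i \<in> T" using permutes_in_image[OF p(2), of i] that by simp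
      then have "\<tau> i \<notin> S" using disj by blast
      then show ?thesis using permutes_not_in[OF p(1), of "\<tau> i"] by simp
    qed
    have "?res S (\<sigma> \<circ> \<tau>) = \<sigma>"
    proof
      fix i show "?res S (\<sigma> \<circ> \<tau>) i = \<sigma> i"
        using s[of i] permutes_not_in[OF p(1), of i] by (cases "i \<in> S") auto
    qed
    moreover have "?res T (\<sigma> \<circ> \<tau>) = \<tau>"
    proof
      fix i show "?res T (\<sigma> \<circ> \<tau>) i = \<tau> i"
        using t[of i] permutes_not_in[OF p(2), of i] by (cases "i \<in> T") auto
    qed
    ultimately show "(?res S (case x of (\<sigma>, \<tau>) \<Rightarrow> \<sigma> \<circ> \<tau>), ?res T (case x of (\<sigma>, \<tau>) \<Rightarrow> \<sigma> \<circ> \<tau>)) = x"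
      unfolding x prod.case by (simp only:)
    have "\<sigma> permutes (S \<union> T)" "\<tau> permutes (S \<union> T)"
      using p by (auto intro: permutes_subset)
    then have "\<sigma> \<circ> \<tau> permutes (S \<union> T)" by (intro permutes_compose)
    moreover have "(\<sigma> \<circ> \<tau>) ` S \<subseteq> S" 
    proof
      fix j assume "j \<in> (\<sigma> \<circ> \<tau>) ` S"
      then obtain i where i: "i \<in> S" "j = (\<sigma> \<circ> \<tau>) i" by (rule imageE)
      then have "j = \<sigma> i" using s by simp
      then show "j \<in> S" using permutes_in_image[OF p(1), of i] i by simp
    qed
    ultimately show "(case x of (\<sigma>, \<tau>) \<Rightarrow> \<sigma> \<circ> \<tau>) \<in> {\<pi>. \<pi> permutes (S \<union> T) \<and> \<pi> ` S \<subseteq> S}"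
      by (simp add: x)
  qed
  also have "\<dots> = fdet S A * fdet T A"
    unfolding fdet_def sum_product by (rule sum.cartesian_product[symmetric])
  finally show ?thesis .
qed

lemma fdet_block_diagonal:
  assumes "finite K" "finite S"
    and zero: "\<And>k l u v. k \<in> K \<Longrightarrow> l \<in> K \<Longrightarrow> k \<noteq> l \<Longrightarrow> u \<in> S \<Longrightarrow> v \<in> S \<Longrightarrow> A (k, u) (l, v) = 0"
  shows "fdet (K \<times> S) A = (\<Prod>k\<in>K. fdet S (\<lambda>u v. A (k, u) (k, v)))"
  using assms(1) zero
proof (induction K)
  case empty
  show ?case by (simp add: fdet_def sign_id)
next
  case (insert k K)
  have "fdet (insert k K \<times> S) A = fdet (({k} \<times> S) \<union> (K \<times> S)) A"
    by (rule arg_cong[where f = "\<lambda>X. fdet X A"]) auto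
  also have "\<dots> = fdet ({k} \<times> S) A * fdet (K \<times> S) A"
    by (rule fdet_block_triangular) (use insert assms(2) in auto)
  also have "fdet ({k} \<times> S) A = fdet S (\<lambda>u v. A (k, u) (k, v))"
    by (rule fdet_reindex) (auto simp: bij_betw_def inj_on_def assms(2))
  finally show ?case using insert by simp
qed

lemma fdet_singleton [simp]: "fdet {i} A = A i i"
proof -
  have "fdet {i} A = (\<Prod>i\<in>{i}. A i i)" by (rule fdet_ranked[where h = "\<lambda>_. 0"]) auto
  then show ?thesis by simp
qed

lemma fdet_hom:
  fixes h :: "'a :: comm_ring_1 \<Rightarrow> 'b :: comm_ring_1" and A :: "'i \<Rightarrow> 'i \<Rightarrow> 'a"
  assumes "h 0 = 0" "h 1 = 1" "\<And>x y. h (x + y) = h x + h y" "\<And>x y. h (x * y) = h x * h y"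
  shows "h (fdet S A) = fdet S (\<lambda>i j. h (A i j))"
proof -
  have sum: "h (sum f X) = (\<Sum>x\<in>X. h (f x))" for f :: "('i \<Rightarrow> 'i) \<Rightarrow> 'a" and X
    by (induction X rule: infinite_finite_induct) (auto simp: assms)
  have prod: "h (prod f X) = (\<Prod>x\<in>X. h (f x))" for f :: "'i \<Rightarrow> 'a" and X
    by (induction X rule: infinite_finite_induct) (auto simp: assms)
  have "h (- 1) + h 1 = h (- 1 + 1)" by (simp only: assms)
  then have "h (- 1) = - 1" by (simp add: assms eq_neg_iff_add_eq_0)
  then have "h (of_int (sign \<pi>)) = of_int (sign \<pi>)" for \<pi> :: "'i \<Rightarrow> 'i"
    by (cases "evenperm \<pi>") (simp_all add: sign_def assms)
  then show ?thesis by (simp add: fdet_def sum prod assms)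
qed

lemma fdet_cong_dvd:
  fixes A B :: "'i \<Rightarrow> 'i \<Rightarrow> 'a :: comm_ring_1"
  assumes "\<And>i j. i \<in> S \<Longrightarrow> j \<in> S \<Longrightarrow> m dvd A i j - B i j"
  shows "m dvd fdet S A - fdet S B"
proof -
  have prod: "m dvd prod f X - prod g X" if "\<And>x. x \<in> X \<Longrightarrow> m dvd f x - g x" for f g :: "'i \<Rightarrow> 'a" and X
    using that
  proof (induction X rule: infinite_finite_induct)
    case (insert x X)
    have "f x * prod f X - g x * prod g X
        = f x * (prod f X - prod g X) + (f x - g x) * prod g X" by (simp add: algebra_simps)
    then show ?case using insert by (simp add: dvd_add)
  qed auto
  have "fdet S A - fdet S B
      = (\<Sum>\<pi> | \<pi> permutes S. of_int (sign \<pi>) * ((\<Prod>i\<in>S. A i (\<pi> i)) - (\<Prod>i\<in>S. B i (\<pi> i))))"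
    by (simp add: fdet_def sum_subtractf right_diff_distrib)
  also have "m dvd \<dots>"
  proof (intro dvd_sum dvd_mult prod assms)
    fix \<pi> i assume "\<pi> \<in> {\<pi>. \<pi> permutes S}" "i \<in> S"
    then show "\<pi> i \<in> S" by (simp add: permutes_in_image)
  qed
  finally show ?thesis .
qed

lemma fdet_sum_into_row:
  fixes A :: "'i \<Rightarrow> 'i \<Rightarrow> 'a :: comm_ring_1"
  assumes "finite S" "r \<in> S"
  shows "fdet S (\<lambda>i j. if i = r then (\<Sum>k\<in>S. A k j) else A i j) = fdet S A"
proof -
  define P where "P i j = (if i = j \<or> i = r then 1 else 0 :: 'a)" for i j
  have "fdet S P = (\<Prod>i\<in>S. P i i)"
    by (rule fdet_ranked[where h = "\<lambda>i. if i = r then 1 else 0"]) (use assms in \<open>auto simp: P_def\<close>)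
  then have "fdet S P = 1" by (simp add: P_def)
  then have "fdet S A = fdet S (\<lambda>i j. \<Sum>k\<in>S. P i k * A k j)"
    by (simp add: fdet_mult[OF assms(1)])
  also have "\<dots> = fdet S (\<lambda>i j. if i = r then (\<Sum>k\<in>S. A k j) else A i j)"
    by (rule fdet_cong) (use assms in \<open>auto simp: P_def if_distrib[of "\<lambda>x. x * _"] sum.delta' cong: if_cong\<close>)
  finally show ?thesis by simp
qed

lemma fdet_sum_into_column:
  fixes A :: "'i \<Rightarrow> 'i \<Rightarrow> 'a :: comm_ring_1"
  assumes "finite S" "r \<in> S"
  shows "fdet S (\<lambda>i j. if j = r then (\<Sum>k\<in>S. A i k) else A i j) = fdet S A"
  using fdet_sum_into_row[OF assms, of "\<lambda>i j. A j i"]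
    fdet_transpose[OF assms(1), of "\<lambda>i j. if j = r then (\<Sum>k\<in>S. A i k) else A i j"]
    fdet_transpose[OF assms(1), of A]
  by simp

lemma fdet_subtract_row:
  fixes A :: "'i \<Rightarrow> 'i \<Rightarrow> 'a :: comm_ring_1"
  assumes "finite S" "r \<in> S"
  shows "fdet S (\<lambda>i j. if i = r then A i j else A i j - c * A r j) = fdet S A"
proof -
  define U where "U i j = (if i = j then 1 else if j = r then - c else 0)" for i j
  have "fdet S U = (\<Prod>i\<in>S. U i i)"
    by (rule fdet_ranked[where h = "\<lambda>i. if i = r then 0 else 1"]) (use assms in \<open>auto simp: U_def\<close>)
  then have "fdet S U = 1" by (simp add: U_def)
  then have "fdet S A = fdet S (\<lambda>i j. \<Sum>k\<in>S. U i k * A k j)"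
    by (simp add: fdet_mult[OF assms(1)])
  also have "\<dots> = fdet S (\<lambda>i j. if i = r then A i j else A i j - c * A r j)"
  proof (rule fdet_cong)
    fix i j assume "i \<in> S" "j \<in> S"
    have "(\<Sum>k\<in>S. U i k * A k j) = (\<Sum>k\<in>S. (if k = i then A i j else 0) + (if k = r then (if i = r then 0 else - c * A r j) else 0))"
      by (intro sum.cong) (auto simp: U_def)
    then show "(\<Sum>k\<in>S. U i k * A k j) = (if i = r then A i j else A i j - c * A r j)"
      using assms \<open>i \<in> S\<close> by (simp add: sum.distrib sum.delta)
  qed
  finally show ?thesis by simp
qed

text \<open>
  Adding all rows to row \<open>r\<close> and then all columns to column \<open>r\<close> makes the border constant:
  it becomes \<open>c * N\<close> with corner \<open>c * N ^ 2\<close>, where \<open>N = card S\<close>. Subtracting the multiple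
  \<open>1 / N\<close> of row \<open>r\<close> from the other rows removes both \<open>c\<close> and the border column. For a Laplacian
  \<open>M\<close> this trades the principal minor, which breaks the symmetry of a covering by the choice of
  \<open>r\<close>, for a determinant that is invariant under deck transformations.
\<close>

lemma fdet_add_constant:
  fixes M :: "'i \<Rightarrow> 'i \<Rightarrow> 'a :: field_char_0"
  assumes S: "finite S" "r \<in> S"
    and rows: "\<And>i. i \<in> S \<Longrightarrow> (\<Sum>j\<in>S. M i j) = 0"
    and cols: "\<And>j. j \<in> S \<Longrightarrow> (\<Sum>i\<in>S. M i j) = 0"
  shows "fdet S (\<lambda>i j. M i j + c) = c * of_nat (card S) ^ 2 * fdet (S - {r}) M"
proof -
  define N :: 'a where "N = of_nat (card S)"
  have "card S > 0" using S by (auto simp: card_gt_0_iff)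
  then have N: "N \<noteq> 0" by (simp add: N_def)
  define A1 where "A1 i j = (if i = r then (\<Sum>k\<in>S. M k j + c) else M i j + c)" for i j
  define A2 where "A2 i j = (if j = r then (\<Sum>k\<in>S. A1 i k) else A1 i j)" for i j
  define A3 where "A3 i j = (if i = r then A2 i j else A2 i j - inverse N * A2 r j)" for i j
  have A1r: "A1 r j = c * N" if "j \<in> S" for j
    using cols[OF that] by (simp add: A1_def sum.distrib N_def)
  have A2: "A2 r r = c * N ^ 2" "\<And>j. j \<in> S \<Longrightarrow> j \<noteq> r \<Longrightarrow> A2 r j = c * N"
    "\<And>i. i \<in> S \<Longrightarrow> i \<noteq> r \<Longrightarrow> A2 i r = c * N"
    "\<And>i j. i \<noteq> r \<Longrightarrow> j \<noteq> r \<Longrightarrow> A2 i j = M i j + c"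
  proof -
    have "A2 r r = (\<Sum>k\<in>S. c * N)" unfolding A2_def using A1r by simp
    then show "A2 r r = c * N ^ 2" by (simp add: N_def power2_eq_square)
    show "A2 i r = c * N" if "i \<in> S" "i \<noteq> r" for i
      using rows[OF that(1)] that(2) by (simp add: A2_def A1_def sum.distrib N_def)
  qed (auto simp: A2_def A1r, simp add: A1_def)
  have "fdet S (\<lambda>i j. M i j + c) = fdet S A1"
    unfolding A1_def by (rule fdet_sum_into_row[OF S, symmetric])
  also have "\<dots> = fdet S A2"
    unfolding A2_def by (rule fdet_sum_into_column[OF S, symmetric])
  also have "\<dots> = fdet S A3"
    unfolding A3_def by (rule fdet_subtract_row[OF S, symmetric])
  also have "S = (S - {r}) \<union> {r}" using S by auto
  then have "fdet S A3 = fdet ((S - {r}) \<union> {r}) A3" by simp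
  also have "\<dots> = fdet (S - {r}) A3 * fdet {r} A3"
    by (rule fdet_block_triangular) (use S N A2 in \<open>auto simp: A3_def power2_eq_square\<close>)
  also have "fdet (S - {r}) A3 = fdet (S - {r}) M"
    by (rule fdet_cong) (use A2 N in \<open>auto simp: A3_def\<close>)
  finally show ?thesis using A2 by (simp add: A3_def N_def)
qed

text \<open>
  The residue of \<open>b - a\<close> is written with \<open>b + N - a\<close> to keep the subtraction of natural numbers
  exact.
\<close>

lemma cyclic_diff_eq_iff:
  fixes a b c N :: nat
  assumes "a < N" "b < N" "c < N"
  shows "(b + N - a) mod N = c \<longleftrightarrow> b = (a + c) mod N"
proof -
  have "(b + N - a) mod N = (if a \<le> b then b - a else b + N - a)"
  proof (cases "a \<le> b")
    case True
    then have "b + N - a = (b - a) + N" by simp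
    then have "(b + N - a) mod N = (b - a) mod N" by simp
    then show ?thesis using True assms by simp
  qed (use assms in simp)
  moreover have "(a + c) mod N = (if a + c < N then a + c else a + c - N)"
    using assms by (simp add: mod_if)
  ultimately show ?thesis using assms by auto
qed

lemma root_of_unity_sum:
  fixes z :: complex
  assumes "z ^ N = 1" "z \<noteq> 1"
  shows "(\<Sum>k<N. z ^ k) = 0"
  using assms by (simp add: geometric_sum)

text \<open>
  The Fourier matrix \<open>F\<close>, with entries \<open>\<zeta> k ^ a\<close> on the residues and the identity on \<open>V\<close>,
  conjugates the block circulant matrix into the block diagonal one whose blocks are the Fourier
  transforms of \<open>M\<close>.
\<close>

lemma fdet_block_circulant:
  fixes M :: "nat \<Rightarrow> 'v \<Rightarrow> 'v \<Rightarrow> complex"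
  assumes N: "N > 0" and V: "finite V"
  shows "fdet ({..<N} \<times> V) (\<lambda>x y. M ((fst y + N - fst x) mod N) (snd x) (snd y))
       = (\<Prod>z | z ^ N = 1. fdet V (\<lambda>u v. \<Sum>c<N. M c u v * z ^ c))"
proof -
  define \<zeta> where "\<zeta> k = cis (2 * pi * real k / real N)" for k
  have bij: "bij_betw \<zeta> {..<N} {z. z ^ N = 1}"
    unfolding \<zeta>_def using N by (rule Complex.bij_betw_roots_unity)
  have root: "\<zeta> k ^ N = 1" if "k < N" for k
    using bij that by (auto simp: bij_betw_def)
  have nz: "\<zeta> k \<noteq> 0" for k by (simp add: \<zeta>_def)
  let ?I = "{..<N} \<times> V"
  define B where "B x y = M ((fst y + N - fst x) mod N) (snd x) (snd y)" for x y
  define D where "D k u v = (\<Sum>c<N. M c u v * \<zeta> k ^ c)" for k u v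
  define DD where "DD x y = (if fst x = fst y then D (fst x) (snd x) (snd y) else 0)" for x y
  define F where "F x y = (if snd x = snd y then \<zeta> (fst y) ^ fst x else 0)" for x y :: "nat \<times> 'v"
  define F' where "F' x y = (if snd x = snd y then inverse (\<zeta> (fst x)) ^ fst y else 0)" for x y :: "nat \<times> 'v"
  have finI: "finite ?I" using V by simp
  have sumI: "(\<Sum>y\<in>?I. g y) = (\<Sum>a<N. \<Sum>v\<in>V. g (a, v))" for g :: "nat \<times> 'v \<Rightarrow> complex"
    by (simp add: sum.cartesian_product)
  have FF: "(\<Sum>y\<in>?I. F' x y * F y w) = (if x = w then of_nat N else 0)" if xw: "x \<in> ?I" "w \<in> ?I" for x w
  proof -
    obtain k u l v where x: "x = (k, u)" "k < N" "u \<in> V" and w: "w = (l, v)" "l < N" "v \<in> V"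
      using xw by auto
    have "(\<Sum>y\<in>?I. F' x y * F y w) = (\<Sum>a<N. if u = v then (\<zeta> l / \<zeta> k) ^ a else 0)"
      unfolding sumI
    proof (intro sum.cong refl)
      fix a
      have "(\<Sum>t\<in>V. F' x (a, t) * F (a, t) w)
          = (\<Sum>t\<in>V. if t = u then (if u = v then (\<zeta> l / \<zeta> k) ^ a else 0) else 0)"
        by (intro sum.cong) (auto simp: F_def F'_def x w power_mult_distrib[symmetric] divide_inverse mult.commute)
      then show "(\<Sum>t\<in>V. F' x (a, t) * F (a, t) w) = (if u = v then (\<zeta> l / \<zeta> k) ^ a else 0)"
        using V x by (simp add: sum.delta)
    qed
    also have "\<dots> = (if x = w then of_nat N else 0)"
    proof (cases "k = l")
      case True
      then show ?thesis using nz by (simp add: x w)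
    next
      case False
      then have "\<zeta> l \<noteq> \<zeta> k" using bij x w by (auto simp: bij_betw_def inj_on_def)
      then have "\<zeta> l / \<zeta> k \<noteq> 1" using nz by simp
      moreover have "(\<zeta> l / \<zeta> k) ^ N = 1" using root x w by (simp add: power_divide)
      ultimately have "(\<Sum>a<N. (\<zeta> l / \<zeta> k) ^ a) = 0" by (intro root_of_unity_sum)
      then show ?thesis using False by (cases "u = v") (simp_all add: x w)
    qed
    finally show ?thesis .
  qed
  have "fdet ?I F' * fdet ?I F = fdet ?I (\<lambda>x w. \<Sum>y\<in>?I. F' x y * F y w)"
    by (rule fdet_mult[OF finI, symmetric])
  also have "\<dots> = fdet ?I (\<lambda>x w. if x = w then of_nat N else 0)"
    by (rule fdet_cong) (rule FF)
  also have "\<dots> = (\<Prod>x\<in>?I. of_nat N)"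
    by (subst fdet_ranked[where h = "\<lambda>_. 0", OF finI]) auto
  finally have "fdet ?I F' * fdet ?I F \<noteq> 0" using N by simp
  then have "fdet ?I F \<noteq> 0" by auto
  have "(\<Sum>y\<in>?I. B x y * F y w) = (\<Sum>y\<in>?I. F x y * DD y w)" if xw: "x \<in> ?I" "w \<in> ?I" for x w
  proof -
    obtain a u k v where x: "x = (a, u)" "a < N" "u \<in> V" and w: "w = (k, v)" "k < N" "v \<in> V"
      using xw by auto
    have "(\<Sum>y\<in>?I. B x y * F y w) = (\<Sum>b<N. M ((b + N - a) mod N) u v * \<zeta> k ^ b)"
      unfolding sumI
    proof (intro sum.cong refl)
      fix b
      have "(\<Sum>t\<in>V. B x (b, t) * F (b, t) w)
          = (\<Sum>t\<in>V. if t = v then M ((b + N - a) mod N) u v * \<zeta> k ^ b else 0)"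
        by (intro sum.cong) (auto simp: F_def B_def x w)
      then show "(\<Sum>t\<in>V. B x (b, t) * F (b, t) w) = M ((b + N - a) mod N) u v * \<zeta> k ^ b"
        using V w by (simp add: sum.delta)
    qed
    also have "\<dots> = (\<Sum>c<N. M c u v * \<zeta> k ^ ((c + a) mod N))"
      by (rule sum.reindex_bij_witness[where i = "\<lambda>c. (c + a) mod N" and j = "\<lambda>b. (b + N - a) mod N"])
         (use x N in \<open>auto simp: mod_simps less_imp_le add.commute mod_add_left_eq mod_add_right_eq mod_if\<close>)
    also have "\<dots> = (\<Sum>c<N. M c u v * (\<zeta> k ^ c * \<zeta> k ^ a))"
    proof (intro sum.cong refl arg_cong2[where f = "(*)"])
      fix c
      have "\<zeta> k ^ (c + a) = \<zeta> k ^ ((c + a) mod N + N * ((c + a) div N))" by simp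
      also have "\<dots> = \<zeta> k ^ ((c + a) mod N)"
        unfolding power_add power_mult root[OF w(2)] by simp
      finally show "\<zeta> k ^ ((c + a) mod N) = \<zeta> k ^ c * \<zeta> k ^ a" by (simp add: power_add)
    qed
    also have "\<dots> = \<zeta> k ^ a * D k u v"
      by (simp add: D_def sum_distrib_left mult_ac)
    also have "\<dots> = (\<Sum>y\<in>?I. F x y * DD y w)"
    proof -
      have "(\<Sum>y\<in>?I. F x y * DD y w) = (\<Sum>y\<in>?I. if y = (k, u) then \<zeta> k ^ a * D k u v else 0)"
        by (intro sum.cong) (auto simp: F_def DD_def x w)
      then show ?thesis using V w x by (simp add: sum.delta)
    qed
    finally show ?thesis .
  qed
  then have "fdet ?I (\<lambda>x w. \<Sum>y\<in>?I. B x y * F y w) = fdet ?I (\<lambda>x w. \<Sum>y\<in>?I. F x y * DD y w)"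
    by (intro fdet_cong)
  then have "fdet ?I B = fdet ?I DD"
    using \<open>fdet ?I F \<noteq> 0\<close> by (simp add: fdet_mult[OF finI])
  also have "\<dots> = (\<Prod>k<N. fdet V (\<lambda>u v. DD (k, u) (k, v)))"
    by (rule fdet_block_diagonal) (use V in \<open>auto simp: DD_def\<close>)
  also have "\<dots> = (\<Prod>k<N. fdet V (\<lambda>u v. \<Sum>c<N. M c u v * \<zeta> k ^ c))"
    by (simp add: DD_def D_def)
  also have "\<dots> = (\<Prod>z | z ^ N = 1. fdet V (\<lambda>u v. \<Sum>c<N. M c u v * z ^ c))"
    by (rule prod.reindex_bij_betw[OF bij])
  finally show ?thesis by (simp add: B_def[abs_def])
qed


section \<open>The matrix-tree theorem\<close>

definition laplacian :: "('a, 'b) pre_digraph \<Rightarrow> 'a \<Rightarrow> 'a \<Rightarrow> 'c :: comm_ring_1" where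
  "laplacian G u v = (\<Sum>e\<in>out_arcs G u. of_bool (u = v) - of_bool (head G e = v))"

text \<open>
  Spanning trees oriented towards the root \<open>r\<close>, given by the arc with which each other vertex
  starts its path to \<open>r\<close>. Some \<open>h\<close> decreases along these arcs exactly if all paths end in \<open>r\<close>.
\<close>

definition arborescences :: "('a, 'b) pre_digraph \<Rightarrow> 'a \<Rightarrow> ('a \<Rightarrow> 'b) set" where
  "arborescences G r = {f \<in> Pi\<^sub>E (verts G - {r}) (out_arcs G).
     \<exists>h :: 'a \<Rightarrow> nat. \<forall>u \<in> verts G - {r}. h (head G (f u)) < h u}"

text \<open>
  If the chosen arcs lead every vertex to \<open>r\<close>, the matrix is triangular with respect to the
  distance from \<open>r\<close>. Otherwise the set of vertices that never reach \<open>r\<close> is closed under following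
  arcs in both directions, so that all its row sums vanish.
\<close>

lemma fdet_out_arc_choice:
  assumes "fin_digraph G" "r \<in> verts G" and f: "f \<in> Pi\<^sub>E (verts G - {r}) (out_arcs G)"
  shows "fdet (verts G - {r}) (\<lambda>u v. of_bool (u = v) - of_bool (head G (f u) = v))
       = (of_bool (f \<in> arborescences G r) :: 'c :: comm_ring_1)"
proof -
  interpret fin_digraph G by fact
  define W where "W = verts G - {r}"
  define step where "step u = head G (f u)" for u
  have W: "finite W" by (simp add: W_def)
  have stepW: "step u \<in> verts G" if "u \<in> W" for u
    using PiE_mem[OF f, of u] that by (simp add: step_def W_def)
  let ?A = "\<lambda>u v. of_bool (u = v) - of_bool (step u = v) :: 'c"
  have "fdet W ?A = of_bool (f \<in> arborescences G r)"
  proof (cases "f \<in> arborescences G r")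
    case True
    then obtain h :: "'a \<Rightarrow> nat" where h: "\<And>u. u \<in> W \<Longrightarrow> h (step u) < h u"
      by (auto simp: arborescences_def W_def step_def)
    have "fdet W ?A = (\<Prod>u\<in>W. ?A u u)"
      by (rule fdet_ranked[OF W, where h = h]) (use h in \<open>auto simp: not_less[symmetric]\<close>)
    also have "\<dots> = 1"
      by (intro prod.neutral ballI) (use h in force)
    finally show ?thesis using True by simp
  next
    case False
    define C where "C = {u \<in> W. \<forall>n. (step ^^ n) u \<noteq> r}"
    have "C \<noteq> {}"
    proof
      assume "C = {}"
      then have reach: "\<exists>n. (step ^^ n) u = r" if "u \<in> W" for u
        using that by (auto simp: C_def)
      define h where "h u = (LEAST n. (step ^^ n) u = r)" for u
      have "h (step u) < h u" if "u \<in> W" for u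
      proof -
        have *: "(step ^^ h u) u = r"
          unfolding h_def using reach[OF that] by (rule LeastI_ex)
        then have "h u \<noteq> 0" using that by (auto simp: W_def intro: ccontr)
        then obtain n where n: "h u = Suc n" by (cases "h u") auto
        then have "(step ^^ n) (step u) = r" using * by (simp add: funpow_swap1)
        then have "h (step u) \<le> n" unfolding h_def by (rule Least_le)
        then show ?thesis using n by simp
      qed
      then show False using False f by (auto simp: arborescences_def W_def step_def)
    qed
    have "fdet W ?A = 0"
    proof (rule fdet_vanishing_row_sums[OF W _ \<open>C \<noteq> {}\<close>])
      show CW: "C \<subseteq> W" by (auto simp: C_def)
      fix u assume u: "u \<in> W"
      have "(\<forall>n. (step ^^ n) u \<noteq> r) \<longleftrightarrow> (\<forall>n. (step ^^ n) (step u) \<noteq> r)"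
      proof
        assume *: "\<forall>n. (step ^^ n) u \<noteq> r"
        have "(step ^^ n) (step u) = (step ^^ Suc n) u" for n by (simp add: funpow_swap1)
        then show "\<forall>n. (step ^^ n) (step u) \<noteq> r" using * by metis
      next
        assume *: "\<forall>n. (step ^^ n) (step u) \<noteq> r"
        have "(step ^^ n) u \<noteq> r" for n
          using * u by (cases n) (auto simp: W_def funpow_swap1)
        then show "\<forall>n. (step ^^ n) u \<noteq> r" by blast
      qed
      moreover have "step u \<noteq> r \<Longrightarrow> step u \<in> W" using stepW[OF u] by (simp add: W_def)
      ultimately have "u \<in> C \<longleftrightarrow> step u \<in> C"
        using u unfolding C_def by (auto dest: spec[of _ 0])
      moreover have "finite C" using CW W by (rule finite_subset)
      ultimately show "(\<Sum>v\<in>C. ?A u v) = 0"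
        by (simp add: sum_subtractf of_bool_def sum.delta)
    qed
    then show ?thesis using False by simp
  qed
  then show ?thesis by (simp add: W_def step_def)
qed

text \<open>
  Each row of the Laplacian is a sum over the arcs leaving a vertex; expanding the determinant
  linearly in all rows gives one term for each choice of arcs.
\<close>

lemma fdet_laplacian_eq_card_arborescences:
  assumes "fin_digraph G" "r \<in> verts G"
  shows "fdet (verts G - {r}) (laplacian G) = (of_nat (card (arborescences G r)) :: 'c :: comm_ring_1)"
proof -
  interpret fin_digraph G by fact
  let ?F = "Pi\<^sub>E (verts G - {r}) (out_arcs G)"
  have fin: "finite ?F" by (intro finite_PiE) auto
  have "fdet (verts G - {r}) (laplacian G)
      = (\<Sum>f\<in>?F. fdet (verts G - {r}) (\<lambda>u v. of_bool (u = v) - of_bool (head G (f u) = v)) :: 'c)"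
    unfolding laplacian_def by (rule fdet_row_sums) auto
  also have "\<dots> = (\<Sum>f\<in>?F. of_bool (f \<in> arborescences G r))"
    using assms by (intro sum.cong refl fdet_out_arc_choice)
  also have "\<dots> = of_nat (card (?F \<inter> arborescences G r))"
    using fin by (simp add: of_bool_def sum.If_cases)
  also have "?F \<inter> arborescences G r = arborescences G r"
    by (auto simp: arborescences_def)
  finally show ?thesis .
qed

locale serre_graph = fin_digraph G + bidirected_digraph G arev
  for G :: "('a, 'b) pre_digraph" and arev :: "'b \<Rightarrow> 'b"
begin

definition tree_of :: "'a \<Rightarrow> ('a \<Rightarrow> 'b) \<Rightarrow> ('a, 'b) pre_digraph" where
  "tree_of r f = G\<lparr>arcs := f ` (verts G - {r}) \<union> arev ` f ` (verts G - {r})\<rparr>"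

lemma tree_of_sel [simp]:
  "verts (tree_of r f) = verts G" "tail (tree_of r f) = tail G" "head (tree_of r f) = head G"
  by (simp_all add: tree_of_def)

text \<open>
  An arc of the tree either leaves its tail towards the root, or it is the reverse of the arc by
  which its head leaves towards the root. Comparing heights in the two cases replaces reasoning about
  paths in the lemmas on uniqueness and on circuits.
\<close>

lemma arborescenceE:
  assumes "f \<in> arborescences G r"
  obtains h :: "'a \<Rightarrow> nat" where
    "\<And>u. u \<in> verts G - {r} \<Longrightarrow> h (head G (f u)) < h u"
    "\<And>u. u \<in> verts G - {r} \<Longrightarrow> f u \<in> arcs G"
    "\<And>u. u \<in> verts G - {r} \<Longrightarrow> tail G (f u) = u"
    "\<And>e. e \<in> arcs (tree_of r f) \<Longrightarrow>
       e \<in> arcs G \<and> ((tail G e \<in> verts G - {r} \<and> e = f (tail G e)) \<or>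
          (head G e \<in> verts G - {r} \<and> e = arev (f (head G e))))"
proof -
  obtain h :: "'a \<Rightarrow> nat" where h: "\<And>u. u \<in> verts G - {r} \<Longrightarrow> h (head G (f u)) < h u"
    and f: "f \<in> Pi\<^sub>E (verts G - {r}) (out_arcs G)"
    using assms by (auto simp: arborescences_def)
  have f1: "f u \<in> arcs G" "tail G (f u) = u" if "u \<in> verts G - {r}" for u
    using PiE_mem[OF f that] by auto
  show ?thesis
  proof (rule that[of h])
    fix e assume "e \<in> arcs (tree_of r f)"
    then consider u where "u \<in> verts G - {r}" "e = f u" | u where "u \<in> verts G - {r}" "e = arev (f u)"
      by (auto simp: tree_of_def)
    then show "e \<in> arcs G \<and> ((tail G e \<in> verts G - {r} \<and> e = f (tail G e)) \<or>
          (head G e \<in> verts G - {r} \<and> e = arev (f (head G e))))"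
      by cases (use f1 in auto)
  qed (use h f1 in auto)
qed

lemma spanning_tree_of:
  assumes "f \<in> arborescences G r"
  shows "spanning (tree_of r f) G"
proof -
  obtain h :: "'a \<Rightarrow> nat" where h:
    "\<And>e. e \<in> arcs (tree_of r f) \<Longrightarrow> e \<in> arcs G"
    using assms by (rule arborescenceE) blast
  then have "wf_digraph (tree_of r f)"
    by unfold_locales auto
  then show ?thesis
    using h wf_digraph_axioms by (auto simp: spanning_def subgraph_def compatible_def)
qed

lemma arev_arcs_tree_of: "arev ` arcs (tree_of r f) \<subseteq> arcs (tree_of r f)"
  by (auto simp: tree_of_def)

lemma connected_tree_of:
  assumes f: "f \<in> arborescences G r" and r: "r \<in> verts G"
  shows "Digraph_Component.connected (tree_of r f)"
proof -
  obtain h :: "'a \<Rightarrow> nat" where h: "\<And>u. u \<in> verts G - {r} \<Longrightarrow> h (head G (f u)) < h u"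
    "\<And>u. u \<in> verts G - {r} \<Longrightarrow> f u \<in> arcs G"
    "\<And>u. u \<in> verts G - {r} \<Longrightarrow> tail G (f u) = u"
    using f by (rule arborescenceE) blast
  let ?R = "rtrancl_on (verts G) ((arcs_ends (tree_of r f))\<^sup>s)"
  have to_r: "(u, r) \<in> ?R" if "u \<in> verts G" for u
    using that
  proof (induction "h u" arbitrary: u rule: less_induct)
    case less
    show ?case
    proof (cases "u = r")
      case True
      then show ?thesis using r by simp
    next
      case False
      then have u: "u \<in> verts G - {r}" using less by simp
      have "(u, head G (f u)) \<in> arcs_ends (tree_of r f)"
        using h(3)[OF u] u by (auto simp: arcs_ends_conv tree_of_def intro!: image_eqI[of _ _ "f u"])
      moreover have "head G (f u) \<in> verts G" using h(2)[OF u] by simp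
      ultimately show ?thesis using less h(1)[OF u]
        by (intro converse_rtrancl_on_into_rtrancl_on[of u "head G (f u)"]) (auto simp: symcl_def)
    qed
  qed
  have "sym ?R" by (intro rtrancl_on_sym) (auto simp: sym_def symcl_def)
  then have "(u, v) \<in> ?R" if "u \<in> verts G" "v \<in> verts G" for u v
    using to_r[OF that(1)] to_r[OF that(2)] by (meson rtrancl_on_trans symD)
  then show ?thesis using r by (auto simp: connected_conv)
qed


text \<open>
  Suppose \<open>f\<close> and \<open>f'\<close> give the same tree but differ at \<open>u\<close>, with \<open>u\<close> of least height for \<open>f'\<close>.
  Then \<open>f' u\<close> is the reverse of the arc that \<open>f\<close>, hence by minimality also \<open>f'\<close>, chooses at the
  head of \<open>f' u\<close>: both ends of this arc would be lower than the other.
\<close>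

lemma inj_on_tree_of: "inj_on (tree_of r) (arborescences G r)"
proof (rule inj_onI)
  fix f f' assume f: "f \<in> arborescences G r" and f': "f' \<in> arborescences G r"
    and eq: "tree_of r f = tree_of r f'"
  obtain h :: "'a \<Rightarrow> nat" where h: "\<And>u. u \<in> verts G - {r} \<Longrightarrow> f u \<in> arcs G"
    "\<And>u. u \<in> verts G - {r} \<Longrightarrow> tail G (f u) = u"
    "\<And>e. e \<in> arcs (tree_of r f) \<Longrightarrow>
       e \<in> arcs G \<and> ((tail G e \<in> verts G - {r} \<and> e = f (tail G e)) \<or>
          (head G e \<in> verts G - {r} \<and> e = arev (f (head G e))))"
    using f by (rule arborescenceE) blast
  obtain h' :: "'a \<Rightarrow> nat" where h': "\<And>u. u \<in> verts G - {r} \<Longrightarrow> h' (head G (f' u)) < h' u"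
    "\<And>u. u \<in> verts G - {r} \<Longrightarrow> f' u \<in> arcs G"
    "\<And>u. u \<in> verts G - {r} \<Longrightarrow> tail G (f' u) = u"
    using f' by (rule arborescenceE) blast
  have "f u = f' u" if "u \<in> verts G - {r}" for u
    using that
  proof (induction "h' u" arbitrary: u rule: less_induct)
    case less
    have "f' u \<in> arcs (tree_of r f')" using less.prems by (simp add: tree_of_def)
    then have "f' u \<in> arcs (tree_of r f)" by (simp add: eq)
    from h(3)[OF this] consider "f' u = f u"
      | "head G (f' u) \<in> verts G - {r}" "f' u = arev (f (head G (f' u)))"
      using h'(3)[OF less.prems] by auto
    then show ?case
    proof cases
      case 2
      define x where "x = head G (f' u)"
      have "f x = f' x"
        using less.hyps[of x] 2 h'(1)[OF less.prems] by (simp add: x_def)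
      then have "f' u = arev (f' x)" using 2 by (simp add: x_def)
      then have "head G (f' x) = u"
        using tail_arev[OF h'(2)[of x]] h'(3)[OF less.prems] 2 by (metis x_def)
      then show ?thesis using h'(1)[of x] h'(1)[OF less.prems] 2 by (simp add: x_def)
    qed simp
  qed
  moreover have "f \<in> extensional (verts G - {r})" "f' \<in> extensional (verts G - {r})"
    using f f' by (auto simp: arborescences_def PiE_def)
  ultimately show "f = f'" by (rule extensionalityI[rotated 2])
qed

text \<open>
  At a vertex \<open>w\<close> of greatest height on a directed cycle, both the arc leaving \<open>w\<close> and the
  reverse of the arc entering it must be the one arc with which \<open>w\<close> starts its path to the root.
  So the cycle goes back along the arc on which it came, and having no repeated vertices it is of
  the excluded form \<open>[e, arev e]\<close>.
\<close>

lemma tree_of_no_circuit: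
  assumes f: "f \<in> arborescences G r"
  shows "\<not> circuit arev (tree_of r f) q"
proof
  define H where "H = tree_of r f"
  assume "circuit arev (tree_of r f) q"
  then have cyc: "pre_digraph.cycle H q" and nobt: "\<And>e. q \<noteq> [e, arev e]"
    by (auto simp: circuit_def H_def)
  obtain h :: "'a \<Rightarrow> nat" where h: "\<And>u. u \<in> verts G - {r} \<Longrightarrow> h (head G (f u)) < h u"
    "\<And>u. u \<in> verts G - {r} \<Longrightarrow> f u \<in> arcs G"
    "\<And>u. u \<in> verts G - {r} \<Longrightarrow> tail G (f u) = u"
    "\<And>e. e \<in> arcs H \<Longrightarrow>
       e \<in> arcs G \<and> ((tail G e \<in> verts G - {r} \<and> e = f (tail G e)) \<or>
          (head G e \<in> verts G - {r} \<and> e = arev (f (head G e))))"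
    using f unfolding H_def by (rule arborescenceE) blast
  obtain u where walk: "pre_digraph.awalk H u q u"
    and dist: "distinct (tl (pre_digraph.awalk_verts H u q))" and "q \<noteq> []"
    using cyc unfolding pre_digraph.cycle_def by blast
  have cas: "cas u q u" and arcs: "set q \<subseteq> arcs H"
    using walk compatible_cas[of H G] by (auto simp: pre_digraph.awalk_def compatible_def H_def)
  have "tl (awalk_verts u q) = map (head G) q"
    using awalk_verts_conv'[OF cas] \<open>q \<noteq> []\<close> by simp
  then have dist: "distinct (map (head G) q)"
    using dist compatible_awalk_verts[of H G] by (simp add: compatible_def H_def)
  define n where "n = length q"
  have n: "n > 0" using \<open>q \<noteq> []\<close> by (simp add: n_def)
  define s where "s i = Suc i mod n" for i
  have s: "s i < n" for i using n by (simp add: s_def)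
  have linked: "cas u p v \<Longrightarrow> p \<noteq> [] \<Longrightarrow> tail G (hd p) = u \<and> head G (last p) = v \<and>
      (\<forall>i. Suc i < length p \<longrightarrow> head G (p ! i) = tail G (p ! Suc i))" for u p v
  proof (induction p arbitrary: u)
    case (Cons e p)
    show ?case
    proof (cases p)
      case Nil
      then show ?thesis using Cons.prems by simp
    next
      case (Cons e' p')
      then have IH: "tail G e' = head G e \<and> head G (last p) = v \<and>
          (\<forall>i. Suc i < length p \<longrightarrow> head G (p ! i) = tail G (p ! Suc i))"
        using Cons.IH[of "head G e"] Cons.prems by simp
      have "head G ((e # p) ! i) = tail G ((e # p) ! Suc i)" if "Suc i < length (e # p)" for i
        using that IH Cons by (cases i) auto
      then show ?thesis using IH Cons.prems Cons by simp
    qed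
  qed simp
  have head_tail: "head G (q ! i) = tail G (q ! s i)" if "i < n" for i
  proof (cases "Suc i = n")
    case True
    then have "i = n - 1" by simp
    then have "q ! i = last q" "s i = 0" using True \<open>q \<noteq> []\<close>
      by (auto simp: n_def s_def last_conv_nth)
    then show ?thesis using linked[OF cas \<open>q \<noteq> []\<close>] \<open>q \<noteq> []\<close> by (simp add: hd_conv_nth)
  next
    case False
    then show ?thesis using linked[OF cas \<open>q \<noteq> []\<close>] that by (simp add: s_def n_def)
  qed
  have inH: "q ! i \<in> arcs H" if "i < n" for i using arcs that by (auto simp: n_def)
  have heads: "i = j" if "head G (q ! i) = head G (q ! j)" "i < n" "j < n" for i j
    using dist that by (simp add: distinct_conv_nth n_def) metis
  obtain i where i: "i < n" and max: "\<And>j. j < n \<Longrightarrow> h (head G (q ! j)) \<le> h (head G (q ! i))"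
  proof -
    have "finite ((\<lambda>i. h (head G (q ! i))) ` {..<n})" "(\<lambda>i. h (head G (q ! i))) ` {..<n} \<noteq> {}"
      using n by auto
    from Max_in[OF this] obtain i where "i < n" "h (head G (q ! i)) = Max ((\<lambda>i. h (head G (q ! i))) ` {..<n})"
      by auto
    then show ?thesis using that by simp
  qed
  define e where "e = q ! s i"
  define w where "w = head G (q ! i)"
  have tail_e: "tail G e = w" using head_tail[OF i] by (simp add: e_def w_def)
  have out: "w \<in> verts G - {r} \<and> e = f w"
  proof -
    have "h (head G e) \<le> h w" using max[OF s] by (simp add: e_def w_def)
    moreover have "e \<in> arcs H" using inH[OF s] by (simp add: e_def)
    from h(4)[OF this] have "(w \<in> verts G - {r} \<and> e = f w) \<or>
          (head G e \<in> verts G - {r} \<and> e = arev (f (head G e)))"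
      unfolding tail_e by blast
    moreover have "h w < h (head G e)" if "head G e \<in> verts G - {r}" "e = arev (f (head G e))"
    proof -
      have "tail G e = head G (f (head G e))" using that h(2) by (metis tail_arev)
      then show ?thesis using h(1)[OF that(1)] tail_e by simp
    qed
    ultimately show ?thesis by auto
  qed
  obtain j where j: "j < n" "s j = i"
  proof (cases i)
    case 0
    then show ?thesis using that[of "n - 1"] n by (simp add: s_def)
  next
    case (Suc k)
    then show ?thesis using that[of k] i by (simp add: s_def)
  qed
  then have tail_le: "h (tail G (q ! i)) \<le> h w"
    using max[of j] head_tail[of j] by (simp add: w_def)
  have rev: "q ! i = arev e"
  proof -
    from h(4)[OF inH[OF i]] consider "tail G (q ! i) \<in> verts G - {r}" "q ! i = f (tail G (q ! i))"
      | "q ! i = arev (f w)" by (auto simp: w_def)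
    then show ?thesis
    proof cases
      case 1
      then show ?thesis using h(1)[OF 1(1)] tail_le by (simp add: w_def)
    next
      case 2
      then show ?thesis using out by simp
    qed
  qed
  have "e \<in> arcs G" using out h(2) by simp
  have "head G (q ! j) = head G (q ! s i)"
    using head_tail[OF j(1)] j(2) rev \<open>e \<in> arcs G\<close> by (simp add: e_def[symmetric])
  then have "j = s i" using heads j s by simp
  then have ss: "s (s i) = i" using j by simp
  show False
  proof (cases "s i = i")
    case True
    then have "arev e = e" using rev by (simp add: e_def)
    then show False using arev_neq[OF \<open>e \<in> arcs G\<close>] by simp
  next
    case False
    have "n = 2"
    proof (cases "Suc i < n")
      case True
      then show ?thesis using ss False n i by (cases "Suc (Suc i) < n") (auto simp: s_def mod_if split: if_splits)
    next
      case F2: False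
      then have "i = n - 1" using i by simp
      then show ?thesis using ss False n i by (cases "n = 1"; cases "n = 2") (auto simp: s_def)
    qed
    then have "q = [q ! 0, q ! 1]" by (auto simp: n_def length_Suc_conv numeral_2_eq_2)
    moreover have "(i = 0 \<and> s i = 1) \<or> (i = 1 \<and> s i = 0)"
      using i \<open>n = 2\<close> by (auto simp: s_def less_2_cases_iff)
    ultimately have "q = [arev e, e] \<or> q = [e, arev e]" using rev by (auto simp: e_def)
    then show False using nobt[of e] nobt[of "arev e"] by simp
  qed
qed

text \<open>
  Let each vertex choose an arc that brings it closer to \<open>r\<close>.
\<close>

lemma ex_arborescence_in_subgraph:
  assumes H: "spanning H G" "arev ` arcs H \<subseteq> arcs H" "Digraph_Component.connected H"
    and r: "r \<in> verts G"
  obtains f where "f \<in> arborescences G r" "f ` (verts G - {r}) \<subseteq> arcs H"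
proof -
  have vH: "verts H = verts G" and sub: "arcs H \<subseteq> arcs G" and tH: "tail H = tail G" "head H = head G"
    and wf: "wf_digraph H"
    using H by (auto simp: spanning_def subgraph_def compatible_def)
  interpret H: wf_digraph H by fact
  have "symmetric H"
    unfolding symmetric_conv
  proof
    fix e assume "e \<in> arcs H"
    then show "\<exists>e2\<in>arcs H. tail H e = head H e2 \<and> head H e = tail H e2"
      using H(2) sub by (intro bexI[of _ "arev e"]) (auto simp: tH)
  qed
  then have sc: "strongly_connected H"
    using H.symmetric_connected_imp_strongly_connected H(3) by blast
  have ex: "\<exists>n. (u, r) \<in> arcs_ends H ^^ n" if "u \<in> verts G" for u
  proof -
    have "u \<rightarrow>\<^sup>*\<^bsub>H\<^esub> r" using sc that r by (auto simp: strongly_connected_def vH)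
    then have "(u, r) \<in> (arcs_ends H)\<^sup>*" by (rule reachable_rtranclI)
    then show ?thesis by (simp add: rtrancl_power)
  qed
  define h where "h u = (LEAST n. (u, r) \<in> arcs_ends H ^^ n)" for u
  have step: "\<exists>e\<in>arcs H. tail G e = u \<and> h (head G e) < h u" if u: "u \<in> verts G - {r}" for u
  proof -
    have "\<exists>n. (u, r) \<in> arcs_ends H ^^ n" using ex u by blast
    then have *: "(u, r) \<in> arcs_ends H ^^ h u" unfolding h_def by (rule LeastI_ex)
    then obtain n where n: "h u = Suc n" using u by (cases "h u") auto
    then obtain w where w: "(u, w) \<in> arcs_ends H" "(w, r) \<in> arcs_ends H ^^ n"
      using * relpow_Suc_D2 by metis
    have "h w \<le> n" unfolding h_def using w(2) by (rule Least_le)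
    then show ?thesis using w(1) n by (auto simp: arcs_ends_conv tH)
  qed
  define f where "f = (\<lambda>u\<in>verts G - {r}. SOME e. e \<in> arcs H \<and> tail G e = u \<and> h (head G e) < h u)"
  have f: "f u \<in> arcs H \<and> tail G (f u) = u \<and> h (head G (f u)) < h u" if "u \<in> verts G - {r}" for u
    using someI_ex[OF step[OF that, unfolded Bex_def]] that by (simp add: f_def)
  have "f \<in> Pi\<^sub>E (verts G - {r}) (out_arcs G)"
  proof (rule PiE_I)
    fix u assume "u \<in> verts G - {r}"
    from f[OF this] sub show "f u \<in> out_arcs G u" by auto
  qed (unfold f_def restrict_def, rule if_not_P)
  then have "f \<in> arborescences G r"
    using f unfolding arborescences_def by blast
  then show ?thesis using f that by blast
qed

text \<open>
  The tree of an arborescence contained in \<open>H\<close> is all of \<open>H\<close>: a further arc together with a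
  path in the tree between its ends would be a circuit.
\<close>

lemma tree_of_surj:
  assumes H: "spanning H G" "undirected_tree arev H" and r: "r \<in> verts G"
  shows "\<exists>f \<in> arborescences G r. tree_of r f = H"
proof -
  have arev_H: "arev ` arcs H \<subseteq> arcs H" and con: "Digraph_Component.connected H"
    and nocirc: "\<And>q. \<not> circuit arev H q"
    using H by (auto simp: undirected_tree_def)
  have vH: "verts H = verts G" and sub: "arcs H \<subseteq> arcs G" and tH: "tail H = tail G" "head H = head G"
    and wf: "wf_digraph H"
    using H by (auto simp: spanning_def subgraph_def compatible_def)
  interpret H: wf_digraph H by fact
  obtain f where f: "f \<in> arborescences G r" "f ` (verts G - {r}) \<subseteq> arcs H"
    using ex_arborescence_in_subgraph[OF H(1) arev_H con r] .
  define T where "T = tree_of r f"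
  have T_H: "arcs T \<subseteq> arcs H" using f(2) arev_H by (auto simp: T_def tree_of_def)
  have arev_T: "arev ` arcs T \<subseteq> arcs T" unfolding T_def by (rule arev_arcs_tree_of)
  have "spanning T G" unfolding T_def using f(1) by (rule spanning_tree_of)
  then interpret T: wf_digraph T by (auto simp: spanning_def subgraph_def)
  have tT: "tail T = tail G" "head T = head G" "verts T = verts G" by (simp_all add: T_def)
  have "symmetric T"
    unfolding symmetric_conv
  proof
    fix e assume "e \<in> arcs T"
    then show "\<exists>e2\<in>arcs T. tail T e = head T e2 \<and> head T e = tail T e2"
      using arev_T T_H sub by (intro bexI[of _ "arev e"]) (auto simp: tT)
  qed
  then have scT: "strongly_connected T"
    using T.symmetric_connected_imp_strongly_connected connected_tree_of[OF f(1) r]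
    by (simp add: T_def)
  have "arcs H \<subseteq> arcs T"
  proof
    fix e assume e: "e \<in> arcs H"
    show "e \<in> arcs T"
    proof (rule ccontr)
      assume nT: "e \<notin> arcs T"
      have "head G e \<rightarrow>\<^sup>*\<^bsub>T\<^esub> tail G e"
        using scT e sub by (auto simp: strongly_connected_def tT)
      then obtain p where p: "T.apath (head G e) p (tail G e)" by (auto simp: T.reachable_apath)
      have comp: "compatible T H" by (simp add: compatible_def tT tH)
      have "H.awalk (head G e) p (tail G e)"
        using p T_H e vH sub unfolding T.apath_def T.awalk_def H.awalk_def compatible_cas[OF comp]
        by (auto simp: tT)
      then have "H.awalk (tail G e) (e # p) (tail G e)"
        using e by (simp add: H.awalk_Cons_iff tH)
      moreover have "distinct (tl (H.awalk_verts (tail G e) (e # p)))"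
        using p unfolding T.apath_def compatible_awalk_verts[OF comp] by (simp add: tH)
      ultimately have "H.cycle (e # p)" unfolding H.cycle_def by blast
      moreover have "e # p \<noteq> [a, arev a]" for a
      proof
        assume "e # p = [a, arev a]"
        then have "arev e \<in> arcs T" using p by (auto simp: T.apath_def T.awalk_def)
        then have "arev (arev e) \<in> arcs T" using arev_T by blast
        then show False using nT by simp
      qed
      ultimately show False using nocirc[of "e # p"] by (auto simp: circuit_def)
    qed
  qed
  then have "arcs T = arcs H" using T_H by blast
  then have "T = H" by (simp add: tT tH vH pre_digraph.equality)
  then show ?thesis using f(1) by (auto simp: T_def)
qed

theorem num_spanning_trees_eq_card_arborescences:
  assumes "r \<in> verts G"
  shows "num_spanning_trees arev G = card (arborescences G r)"
proof -
  have "{H. spanning H G \<and> undirected_tree arev H} = tree_of r ` arborescences G r"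
  proof (intro equalityI subsetI)
    fix H assume "H \<in> {H. spanning H G \<and> undirected_tree arev H}"
    then show "H \<in> tree_of r ` arborescences G r" using tree_of_surj[of H r] assms by blast
  next
    fix H assume "H \<in> tree_of r ` arborescences G r"
    then obtain f where "f \<in> arborescences G r" "H = tree_of r f" by blast
    then show "H \<in> {H. spanning H G \<and> undirected_tree arev H}"
      using spanning_tree_of connected_tree_of[OF _ assms] arev_arcs_tree_of tree_of_no_circuit
      unfolding undirected_tree_def by blast
  qed
  then show ?thesis
    by (simp add: num_spanning_trees_def card_image inj_on_tree_of)
qed

corollary num_spanning_trees_eq_fdet:
  assumes "r \<in> verts G"
  shows "of_nat (num_spanning_trees arev G) = (fdet (verts G - {r}) (laplacian G) :: 'c :: comm_ring_1)"
  using assms fdet_laplacian_eq_card_arborescences[OF fin_digraph_axioms assms, where 'c = 'c]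
  by (simp add: num_spanning_trees_eq_card_arborescences)

lemma num_spanning_trees_pos:
  assumes "Digraph_Component.connected G"
  shows "num_spanning_trees arev G > 0"
proof -
  obtain r where r: "r \<in> verts G"
    using assms by (auto simp: connected_conv)
  have "spanning G G" using wf_digraph_axioms by (auto simp: spanning_def subgraph_def compatible_def)
  moreover have "arev ` arcs G \<subseteq> arcs G" by auto
  ultimately obtain f where "f \<in> arborescences G r"
    by (rule ex_arborescence_in_subgraph[OF _ _ assms r])
  moreover have "finite (arborescences G r)"
    by (rule finite_subset[of _ "Pi\<^sub>E (verts G - {r}) (out_arcs G)"])
       (auto simp: arborescences_def intro!: finite_PiE)
  ultimately show ?thesis
    using r by (auto simp: num_spanning_trees_eq_card_arborescences card_gt_0_iff)
qed

end


section \<open>Integer polynomials modulo \<open>(1 + T) ^ p ^ n - 1\<close>\<close>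

lemma prime_power_dvd_freshman:
  fixes a b :: "'a :: comm_ring_1"
  assumes "prime p"
  shows "of_nat p dvd (a + b) ^ (p ^ n) - (a ^ (p ^ n) + b ^ (p ^ n))"
proof (induction n)
  case (Suc n)
  have base: "of_nat p dvd (x + y) ^ p - (x ^ p + y ^ p)" for x y :: 'a
  proof -
    have "p > 0" using assms by (rule prime_gt_0_nat)
    have "{..p} = insert 0 (insert p {0<..<p})" using \<open>p > 0\<close> by auto
    then have "(x + y) ^ p - (x ^ p + y ^ p) = (\<Sum>k\<in>{0<..<p}. of_nat (p choose k) * x ^ k * y ^ (p - k))"
      using \<open>p > 0\<close> by (simp add: binomial_ring add_ac)
    moreover have "of_nat p dvd (of_nat (p choose k) :: 'a)" if "k \<in> {0<..<p}" for k
    proof -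
      have "p dvd (p choose k)"
        using that assms by (intro dvd_choose_prime) auto
      then show ?thesis by (auto elim!: dvdE)
    qed
    ultimately show ?thesis by (auto intro!: dvd_sum dvd_mult2)
  qed
  let ?x = "(a + b) ^ p ^ n" and ?y = "a ^ p ^ n + b ^ p ^ n"
  have "?x - ?y dvd ?x ^ p - ?y ^ p" by (simp add: power_diff_sumr2)
  then have "of_nat p dvd ?x ^ p - ?y ^ p" using Suc dvd_trans by blast
  moreover have "of_nat p dvd ?y ^ p - ((a ^ p ^ n) ^ p + (b ^ p ^ n) ^ p)" by (rule base)
  ultimately have "of_nat p dvd ?x ^ p - ?y ^ p + (?y ^ p - ((a ^ p ^ n) ^ p + (b ^ p ^ n) ^ p))"
    by (rule dvd_add)
  then show ?case by (simp add: power_mult[symmetric] mult.commute add_diff_eq diff_add_eq)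
qed simp

text \<open>
  For \<open>N = p ^ n\<close> this is Iwasawa's polynomial \<open>\<omega>\<^sub>n\<close>, in the variable \<open>T = x - 1\<close>: the integer
  polynomials modulo \<open>omega N\<close> are the group ring of the cyclic group of order \<open>N\<close> generated by
  \<open>x = 1 + T\<close>.
\<close>

definition omega :: "nat \<Rightarrow> int poly" where
  "omega N = [:1, 1:] ^ N - 1"

lemma omega_dvd_omega:
  assumes "M dvd N"
  shows "omega M dvd omega N"
proof -
  obtain k where "N = M * k" using assms by blast
  then show ?thesis
    using power_diff_sumr2[of "[:1, 1:] ^ M" k "1 :: int poly"]
    by (simp add: omega_def power_mult)
qed

lemma degree_linear_power_int: "degree ([:1, 1 :: int:] ^ N) = N"
  by (simp add: degree_power_eq)

lemma monic_omega:
  assumes "N > 0"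
  shows "degree (omega N) = N" "lead_coeff (omega N) = 1"
proof -
  have "lead_coeff ([:1, 1 :: int:] ^ N) = 1" by (simp add: lead_coeff_power)
  then have c: "coeff ([:1, 1 :: int:] ^ N) N = 1" by (simp add: degree_linear_power_int)
  have "degree (- 1 :: int poly) < degree ([:1, 1 :: int:] ^ N)"
    using assms by (simp add: degree_linear_power_int)
  then have "degree ([:1, 1 :: int:] ^ N + (- 1)) = N"
    using degree_add_eq_left[of "- 1 :: int poly" "[:1, 1 :: int:] ^ N"]
    by (simp add: degree_linear_power_int)
  then show d: "degree (omega N) = N" by (simp add: omega_def)
  show "lead_coeff (omega N) = 1" unfolding d using assms c by (simp add: omega_def)
qed

lemma omega_mod_prime:
  assumes "prime p"
  obtains c where "omega (p ^ n) = monom 1 (p ^ n) + [:int p:] * c"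
proof -
  have "of_nat p dvd (1 + monom 1 1 :: int poly) ^ (p ^ n) - (1 ^ (p ^ n) + monom 1 1 ^ (p ^ n))"
    using assms by (rule prime_power_dvd_freshman)
  moreover have "(1 + monom 1 1 :: int poly) = [:1, 1:]"
    by (simp add: monom_altdef one_pCons)
  moreover have "(of_nat p :: int poly) = [:int p:]" by (simp add: of_nat_poly)
  ultimately have "[:int p:] dvd omega (p ^ n) - monom 1 (p ^ n)"
    by (simp add: omega_def monom_power algebra_simps)
  then obtain c where "omega (p ^ n) - monom 1 (p ^ n) = [:int p:] * c" by blast
  then show ?thesis using that[of c] by (simp add: algebra_simps)
qed

lemma monic_int_division:
  fixes f w :: "int poly"
  assumes "lead_coeff w = 1"
  obtains q r where "f = w * q + r" "r = 0 \<or> degree r < degree w"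
proof -
  have "w \<noteq> 0" using assms by auto
  then show ?thesis
    using pseudo_divmod[of w f "fst (pseudo_divmod f w)" "snd (pseudo_divmod f w)"] assms that
    by simp
qed

lemma dvd_if_small_multiple:
  fixes w r s :: "int poly"
  assumes "lead_coeff w = 1" "r = w * s" "r = 0 \<or> degree r < degree w"
  shows "r = 0"
proof (rule ccontr)
  assume "r \<noteq> 0"
  then have "s \<noteq> 0" "w \<noteq> 0" using assms by auto
  then show False using assms \<open>r \<noteq> 0\<close> by (simp add: degree_mult_eq)
qed

lemma prime_const_poly:
  assumes "prime p"
  shows "prime_elem [:int p:]"
  using assms by (simp add: prime_elem_const_poly_iff)

lemma not_prime_dvd_monic:
  fixes w :: "int poly"
  assumes "prime p" "lead_coeff w = 1"
  shows "\<not> [:int p:] dvd w"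
proof
  assume "[:int p:] dvd w"
  then have "int p dvd lead_coeff w" by (simp only: const_poly_dvd_iff)
  then show False using assms by auto
qed

text \<open>
  The constant \<open>p\<close> is prime among the integer polynomials and does not divide a monic one.
\<close>

lemma monic_dvd_cancel_prime_power:
  fixes w :: "int poly"
  assumes "prime p" "lead_coeff w = 1" "w dvd [:int p:] ^ k * h"
  shows "w dvd h"
  using assms(3)
proof (induction k)
  case (Suc k)
  then obtain s where s: "[:int p:] * ([:int p:] ^ k * h) = w * s" by (auto simp: mult.assoc)
  then have "[:int p:] dvd w * s" by (metis dvd_triv_left)
  then have "[:int p:] dvd s"
    using prime_const_poly[OF assms(1)] not_prime_dvd_monic[OF assms(1,2)]
    by (auto simp: prime_elem_dvd_mult_iff)
  then obtain s' where "s = [:int p:] * s'" by blast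
  then have "[:int p:] * ([:int p:] ^ k * h) = [:int p:] * (w * s')" using s by (simp add: mult.left_commute)
  moreover have "[:int p:] \<noteq> 0" using prime_gt_0_nat[OF assms(1)] by simp
  ultimately have "[:int p:] ^ k * h = w * s'" by (metis mult_left_cancel)
  then show ?case by (intro Suc.IH) simp
qed simp

text \<open>
  The integer polynomials modulo a monic \<open>w\<close> form a free abelian group of finite rank, in which
  only 0 is divisible by all powers of \<open>p\<close>.
\<close>

lemma monic_dvd_if_all_prime_powers:
  fixes w d :: "int poly"
  assumes "prime p" "lead_coeff w = 1"
    and all: "\<And>k. \<exists>g s. d = [:int p:] ^ k * g + w * s"
  shows "w dvd d"
proof -
  obtain q r where qr: "d = w * q + r" "r = 0 \<or> degree r < degree w"
    using monic_int_division[OF assms(2)] .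
  have "int p ^ k dvd coeff r i" for k i
  proof -
    obtain g s where gs: "d = [:int p:] ^ k * g + w * s" using all by blast
    obtain q' r' where qr': "g = w * q' + r'" "r' = 0 \<or> degree r' < degree w"
      using monic_int_division[OF assms(2)] .
    have P: "[:int p:] ^ k = [:int p ^ k:]" by (simp add: poly_const_pow)
    have "r - [:int p:] ^ k * r' = w * (s + [:int p:] ^ k * q' - q)"
      using qr(1) gs qr'(1) by (simp add: algebra_simps)
    moreover have "r - [:int p:] ^ k * r' = 0 \<or> degree (r - [:int p:] ^ k * r') < degree w"
    proof (cases "degree w = 0")
      case False
      then show ?thesis
        using qr(2) qr'(2) by (auto simp: P intro!: degree_diff_less)
    qed (use qr qr' in auto)
    ultimately have "r - [:int p:] ^ k * r' = 0"
      by (rule dvd_if_small_multiple[OF assms(2)])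
    then have "r = Polynomial.smult (int p ^ k) r'" by (simp add: P)
    then show ?thesis by simp
  qed
  then have "coeff r i = 0" for i
  proof -
    define c where "c = coeff r i"
    have dv: "int p ^ k dvd c" for k using \<open>\<And>k i. int p ^ k dvd coeff r i\<close> by (simp add: c_def)
    have "nat \<bar>c\<bar> < p ^ nat \<bar>c\<bar>" 
      using prime_gt_1_nat[OF assms(1)] by (intro power_gt_expt) simp
    then have "\<bar>c\<bar> < int p ^ nat \<bar>c\<bar>" by (metis nat_less_iff abs_ge_zero of_nat_power zless_nat_eq_int_zless)
    then show ?thesis using dv[of "nat \<bar>c\<bar>"] zdvd_not_zless[of "\<bar>c\<bar>"] by (fastforce simp: c_def)
  qed
  then have "r = 0" by (simp add: poly_eq_iff)
  then show ?thesis using qr by simp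
qed

lemma split_at_coeff:
  fixes g :: "int poly"
  assumes "\<And>i. i < l \<Longrightarrow> int p dvd coeff g i"
  obtains a b where "g = [:int p:] * a + monom 1 l * b" "coeff b 0 = coeff g l"
proof -
  define b where "b = poly_shift l g"
  have "[:int p:] dvd g - monom 1 l * b"
    using assms by (auto simp: const_poly_dvd_iff coeff_monom_mult b_def coeff_poly_shift)
  then obtain a where "g - monom 1 l * b = [:int p:] * a" by blast
  then show ?thesis
    using that[of a b] by (simp add: algebra_simps b_def coeff_poly_shift)
qed

text \<open>
  The powers of \<open>p\<close> that divide \<open>d n\<close> modulo \<open>omega (p ^ n)\<close> can only become fewer as \<open>n\<close> grows, so
  there is a largest one, \<open>p ^ \<mu>\<close>, that divides for every \<open>n\<close>, and for large \<open>n\<close> it is the exact one.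
  The quotient \<open>g\<close> then is nonzero modulo \<open>p\<close> and \<open>omega (p ^ n)\<close>, which by \<open>omega_mod_prime\<close> means
  modulo \<open>p\<close> and \<open>T ^ p ^ n\<close>; and as the quotients are compatible as well, the first coefficient that
  is not divisible by \<open>p\<close> stays at the same place.
\<close>

lemma iwasawa_invariants_of_compatible_polys:
  fixes d :: "nat \<Rightarrow> int poly"
  assumes p: "prime p"
    and compat: "\<And>m n. m \<le> n \<Longrightarrow> omega (p ^ m) dvd d n - d m"
    and nz: "\<not> omega (p ^ n0) dvd d n0"
  obtains \<mu> l n1 where "\<And>n. n \<ge> n1 \<Longrightarrow>
    l < p ^ n \<and> (\<exists>g s. d n = [:int p:] ^ \<mu> * g + omega (p ^ n) * s \<and>
       (\<forall>i<l. int p dvd coeff g i) \<and> \<not> int p dvd coeff g l)"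
proof -
  have mon: "lead_coeff (omega (p ^ n)) = 1" for n
    using prime_gt_0_nat[OF p] by (intro monic_omega) simp
  have dvd_le: "omega (p ^ m) dvd omega (p ^ n)" if "m \<le> n" for m n
    using that by (intro omega_dvd_omega le_imp_power_dvd)
  define Q where "Q n k \<longleftrightarrow> (\<exists>g s. d n = [:int p:] ^ k * g + omega (p ^ n) * s)" for n k
  have Q_mono: "Q m k" if "Q n k" and le: "m \<le> n" for m n k
  proof -
    obtain g s where gs: "d n = [:int p:] ^ k * g + omega (p ^ n) * s" using \<open>Q n k\<close> by (auto simp: Q_def)
    obtain t where "d n - d m = omega (p ^ m) * t" using compat[OF le] by blast
    moreover obtain u where "omega (p ^ n) = omega (p ^ m) * u" using dvd_le[OF le] by blast
    ultimately have "d m = [:int p:] ^ k * g + omega (p ^ m) * (u * s - t)"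
      using gs by (simp add: algebra_simps)
    then show ?thesis unfolding Q_def by blast
  qed
  have Q_down: "Q n j" if "Q n k" "j \<le> k" for n j k
  proof -
    obtain g s where "d n = [:int p:] ^ k * g + omega (p ^ n) * s" using \<open>Q n k\<close> by (auto simp: Q_def)
    then have "d n = [:int p:] ^ j * ([:int p:] ^ (k - j) * g) + omega (p ^ n) * s"
      using that(2) by (simp add: mult.assoc[symmetric] power_add[symmetric])
    then show ?thesis unfolding Q_def by blast
  qed
  obtain B where B: "\<not> Q n0 B"
    using monic_dvd_if_all_prime_powers[OF p mon] nz unfolding Q_def by blast
  define K where "K = {k. \<forall>n. Q n k}"
  have "finite K" using B Q_down by (intro finite_subset[of K "{..<B}"]) (auto simp: K_def not_less[symmetric])
  moreover have "0 \<in> K"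
  proof -
    have "Q n 0" for n unfolding Q_def by (intro exI[of _ "d n"] exI[of _ 0]) simp
    then show ?thesis by (simp add: K_def)
  qed
  ultimately have "Max K \<in> K" "Suc (Max K) \<notin> K"
    using Max_in[of K] Max_ge[of K "Suc (Max K)"] by (metis empty_iff, metis not_less_eq_eq order_refl)
  define \<mu> where "\<mu> = Max K"
  obtain n1 where n1: "\<not> Q n1 (Suc \<mu>)" using \<open>Suc (Max K) \<notin> K\<close> by (auto simp: K_def \<mu>_def)
  have ex: "\<exists>g s. d n = [:int p:] ^ \<mu> * g + omega (p ^ n) * s" for n
    using \<open>Max K \<in> K\<close> by (auto simp: K_def \<mu>_def Q_def)
  obtain g1 s1 where g1: "d n1 = [:int p:] ^ \<mu> * g1 + omega (p ^ n1) * s1" using ex by blast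
  \<comment> \<open>Otherwise one more factor \<open>p\<close> could be split off, as \<open>T ^ p ^ n1\<close> is a multiple of \<open>p\<close> modulo \<open>omega\<close>.\<close>
  have "\<exists>i<p ^ n1. \<not> int p dvd coeff g1 i"
  proof (rule ccontr)
    assume "\<not> ?thesis"
    then obtain a b where ab: "g1 = [:int p:] * a + monom 1 (p ^ n1) * b"
      using split_at_coeff[of "p ^ n1" p g1] by blast
    obtain c where c: "omega (p ^ n1) = monom 1 (p ^ n1) + [:int p:] * c"
      using omega_mod_prime[OF p] .
    define P where "P = [:int p:]"
    have "monom 1 (p ^ n1) = omega (p ^ n1) - P * c" using c by (simp add: P_def)
    then have "d n1 = P ^ \<mu> * (P * a + (omega (p ^ n1) - P * c) * b) + omega (p ^ n1) * s1"
      using g1 ab by (simp only: P_def)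
    then have "d n1 = P ^ Suc \<mu> * (a - c * b) + omega (p ^ n1) * (s1 + P ^ \<mu> * b)"
      by (simp add: algebra_simps)
    then show False using n1 unfolding Q_def P_def by blast
  qed
  then obtain i0 where i0: "i0 < p ^ n1" "\<not> int p dvd coeff g1 i0" by blast
  define l where "l = (LEAST i. \<not> int p dvd coeff g1 i)"
  have l1: "\<not> int p dvd coeff g1 l" unfolding l_def using i0(2) by (rule LeastI)
  have l2: "int p dvd coeff g1 i" if "i < l" for i using that not_less_Least unfolding l_def by blast
  have l3: "l < p ^ n1" using i0 Least_le[of "\<lambda>i. \<not> int p dvd coeff g1 i" i0] by (simp add: l_def)
  show ?thesis
  proof (rule that)
    fix n assume "n \<ge> n1"
    have le: "p ^ n1 \<le> p ^ n" using \<open>n \<ge> n1\<close> prime_gt_0_nat[OF p] by (intro power_increasing) auto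
    obtain g s where g: "d n = [:int p:] ^ \<mu> * g + omega (p ^ n) * s" using ex by blast
    have "omega (p ^ n1) dvd [:int p:] ^ \<mu> * (g - g1)"
    proof -
      have "[:int p:] ^ \<mu> * (g - g1) = (d n - d n1) + omega (p ^ n1) * s1 - omega (p ^ n) * s"
        using g g1 by (simp add: algebra_simps)
      then show ?thesis
        using compat[OF \<open>n \<ge> n1\<close>] dvd_le[OF \<open>n \<ge> n1\<close>] by (simp add: dvd_add dvd_diff)
    qed
    then have "omega (p ^ n1) dvd g - g1" by (rule monic_dvd_cancel_prime_power[OF p mon])
    then obtain t where t: "g - g1 = omega (p ^ n1) * t" by blast
    obtain c where c: "omega (p ^ n1) = monom 1 (p ^ n1) + [:int p:] * c"
      using omega_mod_prime[OF p] .
    have "coeff g i = coeff g1 i + int p * coeff (c * t) i" if "i < p ^ n1" for i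
    proof -
      have "coeff (g - g1) i = coeff (monom 1 (p ^ n1) * t) i + coeff ([:int p:] * (c * t)) i"
        unfolding t c by (simp only: distrib_right mult.assoc coeff_add)
      then show ?thesis using that by (simp add: coeff_monom_mult)
    qed
    then have "int p dvd coeff g i \<longleftrightarrow> int p dvd coeff g1 i" if "i < p ^ n1" for i
      using that by (simp add: dvd_add_left_iff)
    then show "l < p ^ n \<and> (\<exists>g s. d n = [:int p:] ^ \<mu> * g + omega (p ^ n) * s \<and>
       (\<forall>i<l. int p dvd coeff g i) \<and> \<not> int p dvd coeff g l)"
      using g l1 l2 l3 le by (intro conjI exI[of _ g] exI[of _ s]) auto
  qed
qed

lemma pcompose_power: "pcompose (f ^ k) s = pcompose f s ^ k"
  for f s :: "'a :: comm_ring_1 poly"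
proof (induction k)
  case 0
  show ?case by (simp add: one_pCons)
qed (simp add: pcompose_mult)

text \<open>
  Let \<open>S\<close> be the image of \<open>T\<close> under \<open>x \<mapsto> x ^ (p ^ n - 1)\<close>, which inverts \<open>x = 1 + T\<close> modulo
  \<open>omega (p ^ n)\<close>, so that \<open>x * S = - T\<close> there. With \<open>g = T ^ l * b\<close> modulo \<open>p\<close> and \<open>l\<close> odd, invariance of \<open>g\<close>
  says that \<open>x ^ l * b + \<sigma> b\<close> vanishes modulo \<open>p\<close> and a power of \<open>T\<close>, where \<open>\<sigma> b\<close> is the image of
  \<open>b\<close>. Its coefficients at 1 and \<open>T\<close> are \<open>2 * b 0\<close> and \<open>l * b 0 + p ^ n * b 1\<close>. As \<open>p\<close> does not
  divide \<open>b 0\<close>, it divides 2 and the odd number \<open>l\<close>.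
\<close>

lemma even_if_symmetric:
  fixes g :: "int poly"
  assumes p: "prime p" and n: "n > 0" and l: "l + 2 \<le> p ^ n"
    and low: "\<And>i. i < l \<Longrightarrow> int p dvd coeff g i" and unit: "\<not> int p dvd coeff g l"
    and sym: "omega (p ^ n) dvd pcompose g ([:1, 1:] ^ (p ^ n - 1) - 1) - g"
  shows "even l"
proof (rule ccontr)
  assume odd: "odd l"
  define N where "N = p ^ n"
  define x :: "int poly" where "x = [:1, 1:]"
  define S where "S = x ^ (N - 1) - 1"
  define P where "P = [:int p:]"
  define X :: "int poly" where "X = monom 1 1"
  define \<sigma> where "\<sigma> f = pcompose f S" for f
  have "p ^ n > 0" using prime_gt_0_nat[OF p] by simp
  then have "N > 0" by (simp add: N_def)
  have x: "x = 1 + X" by (simp add: x_def X_def monom_altdef one_pCons)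
  obtain c where c: "omega N = X ^ N + P * c"
    using omega_mod_prime[OF p, of n] by (auto simp: N_def P_def X_def monom_power)
  obtain a b where g: "g = P * a + X ^ l * b" and b0: "coeff b 0 = coeff g l"
    using split_at_coeff[of l p g] low by (auto simp: P_def X_def monom_power)
  have \<sigma>g: "\<sigma> g = P * \<sigma> a + S ^ l * \<sigma> b"
    by (simp add: g \<sigma>_def pcompose_add pcompose_mult pcompose_smult pcompose_power P_def X_def pcompose_const monom_altdef pcompose_pCons)
  obtain t where t: "\<sigma> g - g = omega N * t" using sym by (auto simp: N_def \<sigma>_def S_def x_def)
  have "x * x ^ (N - 1) = x ^ N" using \<open>N > 0\<close> by (cases N) auto
  then have xS: "x * S = omega N - X" by (simp add: S_def omega_def x_def[symmetric] algebra_simps) (simp add: x)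
  have "omega N - X - (- X) dvd (omega N - X) ^ l - (- X) ^ l" by (simp add: power_diff_sumr2)
  then obtain y where "(omega N - X) ^ l - (- X) ^ l = omega N * y" by (auto elim: dvdE)
  then have y: "(x * S) ^ l = omega N * y - X ^ l"
    using odd by (simp add: xS eq_diff_eq)
  define Q where "Q = x ^ l * b + \<sigma> b"
  have "X ^ l * Q = P * (x ^ l * \<sigma> a - x ^ l * a) + omega N * (y * \<sigma> b - x ^ l * t)"
  proof -
    have "x ^ l * (\<sigma> g - g) = x ^ l * (omega N * t)" by (simp add: t)
    moreover have "x ^ l * \<sigma> g = P * (x ^ l * \<sigma> a) + (x * S) ^ l * \<sigma> b"
      by (simp add: \<sigma>g algebra_simps power_mult_distrib)
    moreover have "x ^ l * g = P * (x ^ l * a) + X ^ l * (x ^ l * b)"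
      by (simp add: g algebra_simps)
    ultimately show ?thesis unfolding y Q_def by (simp add: algebra_simps)
  qed
  then have XQ: "X ^ l * Q = P * (x ^ l * \<sigma> a - x ^ l * a + c * (y * \<sigma> b - x ^ l * t)) + X ^ N * (y * \<sigma> b - x ^ l * t)"
    unfolding c by (simp add: algebra_simps)
  have dvdQ: "int p dvd coeff Q i" if "i < 2" for i
  proof -
    have "coeff (X ^ l * Q) (l + i) = coeff Q i"
      by (simp add: X_def monom_power coeff_monom_mult)
    moreover have "coeff (X ^ N * (y * \<sigma> b - x ^ l * t)) (l + i) = 0"
      using l that by (simp add: X_def monom_power coeff_monom_mult N_def)
    moreover have "int p dvd coeff (P * z) j" for z j by (simp add: P_def)
    ultimately show ?thesis unfolding XQ coeff_add by (metis add.right_neutral)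
  qed
  have xl: "coeff (x ^ k) 0 = 1" "coeff (x ^ k) 1 = int k" for k
  proof -
    show "coeff (x ^ k) 0 = 1" by (simp add: x_def coeff_0_power)
    show "coeff (x ^ k) 1 = int k"
      by (induction k) (simp_all add: x_def coeff_pCons coeff_0_power algebra_simps)
  qed
  have S0: "coeff S 0 = 0" and S1: "coeff S 1 = int N - 1"
    using \<open>N > 0\<close> xl[of "N - 1"] by (simp_all add: S_def of_nat_diff)
  have \<sigma>0: "coeff (\<sigma> b) 0 = coeff b 0"
    using S0 by (simp add: \<sigma>_def pcompose_coeff_0 poly_0_coeff_0)
  have \<sigma>1: "coeff (\<sigma> b) 1 = coeff b 1 * (int N - 1)"
  proof -
    have c1: "coeff f 1 = coeff (pderiv f) 0" for f :: "int poly" by (simp add: coeff_pderiv)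
    have "coeff (\<sigma> b) 1 = coeff (pcompose (pderiv b) S * pderiv S) 0"
      unfolding c1 \<sigma>_def by (simp add: pderiv_pcompose)
    also have "\<dots> = coeff (pderiv b) 0 * coeff (pderiv S) 0"
      using S0 by (simp add: coeff_mult_0 pcompose_coeff_0 poly_0_coeff_0)
    finally show ?thesis unfolding c1[symmetric] S1 .
  qed
  have "int p dvd 2 * coeff b 0"
    using dvdQ[of 0] by (simp add: Q_def \<sigma>0 coeff_mult_0 xl)
  have "coeff Q 1 = int l * coeff b 0 + int N * coeff b 1"
  proof -
    have "coeff (x ^ l * b) 1 = coeff b 1 + int l * coeff b 0"
      using xl[of l] by (simp add: coeff_mult atMost_Suc)
    then show ?thesis unfolding Q_def coeff_add \<sigma>1 by (simp add: algebra_simps)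
  qed
  moreover have "int p dvd int N" using n by (simp add: N_def)
  ultimately have "int p dvd int l * coeff b 0"
    using dvdQ[of 1] by (simp add: dvd_add_left_iff)
  have "\<not> int p dvd coeff b 0" using b0 unit by simp
  moreover have "prime (int p)" using p by simp
  ultimately have "int p dvd 2" "int p dvd int l"
    using \<open>int p dvd 2 * coeff b 0\<close> \<open>int p dvd int l * coeff b 0\<close> by (auto simp: prime_dvd_mult_iff)
  then have "p = 2" "p dvd l"
    using p primes_dvd_imp_eq[of p 2] two_is_prime_nat int_dvd_int_iff[of p 2] by auto
  then show False using odd by simp
qed


section \<open>Products over roots of unity\<close>

text \<open>
  Evaluation at \<open>T = z - 1\<close>, that is at \<open>1 + T = z\<close>.
\<close>

definition ev :: "int poly \<Rightarrow> complex \<Rightarrow> complex" where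
  "ev f z = poly (map_poly of_int f) (z - 1)"

lemma ev_simps [simp]:
  "ev 0 z = 0" "ev 1 z = 1" "ev (pCons c f) z = of_int c + (z - 1) * ev f z"
  "ev (f + g) z = ev f z + ev g z" "ev (f - g) z = ev f z - ev g z" "ev (- f) z = - ev f z"
  "ev (f * g) z = ev f z * ev g z" "ev (f ^ k) z = ev f z ^ k"
  by (simp_all add: ev_def of_int_hom.map_poly_pCons_hom of_int_poly_hom.hom_add of_int_poly_hom.hom_mult
      of_int_poly_hom.hom_minus of_int_poly_hom.hom_uminus of_int_poly_hom.hom_power)

lemma ev_smult [simp]: "ev (Polynomial.smult c f) z = of_int c * ev f z"
proof -
  have "ev ([:c:] * f) z = ev [:c:] z * ev f z" by (rule ev_simps)
  then show ?thesis by simp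
qed

lemma ev_monom [simp]: "ev (monom 1 k) z = (z - 1) ^ k"
proof -
  have "monom 1 k = (monom 1 1 :: int poly) ^ k" by (simp add: monom_power)
  then show ?thesis by (simp add: monom_altdef)
qed

lemma ev_omega: "ev (omega N) z = z ^ N - 1"
  by (simp add: omega_def)

lemma ev_eq_if_omega_dvd:
  assumes "omega N dvd f - g" "z ^ N = 1"
  shows "ev f z = ev g z"
proof -
  obtain h where "f - g = omega N * h" using assms by blast
  then have "ev (f - g) z = ev (omega N) z * ev h z" by (metis ev_simps(7))
  then show ?thesis using assms by (simp add: ev_omega)
qed

text \<open>
  At an \<open>N\<close>-th root of unity only the exponents of \<open>1 + T\<close> modulo \<open>N\<close> matter.
\<close>

lemma ev_as_cyclic_sum:
  assumes "N > 0"
  obtains m :: "nat \<Rightarrow> int" where "\<And>z. z ^ N = 1 \<Longrightarrow> ev f z = (\<Sum>c<N. of_int (m c) * z ^ c)"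
proof -
  have "\<exists>m :: nat \<Rightarrow> int. \<forall>z. z ^ N = 1 \<longrightarrow> ev f z = (\<Sum>c<N. of_int (m c) * z ^ c)"
  proof (induction f)
    case 0
    show ?case by (intro exI[of _ "\<lambda>_. 0"]) simp
  next
    case (pCons a f)
    then obtain m :: "nat \<Rightarrow> int" where m: "\<And>z. z ^ N = 1 \<Longrightarrow> ev f z = (\<Sum>c<N. of_int (m c) * z ^ c)"
      by blast
    define m' where "m' c = (if c = 0 then a else 0) + m ((c + N - 1) mod N) - m c" for c
    have "ev (pCons a f) z = (\<Sum>c<N. of_int (m' c) * z ^ c)" if z: "z ^ N = 1" for z
    proof -
      have A: "((c + N - 1) mod N + 1) mod N = c" if "c < N" for c
        using that assms by (cases c) (auto simp: mod_Suc)
      have B: "((c + 1) mod N + N - 1) mod N = c" if "c < N" for c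
        using that assms by (cases "c + 1 = N") auto
      have "(\<Sum>c<N. of_int (m ((c + N - 1) mod N)) * z ^ c) = (\<Sum>c<N. of_int (m c) * z ^ ((c + 1) mod N))"
        by (rule sum.reindex_bij_witness[where i = "\<lambda>c. (c + 1) mod N" and j = "\<lambda>b. (b + N - 1) mod N"])
           (use assms A B in auto)
      also have "\<dots> = (\<Sum>c<N. z * (of_int (m c) * z ^ c))"
      proof (intro sum.cong refl)
        fix c
        have "z ^ (c + 1) = z ^ ((c + 1) mod N + N * ((c + 1) div N))" by simp
        also have "\<dots> = z ^ ((c + 1) mod N)"
          unfolding power_add power_mult z by simp
        finally show "of_int (m c) * z ^ ((c + 1) mod N) = z * (of_int (m c) * z ^ c)" by simp
      qed
      finally have shift: "(\<Sum>c<N. of_int (m ((c + N - 1) mod N)) * z ^ c) = z * ev f z"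
        by (simp add: m[OF z] sum_distrib_left)
      have "(\<Sum>c<N. of_int (if c = 0 then a else 0) * z ^ c) = (\<Sum>c<N. if c = 0 then of_int a else 0)"
        by (intro sum.cong) auto
      then have "(\<Sum>c<N. of_int (if c = 0 then a else 0) * z ^ c) = of_int a"
        using assms by (simp add: sum.delta)
      then show ?thesis
        using shift m[OF z] by (simp add: m'_def sum.distrib sum_subtractf algebra_simps)
    qed
    then show ?case by blast
  qed
  then show ?thesis using that by blast
qed

text \<open>
  This is why the product is an integer. The one-point set serves as the set of blocks.
\<close>

lemma prod_cyclic_sums_eq_fdet:
  fixes m :: "nat \<Rightarrow> int"
  assumes "N > 0"
  shows "(\<Prod>z :: complex | z ^ N = 1. \<Sum>c<N. of_int (m c) * z ^ c)
    = of_int (fdet ({..<N} \<times> {()}) (\<lambda>x y. m ((fst y + N - fst x) mod N)))"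
proof -
  have "(\<Prod>z :: complex | z ^ N = 1. \<Sum>c<N. of_int (m c) * z ^ c)
      = (\<Prod>z | z ^ N = 1. fdet {()} (\<lambda>u v. \<Sum>c<N. of_int (m c) * z ^ c))" by simp
  also have "\<dots> = fdet ({..<N} \<times> {()}) (\<lambda>x y. complex_of_int (m ((fst y + N - fst x) mod N)))"
    by (rule fdet_block_circulant[OF assms, symmetric]) simp
  also have "\<dots> = of_int (fdet ({..<N} \<times> {()}) (\<lambda>x y. m ((fst y + N - fst x) mod N)))"
    by (rule fdet_hom[symmetric]) auto
  finally show ?thesis .
qed

text \<open>
  By the binomial theorem modulo \<open>p\<close>, the power \<open>h ^ p ^ n\<close> is \<open>(h 0) ^ p ^ n\<close> modulo \<open>p\<close> and
  \<open>omega (p ^ n)\<close>. So the corresponding power of the product is the determinant of a circulant matrix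
  that is congruent modulo \<open>p\<close> to a multiple of the identity by a number prime to \<open>p\<close>.
\<close>

lemma prod_ev_unit:
  assumes p: "prime p" and h: "\<not> int p dvd coeff h 0"
  obtains k :: int where "\<not> int p dvd k" "(\<Prod>z | z ^ (p ^ n) = 1. ev h z) = of_int k"
proof -
  define N where "N = p ^ n"
  have N: "N > 0" using prime_gt_0_nat[OF p] by (simp add: N_def)
  have pp: "prime (int p)" using p by simp
  obtain m where "\<And>z. z ^ N = 1 \<Longrightarrow> ev h z = (\<Sum>c<N. of_int (m c) * z ^ c)"
    using ev_as_cyclic_sum[OF N] by blast
  then have "(\<Prod>z | z ^ N = 1. ev h z)
      = of_int (fdet ({..<N} \<times> {()}) (\<lambda>x y. m ((fst y + N - fst x) mod N)))" (is "_ = of_int ?k")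
    by (simp add: prod_cyclic_sums_eq_fdet[OF N, symmetric])
  define k where "k = ?k"
  have k: "(\<Prod>z | z ^ N = 1. ev h z) = of_int k" unfolding k_def by fact
  define a where "a = coeff h 0"
  obtain h' where h': "h = [:a:] + monom 1 1 * h'"
    by (cases h) (auto simp: a_def monom_altdef)
  have "of_nat p dvd ([:a:] + monom 1 1 * h') ^ N - ([:a:] ^ N + (monom 1 1 * h') ^ N)"
    unfolding N_def using p by (rule prime_power_dvd_freshman)
  then obtain w where "([:a:] + monom 1 1 * h') ^ N - ([:a:] ^ N + (monom 1 1 * h') ^ N) = of_nat p * w"
    by (rule dvdE)
  then have w: "h ^ N = [:a:] ^ N + (monom 1 1 * h') ^ N + of_nat p * w"
    by (simp only: h' diff_eq_eq add_ac)
  obtain c where c: "omega N = monom 1 N + [:int p:] * c"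
    unfolding N_def using omega_mod_prime[OF p] .
  have P: "(of_nat p :: int poly) = [:int p:]" by (simp add: of_nat_poly)
  define w' where "w' = w - c * h' ^ N"
  have "(monom 1 1 * h') ^ N = (omega N - of_nat p * c) * h' ^ N"
    unfolding P c by (simp add: power_mult_distrib monom_power)
  then have hN: "h ^ N = [:a:] ^ N + of_nat p * w' + omega N * h' ^ N"
    using w by (simp add: w'_def algebra_simps)
  obtain m' where m': "\<And>z. z ^ N = 1 \<Longrightarrow> ev w' z = (\<Sum>c<N. of_int (m' c) * z ^ c)"
    using ev_as_cyclic_sum[OF N] by blast
  \<comment> \<open>The coefficients of \<open>h ^ N\<close> as an element of the group ring.\<close>
  define m2 where "m2 c = (if c = 0 then a ^ N else 0) + int p * m' c" for c
  have ev_hN: "ev h z ^ N = (\<Sum>c<N. of_int (m2 c) * z ^ c)" if z: "z ^ N = 1" for z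
  proof -
    have "ev h z ^ N = ev (h ^ N) z" by simp
    also have "\<dots> = of_int (a ^ N) + of_nat p * ev w' z"
      unfolding hN using z by (simp add: P ev_omega)
    also have "of_int (a ^ N) = (\<Sum>c<N. of_int (if c = 0 then a ^ N else 0) * z ^ c)"
    proof -
      have "(\<Sum>c<N. of_int (if c = 0 then a ^ N else 0) * z ^ c) = (\<Sum>c<N. if c = 0 then of_int (a ^ N) else 0)"
        by (intro sum.cong) auto
      then show ?thesis using N by (simp add: sum.delta)
    qed
    finally show ?thesis
      by (simp add: m'[OF z] m2_def sum.distrib sum_distrib_left algebra_simps)
  qed
  let ?I = "{..<N} \<times> {()}"
  have "of_int (k ^ N) = (\<Prod>z | z ^ N = 1. ev h z ^ N)"
    using k by (simp add: prod_power_distrib[symmetric])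
  also have "\<dots> = (\<Prod>z | z ^ N = 1. \<Sum>c<N. of_int (m2 c) * z ^ c)"
    by (intro prod.cong) (auto simp: ev_hN)
  also have "\<dots> = of_int (fdet ?I (\<lambda>x y. m2 ((fst y + N - fst x) mod N)))"
    by (rule prod_cyclic_sums_eq_fdet[OF N])
  finally have kN: "k ^ N = fdet ?I (\<lambda>x y. m2 ((fst y + N - fst x) mod N))"
    using of_int_eq_iff by blast
  have "int p dvd fdet ?I (\<lambda>x y. m2 ((fst y + N - fst x) mod N)) - fdet ?I (\<lambda>x y. if x = y then a ^ N else 0)"
  proof (rule fdet_cong_dvd)
    fix x y assume "x \<in> ?I" "y \<in> ?I"
    then have "(fst y + N - fst x) mod N = 0 \<longleftrightarrow> x = y"
      using cyclic_diff_eq_iff[of "fst x" N "fst y" 0] by (auto simp: prod_eq_iff)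
    then show "int p dvd m2 ((fst y + N - fst x) mod N) - (if x = y then a ^ N else 0)"
      by (simp add: m2_def)
  qed
  moreover have "fdet ?I (\<lambda>x y. if x = y then a ^ N else 0) = (\<Prod>x\<in>?I. a ^ N)"
    by (subst fdet_ranked[where h = "\<lambda>_. 0"]) auto
  ultimately have "int p dvd k ^ N - (a ^ N) ^ N" using kN by simp
  moreover have "\<not> int p dvd (a ^ N) ^ N" using h prime_dvd_power[OF pp] by (metis a_def)
  ultimately have "\<not> int p dvd k ^ N" by (metis dvd_diff_right_iff)
  then have "\<not> int p dvd k" using N by (metis dvd_power dvd_trans)
  then show ?thesis using that k by (simp add: N_def)
qed

text \<open>
  The roots of unity of exact order \<open>p ^ Suc m\<close>, if \<open>p\<close> is prime.
\<close>

definition primitive_roots :: "nat \<Rightarrow> nat \<Rightarrow> complex set" where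
  "primitive_roots p m = {z. z ^ (p ^ Suc m) = 1 \<and> z ^ (p ^ m) \<noteq> 1}"

lemma roots_of_unity_Suc:
  assumes "prime p"
  shows "{z :: complex. z ^ (p ^ Suc m) = 1} = {z. z ^ (p ^ m) = 1} \<union> primitive_roots p m"
    "{z. z ^ (p ^ m) = 1} \<inter> primitive_roots p m = {}"
    "finite {z :: complex. z ^ (p ^ m) = 1}" "finite (primitive_roots p m)"
proof -
  have "z ^ (p ^ Suc m) = (z ^ (p ^ m)) ^ p" for z :: complex
    by (simp add: power_mult[symmetric] mult.commute)
  then show *: "{z :: complex. z ^ (p ^ Suc m) = 1} = {z. z ^ (p ^ m) = 1} \<union> primitive_roots p m"
    by (auto simp: primitive_roots_def)
  show fin: "finite {z :: complex. z ^ (p ^ m) = 1}" for m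
    using finite_roots_unity[of "p ^ m"] prime_gt_0_nat[OF assms] by (simp add: Suc_leI)
  show "finite (primitive_roots p m)"
    by (rule finite_subset[OF _ fin[of "Suc m"]]) (auto simp: primitive_roots_def)
qed (auto simp: primitive_roots_def)

lemma prod_primitive_roots:
  assumes "prime p"
  shows "(\<Prod>z | z ^ (p ^ Suc m) = 1. f z) = (\<Prod>z | z ^ (p ^ m) = 1. f z) * (\<Prod>z\<in>primitive_roots p m. f z)"
  unfolding roots_of_unity_Suc(1)[OF assms]
  by (rule prod.union_disjoint) (use roots_of_unity_Suc[OF assms, of m] in auto)

lemma card_primitive_roots:
  assumes "prime p"
  shows "card (primitive_roots p m) = p ^ Suc m - p ^ m"
proof -
  have pos: "p ^ k > 0" for k using prime_gt_0_nat[OF assms] by simp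
  have "card {z :: complex. z ^ (p ^ Suc m) = 1} = card {z :: complex. z ^ (p ^ m) = 1} + card (primitive_roots p m)"
    unfolding roots_of_unity_Suc(1)[OF assms]
    by (rule card_Un_disjoint) (use roots_of_unity_Suc[OF assms, of m] in auto)
  then show ?thesis
    using Complex.card_roots_unity_eq[OF pos[of m]] Complex.card_roots_unity_eq[OF pos[of "Suc m"]] by linarith
qed

lemma prod_primitive_ev_unit:
  assumes p: "prime p" and h: "\<not> int p dvd coeff h 0"
  obtains k l :: int where "\<not> int p dvd k" "\<not> int p dvd l"
    "of_int k = of_int l * (\<Prod>z\<in>primitive_roots p m. ev h z)"
proof -
  obtain k where k: "\<not> int p dvd k" "(\<Prod>z | z ^ (p ^ Suc m) = 1. ev h z) = of_int k"
    using prod_ev_unit[OF p h] .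
  obtain l where l: "\<not> int p dvd l" "(\<Prod>z | z ^ (p ^ m) = 1. ev h z) = of_int l"
    using prod_ev_unit[OF p h] .
  show ?thesis
    using that[OF k(1) l(1)] k(2) l(2) prod_primitive_roots[OF p, of "ev h" m] by simp
qed

text \<open>
  Both sides are the value at 1 of the derivative of \<open>x ^ N - 1 = (\<Prod>z. x - z)\<close>.
\<close>

lemma prod_one_minus_roots_of_unity:
  assumes "N > 0"
  shows "(\<Prod>z \<in> {z :: complex. z ^ N = 1} - {1}. 1 - z) = of_nat N"
proof -
  let ?Z = "{z :: complex. z ^ N = 1}"
  define f where "f = (\<Prod>z\<in>?Z. [:- z, 1:])"
  define g :: "complex poly" where "g = monom 1 N - 1"
  have fin: "finite ?Z" using finite_roots_unity[of N] assms by (simp add: Suc_leI)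
  have card: "card ?Z = N" using Complex.card_roots_unity_eq[OF assms] .
  have "lead_coeff f = (\<Prod>z\<in>?Z. lead_coeff [:- z, 1:])" unfolding f_def by (rule lead_coeff_prod)
  then have f: "degree f = N" "lead_coeff f = 1"
    by (simp_all add: f_def degree_prod_sum_eq card)
  have "f - g = 0"
  proof (rule ccontr)
    assume nz: "f - g \<noteq> 0"
    have cN: "coeff (f - g) N = 0" using f assms by (simp add: g_def)
    have "degree g \<le> N" by (simp add: g_def degree_diff_le degree_monom_le)
    then have "degree (f - g) \<le> N" using f by (simp add: degree_diff_le)
    then have "degree (f - g) < N" using cN nz by (metis leading_coeff_0_iff le_neq_implies_less)
    moreover have "?Z \<subseteq> {z. poly (f - g) z = 0}"
    proof
      fix z assume z: "z \<in> ?Z"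
      have "poly f z = 0" using z fin unfolding f_def poly_prod by (intro prod_zero) auto
      then show "z \<in> {z. poly (f - g) z = 0}" using z by (simp add: g_def poly_monom)
    qed
    then have "N \<le> card {z. poly (f - g) z = 0}"
      using card card_mono[OF poly_roots_finite[OF nz]] by metis
    then have "N \<le> degree (f - g)" using card_poly_roots_bound[OF nz] by simp
    ultimately show False by simp
  qed
  then have "poly (pderiv f) 1 = poly (pderiv g) 1" by simp
  also have "\<dots> = of_nat N" by (simp add: g_def pderiv_diff pderiv_monom poly_monom)
  finally have "poly (pderiv f) 1 = of_nat N" .
  moreover define h where "h = (\<Prod>z\<in>?Z - {1}. [:- z, 1:])"
  have "f = [:- 1, 1:] * h"
    unfolding f_def h_def using fin by (subst prod.remove[of _ 1]) auto
  then have "poly (pderiv f) 1 = poly h 1"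
    by (simp add: pderiv_diff pderiv_pCons)
  moreover have "poly h 1 = (\<Prod>z\<in>?Z - {1}. 1 - z)" by (simp add: h_def poly_prod)
  ultimately show ?thesis by simp
qed

lemma prod_primitive_one_minus:
  assumes "prime p"
  shows "(\<Prod>z\<in>primitive_roots p m. 1 - z) = of_nat p"
proof -
  have pos: "p ^ k > 0" for k using prime_gt_0_nat[OF assms] by simp
  have "{z :: complex. z ^ (p ^ Suc m) = 1} - {1} = ({z. z ^ (p ^ m) = 1} - {1}) \<union> primitive_roots p m"
    unfolding roots_of_unity_Suc(1)[OF assms] by (auto simp: primitive_roots_def)
  then have "(\<Prod>z \<in> {z :: complex. z ^ (p ^ Suc m) = 1} - {1}. 1 - z)
      = (\<Prod>z \<in> {z :: complex. z ^ (p ^ m) = 1} - {1}. 1 - z) * (\<Prod>z\<in>primitive_roots p m. 1 - z)"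
    using roots_of_unity_Suc[OF assms, of m] by (simp only:) (intro prod.union_disjoint; auto)
  then have "of_nat (p ^ Suc m) = of_nat (p ^ m) * (\<Prod>z\<in>primitive_roots p m. 1 - z)"
    using prod_one_minus_roots_of_unity[OF pos[of m]] prod_one_minus_roots_of_unity[OF pos[of "Suc m"]] by metis
  then show ?thesis using prime_gt_0_nat[OF assms] by simp
qed

text \<open>
  In the ring generated by a primitive root of unity \<open>z\<close>, the number \<open>p\<close> is a unit times
  \<open>(z - 1) ^ \<phi>\<close>, where \<open>\<phi> = p ^ Suc m - p ^ m\<close> exceeds \<open>l\<close>. So all terms of \<open>g\<close> at \<open>z - 1\<close> except
  the one of degree \<open>l\<close> are divisible by a higher power of \<open>z - 1\<close> than \<open>l\<close>, and \<open>g\<close> takes the value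
  \<open>(z - 1) ^ l\<close> times a unit. The units are treated as values of polynomials with constant term prime
  to \<open>p\<close>, to which \<open>prod_ev_unit\<close> applies; the product of all \<open>z - 1\<close> is \<open>p\<close> up to sign.
\<close>

lemma prod_primitive_ev_valuation:
  assumes p: "prime p" and l: "l < p ^ Suc m - p ^ m"
    and low: "\<And>i. i < l \<Longrightarrow> int p dvd coeff g i" and unit: "\<not> int p dvd coeff g l"
  obtains u v :: int where "\<not> int p dvd u" "\<not> int p dvd v"
    "of_int u * (\<Prod>z\<in>primitive_roots p m. ev g z) = of_int v * of_nat p ^ l"
proof -
  let ?E = "primitive_roots p m"
  define q \<phi> where "q = p ^ m" and "\<phi> = p ^ Suc m - p ^ m"
  define P where "P = [:int p:]"
  have pp: "prime (int p)" using p by simp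
  have qp: "p ^ Suc m = q + \<phi>"
    using prime_gt_0_nat[OF p] by (simp add: q_def \<phi>_def)
  have q\<phi>: "\<phi> > l" using l by (simp add: \<phi>_def)
  define \<Phi> where "\<Phi> = (\<Sum>i<p. ([:1, 1 :: int:] ^ q) ^ i)"
  have om: "omega (p ^ Suc m) = omega q * \<Phi>"
    using power_diff_sumr2[of "[:1, 1 :: int:] ^ q" p 1]
    by (simp add: omega_def \<Phi>_def q_def power_mult[symmetric] mult.commute)
  have \<Phi>0: "coeff \<Phi> 0 = int p" by (simp add: \<Phi>_def coeff_sum coeff_0_power)
  obtain c0 where c0: "omega q = monom 1 q + P * c0"
    using omega_mod_prime[OF p] by (auto simp: q_def P_def)
  obtain c1 where c1: "omega (p ^ Suc m) = monom 1 (p ^ Suc m) + P * c1"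
    using omega_mod_prime[OF p, of "Suc m"] unfolding P_def by blast
  have "monom 1 q * (\<Phi> - monom 1 \<phi>) = P * (c1 - c0 * \<Phi>)"
  proof -
    have "monom 1 (p ^ Suc m) = monom 1 q * (monom 1 \<phi> :: int poly)"
      unfolding qp by (simp add: mult_monom)
    then have "(monom 1 q + P * c0) * \<Phi> = monom 1 q * monom 1 \<phi> + P * c1"
      using om c0 c1 by simp
    then show ?thesis by (simp add: algebra_simps)
  qed
  then have "P dvd monom 1 q * (\<Phi> - monom 1 \<phi>)" by simp
  moreover have "\<not> P dvd monom 1 q"
    unfolding P_def by (rule not_prime_dvd_monic[OF p]) (simp add: degree_monom_eq)
  ultimately have "P dvd \<Phi> - monom 1 \<phi>"
    using prime_const_poly[OF p] by (auto simp: P_def prime_elem_dvd_mult_iff)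
  then obtain r where "\<Phi> - monom 1 \<phi> = P * r" by (rule dvdE)
  then have r: "\<Phi> = monom 1 \<phi> + P * r" by (simp only: diff_eq_eq add.commute)
  have "int p * coeff r 0 = int p"
    using \<Phi>0 q\<phi> by (simp add: r P_def)
  then have r0: "coeff r 0 = 1" using prime_gt_0_nat[OF p] by simp
  have ev_r: "of_nat p * ev r z = - ((z - 1) ^ \<phi>)" if "z \<in> ?E" for z
  proof -
    have "ev (omega q) z \<noteq> 0" "ev (omega (p ^ Suc m)) z = 0"
      using that by (auto simp: ev_omega primitive_roots_def q_def)
    then have "ev \<Phi> z = 0" by (metis om ev_simps(7) mult_eq_0_iff)
    then show ?thesis by (simp add: r P_def eq_neg_iff_add_eq_0 add.commute)
  qed
  obtain a b where g: "g = P * a + monom 1 l * b" and b0: "coeff b 0 = coeff g l"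
    using split_at_coeff[of l p g] low by (auto simp: P_def)
  \<comment> \<open>\<open>r * g\<close> takes the same values as \<open>T ^ l * h\<close>, since \<open>p * r\<close> takes the values of \<open>- T ^ \<phi>\<close>.\<close>
  define h where "h = r * b - monom 1 (\<phi> - l) * a"
  have h0: "coeff h 0 = coeff b 0"
    using q\<phi> r0 by (simp add: h_def coeff_mult_0)
  have ev_rg: "ev r z * ev g z = (z - 1) ^ l * ev h z" if "z \<in> ?E" for z
  proof -
    have "ev r z * ev g z = (of_nat p * ev r z) * ev a z + (z - 1) ^ l * (ev r z * ev b z)"
      by (simp add: g P_def algebra_simps)
    also have "\<dots> = (z - 1) ^ l * ev r z * ev b z - (z - 1) ^ (l + (\<phi> - l)) * ev a z"
      using ev_r[OF that] q\<phi> by simp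
    also have "\<dots> = (z - 1) ^ l * ev h z"
      by (simp only: power_add h_def ev_simps ev_monom) (simp add: algebra_simps)
    finally show ?thesis .
  qed
  obtain k1 l1 where 1: "\<not> int p dvd k1" "\<not> int p dvd l1" "of_int k1 = of_int l1 * (\<Prod>z\<in>?E. ev r z)"
    using prod_primitive_ev_unit[OF p, of r m] r0 pp by (metis not_prime_unit)
  obtain k2 l2 where 2: "\<not> int p dvd k2" "\<not> int p dvd l2" "of_int k2 = of_int l2 * (\<Prod>z\<in>?E. ev h z)"
    using prod_primitive_ev_unit[OF p, of h m] h0 b0 unit by metis
  define s :: int where "s = (- 1) ^ card ?E"
  have "(\<Prod>z\<in>?E. z - 1) = (\<Prod>z\<in>?E. (- 1) * (1 - z))" by simp
  then have X: "(\<Prod>z\<in>?E. z - 1) = of_int s * of_nat p"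
    unfolding prod.distrib prod_primitive_one_minus[OF p] by (simp add: s_def)
  have "(\<Prod>z\<in>?E. ev r z) * (\<Prod>z\<in>?E. ev g z) = (\<Prod>z\<in>?E. z - 1) ^ l * (\<Prod>z\<in>?E. ev h z)"
    unfolding prod.distrib[symmetric] prod_power_distrib using ev_rg by (intro prod.cong) auto
  then have "of_int (k1 * l2) * (\<Prod>z\<in>?E. ev g z) = of_int (s ^ l * l1 * k2) * of_nat p ^ l"
    using 1(3) 2(3) X by (simp add: power_mult_distrib algebra_simps)
  moreover have "\<not> int p dvd k1 * l2" using 1 2 pp by (simp add: prime_dvd_mult_iff)
  moreover have "s = 1 \<or> s = - 1" by (simp add: s_def) (metis minus_one_power_iff)
  then have "\<not> int p dvd s" using pp by (auto simp: not_prime_unit)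
  then have "\<not> int p dvd s ^ l" using prime_dvd_power[OF pp] by blast
  then have "\<not> int p dvd s ^ l * l1 * k2"
    using 1(2) 2(1) by (simp add: prime_dvd_mult_iff[OF pp])
  ultimately show ?thesis using that by blast
qed


section \<open>Laplacians and voltage determinants\<close>

context serre_graph
begin

text \<open>
  Reversal of arcs exchanges the arcs from \<open>u\<close> to \<open>v\<close> with those from \<open>v\<close> to \<open>u\<close>.
\<close>

lemma sum_arev:
  "(\<Sum>e\<in>out_arcs G u. of_bool (head G e = v) * w (arev e))
     = (\<Sum>e\<in>out_arcs G v. of_bool (head G e = u) * (w e :: 'c :: comm_ring_1))"
proof -
  let ?A = "\<lambda>u v. {e \<in> arcs G. tail G e = u \<and> head G e = v}"
  have *: "(\<Sum>e\<in>out_arcs G u. of_bool (head G e = v) * w e) = (\<Sum>e\<in>?A u v. w e)" for u v and w :: "'b \<Rightarrow> 'c"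
    by (rule sum.mono_neutral_cong_right) auto
  have "(\<Sum>e\<in>?A u v. w (arev e)) = (\<Sum>e\<in>?A v u. w e)"
    by (rule sum.reindex_bij_witness[of _ arev arev]) auto
  then show ?thesis unfolding * .
qed

lemma laplacian_sym: "laplacian G u v = (laplacian G v u :: 'c :: comm_ring_1)"
  using sum_arev[where u = u and v = v and w = "\<lambda>_. 1 :: 'c"] by (auto simp: laplacian_def sum_subtractf)

lemma laplacian_row_sum:
  assumes "u \<in> verts G"
  shows "(\<Sum>v\<in>verts G. laplacian G u v) = (0 :: 'c :: comm_ring_1)"
proof -
  have "(\<Sum>v\<in>verts G. laplacian G u v)
      = (\<Sum>e\<in>out_arcs G u. \<Sum>v\<in>verts G. of_bool (u = v) - of_bool (head G e = v) :: 'c)"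
    unfolding laplacian_def by (rule sum.swap)
  also have "\<dots> = 0"
  proof (rule sum.neutral, rule ballI)
    have one: "(\<Sum>v\<in>verts G. of_bool (w = v)) = (1 :: 'c)" if "w \<in> verts G" for w
      using that by (simp add: of_bool_def sum.delta)
    fix e assume "e \<in> out_arcs G u"
    then show "(\<Sum>v\<in>verts G. of_bool (u = v) - of_bool (head G e = v)) = (0 :: 'c)"
      using assms by (simp add: sum_subtractf one)
  qed
  finally show ?thesis .
qed

lemma fdet_laplacian_add_constant:
  assumes "verts G \<noteq> {}"
  shows "fdet (verts G) (\<lambda>u v. laplacian G u v + c)
       = c * of_nat (card (verts G)) ^ 2 * (of_nat (num_spanning_trees arev G) :: 'c :: field_char_0)"
proof -
  obtain r where r: "r \<in> verts G" using assms by blast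
  have cols: "(\<Sum>i\<in>verts G. laplacian G i j) = (0 :: 'c)" if "j \<in> verts G" for j
    using laplacian_row_sum[OF that, where 'c = 'c] by (subst laplacian_sym) simp
  show ?thesis
    unfolding num_spanning_trees_eq_fdet[OF r, where 'c = 'c]
    by (rule fdet_add_constant[OF _ r laplacian_row_sum cols]) auto
qed

text \<open>
  The determinant of the Laplacian of \<open>G\<close> twisted by the voltages \<open>a\<close>, with \<open>1 + T\<close> standing for
  the generator of the cyclic group in which they are taken.
\<close>

definition voltage_det :: "('b \<Rightarrow> nat) \<Rightarrow> int poly" where
  "voltage_det a = fdet (verts G)
     (\<lambda>u v. \<Sum>e\<in>out_arcs G u. of_bool (u = v) - of_bool (head G e = v) * [:1, 1:] ^ a e)"

lemma ev_voltage_det: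
  "ev (voltage_det a) z
     = fdet (verts G) (\<lambda>u v. \<Sum>e\<in>out_arcs G u. of_bool (u = v) - of_bool (head G e = v) * z ^ a e)"
proof -
  have ev_sum: "ev (sum f A) z = (\<Sum>x\<in>A. ev (f x) z)" for f :: "'b \<Rightarrow> int poly" and A
    by (induction A rule: infinite_finite_induct) auto
  have ev_bool: "ev (of_bool b) z = of_bool b" for b by (cases b) auto
  show ?thesis
    unfolding voltage_det_def
    by (subst fdet_hom[where h = "\<lambda>f. ev f z"]) (simp_all add: ev_sum ev_bool)
qed

text \<open>
  At \<open>T = 0\<close> the matrix is the Laplacian of \<open>G\<close>, whose rows sum up to 0.
\<close>

lemma coeff_voltage_det_0:
  assumes "verts G \<noteq> {}"
  shows "coeff (voltage_det a) 0 = 0"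
proof -
  have "coeff (voltage_det a) 0 = fdet (verts G) (\<lambda>u v. laplacian G u v :: int)"
    unfolding voltage_det_def laplacian_def
    by (subst fdet_hom[where h = "\<lambda>f. coeff f 0"])
       (simp_all add: coeff_mult_0 coeff_sum coeff_0_power of_bool_def if_distrib[of "\<lambda>f. coeff f 0"] cong: if_cong)
  also have "\<dots> = 0"
    by (rule fdet_vanishing_row_sums[of _ "verts G"]) (use assms laplacian_row_sum in auto)
  finally show ?thesis .
qed

end

lemma omega_dvd_power_diff:
  assumes "i mod N = j mod N"
  shows "omega N dvd [:1, 1:] ^ i - [:1, 1:] ^ j"
proof -
  have *: "omega N dvd [:1, 1:] ^ i - [:1, 1:] ^ (i mod N)" for i
  proof -
    have "[:1, 1 :: int:] ^ i = [:1, 1:] ^ (i mod N) * [:1, 1:] ^ (N * (i div N))"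
      by (simp add: power_add[symmetric])
    then have "[:1, 1 :: int:] ^ i - [:1, 1:] ^ (i mod N) = [:1, 1:] ^ (i mod N) * omega (N * (i div N))"
      by (simp only: omega_def right_diff_distrib mult_1_right)
    then show ?thesis using omega_dvd_omega[of N "N * (i div N)"] by simp
  qed
  have "[:1, 1 :: int:] ^ i - [:1, 1:] ^ j
      = ([:1, 1:] ^ i - [:1, 1:] ^ (i mod N)) - ([:1, 1:] ^ j - [:1, 1:] ^ (j mod N))"
    using assms by simp
  then show ?thesis using *[of i] *[of j] by (metis dvd_diff)
qed

context serre_graph
begin

lemma voltage_det_cong:
  assumes "\<And>e. e \<in> arcs G \<Longrightarrow> a e mod N = b e mod N"
  shows "omega N dvd voltage_det a - voltage_det b"
  unfolding voltage_det_def
proof (rule fdet_cong_dvd)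
  fix u v
  have "(\<Sum>e\<in>out_arcs G u. of_bool (u = v) - of_bool (head G e = v) * [:1, 1:] ^ a e)
      - (\<Sum>e\<in>out_arcs G u. of_bool (u = v) - of_bool (head G e = v) * [:1, 1 :: int:] ^ b e)
      = (\<Sum>e\<in>out_arcs G u. of_bool (head G e = v) * ([:1, 1:] ^ b e - [:1, 1:] ^ a e))"
    by (simp add: sum_subtractf[symmetric] algebra_simps)
  also have "omega N dvd \<dots>"
    by (intro dvd_sum dvd_mult omega_dvd_power_diff) (use assms in auto)
  finally show "omega N dvd (\<Sum>e\<in>out_arcs G u. of_bool (u = v) - of_bool (head G e = v) * [:1, 1:] ^ a e)
      - (\<Sum>e\<in>out_arcs G u. of_bool (u = v) - of_bool (head G e = v) * [:1, 1 :: int:] ^ b e)" .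
qed

text \<open>
  Inverting \<open>1 + T\<close> inverts all voltages, which amounts to replacing each arc by its reverse and
  thus to transposing the matrix.
\<close>

lemma voltage_det_symmetric:
  assumes N: "N > 0" and inv: "\<And>e. e \<in> arcs G \<Longrightarrow> (a e + a (arev e)) mod N = 0"
  shows "omega N dvd pcompose (voltage_det a) ([:1, 1:] ^ (N - 1) - 1) - voltage_det a"
proof -
  define K where "K = N - 1"
  define S :: "int poly" where "S = [:1, 1:] ^ K - 1"
  have x: "[:1:] + S = [:1, 1:] ^ K" by (simp add: S_def pCons_one)
  have sum: "pcompose (sum f A) S = (\<Sum>x\<in>A. pcompose (f x) S)" for f :: "'b \<Rightarrow> int poly" and A
    by (induction A rule: infinite_finite_induct) (auto simp: pcompose_add)
  have one: "pcompose 1 S = 1" by (simp add: one_pCons)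
  have bool: "pcompose (of_bool b) S = of_bool b" for b by (cases b) (auto simp: one)
  have "pcompose (voltage_det a) S = voltage_det (\<lambda>e. K * a e)"
    unfolding voltage_det_def
    by (subst fdet_hom[where h = "\<lambda>f. pcompose f S"])
       (simp_all add: one pcompose_add pcompose_mult sum pcompose_diff bool pcompose_power x power_mult)
  moreover have "voltage_det a = voltage_det (\<lambda>e. a (arev e))"
  proof -
    have "voltage_det a = fdet (verts G)
       (\<lambda>u v. \<Sum>e\<in>out_arcs G v. of_bool (v = u) - of_bool (head G e = u) * [:1, 1:] ^ a e)"
      unfolding voltage_det_def by (rule fdet_transpose[symmetric]) simp
    also have "\<dots> = voltage_det (\<lambda>e. a (arev e))"
      unfolding voltage_det_def
    proof (rule fdet_cong)
      fix u v
      show "(\<Sum>e\<in>out_arcs G v. of_bool (v = u) - of_bool (head G e = u) * [:1, 1 :: int:] ^ a e)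
          = (\<Sum>e\<in>out_arcs G u. of_bool (u = v) - of_bool (head G e = v) * [:1, 1:] ^ a (arev e))"
        using sum_arev[where u = u and v = v and w = "\<lambda>e. [:1, 1 :: int:] ^ a e"] by (auto simp: sum_subtractf)
    qed
    finally show ?thesis .
  qed
  moreover have "omega N dvd voltage_det (\<lambda>e. K * a e) - voltage_det (\<lambda>e. a (arev e))"
  proof (rule voltage_det_cong)
    fix e assume "e \<in> arcs G"
    then obtain k where k: "a e + a (arev e) = N * k" using inv mod_eq_0_iff_dvd dvdE by metis
    have "N = Suc K" using N by (simp add: K_def)
    then have "K * a e + N * k = a (arev e) + N * a e"
      using k by (simp add: algebra_simps)
    then have "(K * a e + N * k) mod N = (a (arev e) + N * a e) mod N" by simp
    then show "K * a e mod N = a (arev e) mod N" by simp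
  qed
  ultimately show ?thesis by (simp add: S_def K_def)
qed

end


section \<open>Residues of a group isomorphic to the p-adic integers\<close>

text \<open>
  The function \<open>r n\<close> is the residue modulo \<open>p ^ n\<close>. For the last property: if the component
  \<open>x n\<close> of a p-adic integer vanishes, all later ones are divisible by \<open>p ^ n\<close>, and the quotient of
  \<open>x\<close> by \<open>p ^ n\<close> has at place \<open>k\<close> the component \<open>x (n + k) div p ^ n\<close>, since dividing loses \<open>n\<close>
  places of precision.
\<close>

lemma Zp_residues:
  assumes "isomorphic_to_Zp p \<Gamma> T" and p: "p > 0"
  obtains r :: "nat \<Rightarrow> 'g \<Rightarrow> nat" where
    "\<And>n \<gamma>. \<gamma> \<in> carrier \<Gamma> \<Longrightarrow> r n \<gamma> < p ^ n"
    "\<And>n \<gamma>. \<gamma> \<in> carrier \<Gamma> \<Longrightarrow> r (Suc n) \<gamma> mod p ^ n = r n \<gamma>"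
    "\<And>n \<gamma> \<delta>. \<gamma> \<in> carrier \<Gamma> \<Longrightarrow> \<delta> \<in> carrier \<Gamma> \<Longrightarrow> r n (\<gamma> \<otimes>\<^bsub>\<Gamma>\<^esub> \<delta>) = (r n \<gamma> + r n \<delta>) mod p ^ n"
    "\<And>n c. c < p ^ n \<Longrightarrow> \<exists>\<gamma>\<in>carrier \<Gamma>. r n \<gamma> = c"
    "\<And>n. power_subgroup \<Gamma> (p ^ n) = {\<gamma> \<in> carrier \<Gamma>. r n \<gamma> = 0}"
proof -
  interpret group \<Gamma> using assms by (simp add: isomorphic_to_Zp_def)
  obtain \<phi> where \<phi>: "\<phi> \<in> iso \<Gamma> (Zp p)" using assms by (auto simp: isomorphic_to_Zp_def)
  have hom: "\<phi> (\<gamma> \<otimes>\<^bsub>\<Gamma>\<^esub> \<delta>) n = (\<phi> \<gamma> n + \<phi> \<delta> n) mod int p ^ n"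
    if "\<gamma> \<in> carrier \<Gamma>" "\<delta> \<in> carrier \<Gamma>" for \<gamma> \<delta> n
    using \<phi> that by (simp add: iso_def hom_def Zp_def)
  have bij: "bij_betw \<phi> (carrier \<Gamma>) (carrier (Zp p))" using \<phi> by (simp add: iso_def)
  have car: "\<phi> \<gamma> n \<in> {0..<int p ^ n}" "\<phi> \<gamma> (Suc n) mod int p ^ n = \<phi> \<gamma> n"
    if "\<gamma> \<in> carrier \<Gamma>" for \<gamma> n
  proof -
    have "\<phi> \<gamma> \<in> carrier (Zp p)" using bij that by (auto simp: bij_betw_def)
    then show "\<phi> \<gamma> n \<in> {0..<int p ^ n}" "\<phi> \<gamma> (Suc n) mod int p ^ n = \<phi> \<gamma> n"
      by (simp_all add: Zp_def)
  qed
  have surj: "\<exists>\<gamma>\<in>carrier \<Gamma>. \<phi> \<gamma> = x" if "x \<in> carrier (Zp p)" for x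
    using bij_betw_imp_surj_on[OF bij] that by (metis imageE)
  have inj: "\<gamma> = \<delta>" if "\<gamma> \<in> carrier \<Gamma>" "\<delta> \<in> carrier \<Gamma>" "\<phi> \<gamma> = \<phi> \<delta>" for \<gamma> \<delta>
    using bij that by (auto simp: bij_betw_def inj_on_def)
  have one: "\<phi> \<one>\<^bsub>\<Gamma>\<^esub> n = 0" for n
  proof -
    have "\<phi> \<one>\<^bsub>\<Gamma>\<^esub> n = (\<phi> \<one>\<^bsub>\<Gamma>\<^esub> n + \<phi> \<one>\<^bsub>\<Gamma>\<^esub> n) mod int p ^ n"
      using hom[of "\<one>\<^bsub>\<Gamma>\<^esub>" "\<one>\<^bsub>\<Gamma>\<^esub>" n] by simp
    then have "int p ^ n dvd \<phi> \<one>\<^bsub>\<Gamma>\<^esub> n"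
      by (metis add_diff_cancel_left' minus_mod_eq_mult_div dvd_triv_left dvd_minus_iff minus_diff_eq)
    then show ?thesis using car(1)[of "\<one>\<^bsub>\<Gamma>\<^esub>" n] by (auto dest: zdvd_imp_le)
  qed
  have pow: "\<phi> (\<gamma> [^]\<^bsub>\<Gamma>\<^esub> (k :: nat)) n = (int k * \<phi> \<gamma> n) mod int p ^ n" if "\<gamma> \<in> carrier \<Gamma>" for \<gamma> k n
  proof (induction k)
    case (Suc k)
    then show ?case using that by (simp add: hom mod_add_left_eq mod_add_right_eq algebra_simps)
  qed (simp add: one)
  have div_ex: "\<exists>\<delta>\<in>carrier \<Gamma>. \<delta> [^]\<^bsub>\<Gamma>\<^esub> (p ^ n) = \<gamma>" if \<gamma>: "\<gamma> \<in> carrier \<Gamma>" "\<phi> \<gamma> n = 0" for \<gamma> n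
  proof -
    define x where "x = \<phi> \<gamma>"
    define y where "y k = x (n + k) div int p ^ n" for k
    have x: "0 \<le> x k" "x k < int p ^ k" "x (Suc k) mod int p ^ k = x k" for k
      using car[OF \<gamma>(1), of k] by (auto simp: x_def)
    have xmod: "x (n + k) mod int p ^ n = 0" for k
    proof (induction k)
      case (Suc k)
      have "x (n + Suc k) mod int p ^ n = x (Suc (n + k)) mod int p ^ (n + k) mod int p ^ n"
        by (simp add: mod_mod_cancel le_imp_power_dvd)
      then show ?case using Suc x(3)[of "n + k"] by simp
    qed (use \<gamma>(2) in \<open>simp add: x_def\<close>)
    have xmod2: "x (n + k) mod int p ^ k = x k" for k
    proof (induction n)
      case (Suc m)
      have "x (Suc m + k) mod int p ^ k = x (Suc (m + k)) mod int p ^ (m + k) mod int p ^ k"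
        by (simp add: mod_mod_cancel le_imp_power_dvd)
      then show ?case using Suc x(3)[of "m + k"] by simp
    qed (use x in simp)
    have pn: "int p ^ n > 0" using p by simp
    have xy: "x (n + k) = int p ^ n * y k" for k
      unfolding y_def using xmod[of k] by (metis mult_div_mod_eq add.right_neutral)
    have "y \<in> carrier (Zp p)"
    proof -
      have "y k \<in> {0..<int p ^ k}" for k
      proof -
        have "0 \<le> y k" unfolding y_def using x(1) pn by (simp add: pos_imp_zdiv_nonneg_iff)
        moreover have "int p ^ n * y k < int p ^ n * int p ^ k"
          using x(2)[of "n + k"] by (simp add: xy[symmetric] power_add)
        ultimately show ?thesis using pn by simp
      qed
      moreover have "y (Suc k) mod int p ^ k = y k" for k
      proof -
        have "int p ^ n * (y (Suc k) mod int p ^ k) = x (n + Suc k) mod int p ^ (n + k)"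
          by (simp only: xy mult_mod_right power_add)
        also have "\<dots> = int p ^ n * y k" using x(3)[of "n + k"] xy by simp
        finally show ?thesis using p by simp
      qed
      ultimately show ?thesis by (simp add: Zp_def)
    qed
    then obtain \<delta> where \<delta>: "\<delta> \<in> carrier \<Gamma>" "\<phi> \<delta> = y" using surj by blast
    have "\<phi> (\<delta> [^]\<^bsub>\<Gamma>\<^esub> (p ^ n)) = \<phi> \<gamma>"
    proof
      fix k
      have "\<phi> (\<delta> [^]\<^bsub>\<Gamma>\<^esub> (p ^ n)) k = x (n + k) mod int p ^ k"
        by (simp add: pow[OF \<delta>(1)] \<delta>(2) xy)
      then show "\<phi> (\<delta> [^]\<^bsub>\<Gamma>\<^esub> (p ^ n)) k = \<phi> \<gamma> k" by (simp add: xmod2) (simp add: x_def)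
    qed
    then show ?thesis using inj \<delta>(1) \<gamma>(1) by blast
  qed
  define r where "r n \<gamma> = nat (\<phi> \<gamma> n)" for n \<gamma>
  have r: "int (r n \<gamma>) = \<phi> \<gamma> n" if "\<gamma> \<in> carrier \<Gamma>" for n \<gamma>
    using car(1)[OF that, of n] by (simp add: r_def)
  show ?thesis
  proof (rule that[of r])
    fix n \<gamma> assume \<gamma>: "\<gamma> \<in> carrier \<Gamma>"
    have "int (r n \<gamma>) < int (p ^ n)" using car(1)[OF \<gamma>, of n] r[OF \<gamma>] by simp
    then show "r n \<gamma> < p ^ n" by (simp only: of_nat_less_iff)
    have "int (r (Suc n) \<gamma> mod p ^ n) = int (r n \<gamma>)"
      using car(2)[OF \<gamma>, of n] r[OF \<gamma>] by (simp add: zmod_int)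
    then show "r (Suc n) \<gamma> mod p ^ n = r n \<gamma>" by (simp only: of_nat_eq_iff)
    fix \<delta> assume \<delta>: "\<delta> \<in> carrier \<Gamma>"
    have "int (r n (\<gamma> \<otimes>\<^bsub>\<Gamma>\<^esub> \<delta>)) = int ((r n \<gamma> + r n \<delta>) mod p ^ n)"
      using hom[OF \<gamma> \<delta>, of n] r \<gamma> \<delta> by (simp add: zmod_int)
    then show "r n (\<gamma> \<otimes>\<^bsub>\<Gamma>\<^esub> \<delta>) = (r n \<gamma> + r n \<delta>) mod p ^ n" by (simp only: of_nat_eq_iff)
  next
    fix n c assume c: "c < p ^ n"
    define x where "x k = int c mod int p ^ k" for k
    have "x \<in> carrier (Zp p)"
      using p by (simp add: Zp_def x_def mod_mod_cancel le_imp_power_dvd)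
    then obtain \<gamma> where "\<gamma> \<in> carrier \<Gamma>" "\<phi> \<gamma> = x" using surj by blast
    moreover have "x n = int c" using c by (simp add: x_def)
    ultimately show "\<exists>\<gamma>\<in>carrier \<Gamma>. r n \<gamma> = c" by (auto simp: r_def intro!: bexI[of _ \<gamma>])
  next
    fix n
    show "power_subgroup \<Gamma> (p ^ n) = {\<gamma> \<in> carrier \<Gamma>. r n \<gamma> = 0}"
    proof (intro equalityI subsetI)
      fix \<gamma> assume "\<gamma> \<in> power_subgroup \<Gamma> (p ^ n)"
      then obtain \<delta> where \<delta>: "\<delta> \<in> carrier \<Gamma>" "\<gamma> = \<delta> [^]\<^bsub>\<Gamma>\<^esub> (p ^ n)" by (auto simp: power_subgroup_def)
      then have "\<phi> \<gamma> n = 0" by (simp add: pow)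
      then show "\<gamma> \<in> {\<gamma> \<in> carrier \<Gamma>. r n \<gamma> = 0}" using \<delta> by (simp add: r_def)
    next
      fix \<gamma> assume "\<gamma> \<in> {\<gamma> \<in> carrier \<Gamma>. r n \<gamma> = 0}"
      then have \<gamma>: "\<gamma> \<in> carrier \<Gamma>" "\<phi> \<gamma> n = 0" using r[of \<gamma> n] by auto
      show "\<gamma> \<in> power_subgroup \<Gamma> (p ^ n)"
        using div_ex[OF \<gamma>] by (auto simp: power_subgroup_def)
    qed
  qed
qed

text \<open>
  The subgroup of \<open>p ^ n\<close>-th powers is the kernel of the residue map \<open>r\<close>, so its cosets are the
  fibres of \<open>r\<close>, and translating them adds residues.
\<close>

lemma layer_group_cosets:
  assumes "group \<Gamma>" and N: "N = p ^ n" "p > 0"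
    and r: "\<And>\<gamma>. \<gamma> \<in> carrier \<Gamma> \<Longrightarrow> r \<gamma> < N"
    "\<And>\<gamma> \<delta>. \<gamma> \<in> carrier \<Gamma> \<Longrightarrow> \<delta> \<in> carrier \<Gamma> \<Longrightarrow> r (\<gamma> \<otimes>\<^bsub>\<Gamma>\<^esub> \<delta>) = (r \<gamma> + r \<delta>) mod N"
    "\<And>c. c < N \<Longrightarrow> \<exists>\<gamma>\<in>carrier \<Gamma>. r \<gamma> = c"
    "power_subgroup \<Gamma> N = {\<gamma> \<in> carrier \<Gamma>. r \<gamma> = 0}"
  defines "coset c \<equiv> {\<gamma> \<in> carrier \<Gamma>. r \<gamma> = c}"
  shows "carrier (layer_group p \<Gamma> n) = coset ` {..<N}" "inj_on coset {..<N}"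
    "\<And>c g. c < N \<Longrightarrow> g \<in> carrier \<Gamma> \<Longrightarrow> layer_act p \<Gamma> n (coset c) g = coset ((c + r g) mod N)"
proof -
  interpret group \<Gamma> by fact
  have "N > 0" using N by simp
  have r1: "r \<one>\<^bsub>\<Gamma>\<^esub> = 0"
  proof -
    have "r \<one>\<^bsub>\<Gamma>\<^esub> = (r \<one>\<^bsub>\<Gamma>\<^esub> + r \<one>\<^bsub>\<Gamma>\<^esub>) mod N" using r(2)[of "\<one>\<^bsub>\<Gamma>\<^esub>" "\<one>\<^bsub>\<Gamma>\<^esub>"] by simp
    then show ?thesis using r(1)[of "\<one>\<^bsub>\<Gamma>\<^esub>"] by (auto simp: mod_if split: if_splits)
  qed
  have rinv: "(r \<gamma> + r (inv\<^bsub>\<Gamma>\<^esub> \<gamma>)) mod N = 0" if "\<gamma> \<in> carrier \<Gamma>" for \<gamma>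
    using r(2)[of \<gamma> "inv\<^bsub>\<Gamma>\<^esub> \<gamma>"] that r1 by simp
  have rc: "power_subgroup \<Gamma> N #>\<^bsub>\<Gamma>\<^esub> g = coset (r g)" if g: "g \<in> carrier \<Gamma>" for g
  proof (intro equalityI subsetI)
    fix \<delta> assume "\<delta> \<in> power_subgroup \<Gamma> N #>\<^bsub>\<Gamma>\<^esub> g"
    then obtain \<gamma> where "\<gamma> \<in> carrier \<Gamma>" "r \<gamma> = 0" "\<delta> = \<gamma> \<otimes>\<^bsub>\<Gamma>\<^esub> g" by (auto simp: r_coset_def r(4))
    then show "\<delta> \<in> coset (r g)" using g r(1,2) by (simp add: coset_def)
  next
    fix \<delta> assume "\<delta> \<in> coset (r g)"
    then have \<delta>: "\<delta> \<in> carrier \<Gamma>" "r \<delta> = r g" by (auto simp: coset_def)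
    have "r (\<delta> \<otimes>\<^bsub>\<Gamma>\<^esub> inv\<^bsub>\<Gamma>\<^esub> g) = 0" using \<delta> g r(2) rinv by simp
    moreover have "\<delta> = (\<delta> \<otimes>\<^bsub>\<Gamma>\<^esub> inv\<^bsub>\<Gamma>\<^esub> g) \<otimes>\<^bsub>\<Gamma>\<^esub> g" using \<delta> g by (simp add: m_assoc)
    ultimately show "\<delta> \<in> power_subgroup \<Gamma> N #>\<^bsub>\<Gamma>\<^esub> g"
      using \<delta> g unfolding r_coset_def r(4) by blast
  qed
  show "carrier (layer_group p \<Gamma> n) = coset ` {..<N}"
  proof (intro equalityI subsetI)
    fix C assume "C \<in> carrier (layer_group p \<Gamma> n)"
    then obtain g where "g \<in> carrier \<Gamma>" "C = power_subgroup \<Gamma> N #>\<^bsub>\<Gamma>\<^esub> g"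
      by (auto simp: layer_group_def FactGroup_def RCOSETS_def N)
    then show "C \<in> coset ` {..<N}" using rc r(1) by auto
  next
    fix C assume "C \<in> coset ` {..<N}"
    then obtain c where "c < N" "C = coset c" by auto
    then obtain g where "g \<in> carrier \<Gamma>" "C = power_subgroup \<Gamma> N #>\<^bsub>\<Gamma>\<^esub> g" using r(3) rc by metis
    then show "C \<in> carrier (layer_group p \<Gamma> n)"
      by (auto simp: layer_group_def FactGroup_def RCOSETS_def N)
  qed
  show "inj_on coset {..<N}"
  proof (rule inj_onI)
    fix c d assume "c \<in> {..<N}" "d \<in> {..<N}" "coset c = coset d"
    then show "c = d" using r(3)[of c] by (auto simp: coset_def)
  qed
  fix c g assume c: "c < N" and g: "g \<in> carrier \<Gamma>"
  have "layer_act p \<Gamma> n (coset c) g = coset c <#>\<^bsub>\<Gamma>\<^esub> coset (r g)"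
    using rc[OF g] by (simp add: layer_act_def layer_group_def FactGroup_def N)
  also have "\<dots> = coset ((c + r g) mod N)"
  proof (intro equalityI subsetI)
    fix \<delta> assume "\<delta> \<in> coset c <#>\<^bsub>\<Gamma>\<^esub> coset (r g)"
    then show "\<delta> \<in> coset ((c + r g) mod N)" using r(2) by (auto simp: set_mult_def coset_def)
  next
    fix \<delta> assume "\<delta> \<in> coset ((c + r g) mod N)"
    then have \<delta>: "\<delta> \<in> carrier \<Gamma>" "r \<delta> = (c + r g) mod N" by (auto simp: coset_def)
    obtain \<gamma> where \<gamma>: "\<gamma> \<in> carrier \<Gamma>" "r \<gamma> = c" using r(3)[OF c] by blast
    have "r (inv\<^bsub>\<Gamma>\<^esub> \<gamma> \<otimes>\<^bsub>\<Gamma>\<^esub> \<delta>) = (r (inv\<^bsub>\<Gamma>\<^esub> \<gamma>) + (c + r g)) mod N"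
      using \<gamma> \<delta> r(2) by (simp add: mod_add_right_eq)
    also have "\<dots> = ((r \<gamma> + r (inv\<^bsub>\<Gamma>\<^esub> \<gamma>)) mod N + r g) mod N"
      by (simp add: \<gamma> mod_add_left_eq mod_add_right_eq add_ac)
    also have "\<dots> = r g" using rinv[OF \<gamma>(1)] r(1)[OF g] by simp
    finally have "inv\<^bsub>\<Gamma>\<^esub> \<gamma> \<otimes>\<^bsub>\<Gamma>\<^esub> \<delta> \<in> coset (r g)" using \<gamma> \<delta> by (simp add: coset_def)
    moreover have "\<delta> = \<gamma> \<otimes>\<^bsub>\<Gamma>\<^esub> (inv\<^bsub>\<Gamma>\<^esub> \<gamma> \<otimes>\<^bsub>\<Gamma>\<^esub> \<delta>)" using \<gamma> \<delta> by (simp add: m_assoc[symmetric])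
    moreover have "\<gamma> \<in> coset c" using \<gamma> by (simp add: coset_def)
    ultimately show "\<delta> \<in> coset c <#>\<^bsub>\<Gamma>\<^esub> coset (r g)" unfolding set_mult_def by blast
  qed
  finally show "layer_act p \<Gamma> n (coset c) g = coset ((c + r g) mod N)" .
qed


section \<open>Spanning trees of the layers\<close>

text \<open>
  The data of one layer of the covering: \<open>r\<close> is the residue modulo \<open>N = p ^ n\<close> on the group \<open>\<Gamma>\<close>,
  and the cosets that make up the layer group are its fibres.
\<close>

locale voltage_layer = serre_graph X arev + group \<Gamma>
  for X :: "('v, 'e) pre_digraph" and arev :: "'e \<Rightarrow> 'e" and \<Gamma> :: "'g monoid" +
  fixes p n N :: nat and r :: "'g \<Rightarrow> nat" and \<alpha> :: "'e \<Rightarrow> 'g"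
  assumes N: "N = p ^ n" "p > 0"
    and r_less: "\<And>\<gamma>. \<gamma> \<in> carrier \<Gamma> \<Longrightarrow> r \<gamma> < N"
    and r_mult: "\<And>\<gamma> \<delta>. \<gamma> \<in> carrier \<Gamma> \<Longrightarrow> \<delta> \<in> carrier \<Gamma> \<Longrightarrow> r (\<gamma> \<otimes>\<^bsub>\<Gamma>\<^esub> \<delta>) = (r \<gamma> + r \<delta>) mod N"
    and r_surj: "\<And>c. c < N \<Longrightarrow> \<exists>\<gamma>\<in>carrier \<Gamma>. r \<gamma> = c"
    and r_kernel: "power_subgroup \<Gamma> N = {\<gamma> \<in> carrier \<Gamma>. r \<gamma> = 0}"
    and \<alpha>_carrier: "\<And>e. e \<in> arcs X \<Longrightarrow> \<alpha> e \<in> carrier \<Gamma>"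
    and \<alpha>_arev: "\<And>e. e \<in> arcs X \<Longrightarrow> \<alpha> (arev e) = inv\<^bsub>\<Gamma>\<^esub> (\<alpha> e)"
begin

definition coset :: "nat \<Rightarrow> 'g set" where
  "coset c = {\<gamma> \<in> carrier \<Gamma>. r \<gamma> = c}"

lemmas layer = layer_group_cosets[OF group_axioms N r_less r_mult r_surj r_kernel, folded coset_def]

lemma voltage_inverse:
  assumes "e \<in> arcs X"
  shows "(r (\<alpha> e) + r (\<alpha> (arev e))) mod N = 0"
proof -
  have "r \<one>\<^bsub>\<Gamma>\<^esub> = (r \<one>\<^bsub>\<Gamma>\<^esub> + r \<one>\<^bsub>\<Gamma>\<^esub>) mod N" using r_mult[of "\<one>\<^bsub>\<Gamma>\<^esub>" "\<one>\<^bsub>\<Gamma>\<^esub>"] by simp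
  then have "r \<one>\<^bsub>\<Gamma>\<^esub> = 0" using r_less[of "\<one>\<^bsub>\<Gamma>\<^esub>"] by (auto simp: mod_if split: if_splits)
  then show ?thesis
    using r_mult[of "\<alpha> e" "inv\<^bsub>\<Gamma>\<^esub> (\<alpha> e)"] assms \<alpha>_carrier \<alpha>_arev by simp
qed

abbreviation Y where "Y \<equiv> derived_graph p \<Gamma> X \<alpha> n"

lemma N_pos: "N > 0" using N by simp

lemma Y_simps:
  "verts Y = coset ` {..<N} \<times> verts X" "arcs Y = coset ` {..<N} \<times> arcs X"
  "tail Y (C, e) = (C, tail X e)"
  "c < N \<Longrightarrow> e \<in> arcs X \<Longrightarrow> head Y (coset c, e) = (coset ((c + r (\<alpha> e)) mod N), head X e)"
  by (simp_all add: derived_graph_def layer \<alpha>_carrier)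

lemma arev_Y:
  "c < N \<Longrightarrow> e \<in> arcs X \<Longrightarrow>
    derived_arev p \<Gamma> X arev \<alpha> n (coset c, e) = (coset ((c + r (\<alpha> e)) mod N), arev e)"
  "x \<notin> arcs Y \<Longrightarrow> derived_arev p \<Gamma> X arev \<alpha> n x = x"
  by (auto simp: derived_arev_def Y_simps layer \<alpha>_carrier split: prod.splits)

lemma serre_graph_Y: "serre_graph Y (derived_arev p \<Gamma> X arev \<alpha> n)"
proof -
  have wf: "wf_digraph Y"
    by unfold_locales (auto simp: Y_simps N_pos)
  then interpret Y: wf_digraph Y .
  have fin: "fin_digraph Y"
    by unfold_locales (simp_all add: Y_simps)
  have "bidirected_digraph Y (derived_arev p \<Gamma> X arev \<alpha> n)"
  proof (rule Y.bidirected_digraphI)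
    fix x assume "x \<in> arcs Y"
    then obtain c e where x: "x = (coset c, e)" "c < N" "e \<in> arcs X" by (auto simp: Y_simps)
    show "derived_arev p \<Gamma> X arev \<alpha> n x \<noteq> x"
      using arev_neq[OF x(3)] by (simp add: x arev_Y)
    have "((c + r (\<alpha> e)) mod N + r (\<alpha> (arev e))) mod N = (c + (r (\<alpha> e) + r (\<alpha> (arev e))) mod N) mod N"
      by (simp add: mod_simps add.assoc)
    also have "\<dots> = c" using voltage_inverse[OF x(3)] x(2) by simp
    finally show "derived_arev p \<Gamma> X arev \<alpha> n (derived_arev p \<Gamma> X arev \<alpha> n x) = x"
      using x N_pos by (simp add: arev_Y)
    show "tail Y (derived_arev p \<Gamma> X arev \<alpha> n x) = head Y x"
      using x by (simp add: arev_Y Y_simps)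
  qed (rule arev_Y)
  then show ?thesis using fin by (simp add: serre_graph_def)
qed

lemma laplacian_Y:
  assumes "c < N" "d < N"
  shows "laplacian Y (coset c, u) (coset d, v)
    = (\<Sum>e\<in>out_arcs X u. of_bool ((d + N - c) mod N = 0 \<and> u = v)
        - of_bool ((d + N - c) mod N = r (\<alpha> e) \<and> head X e = v) :: 'c :: comm_ring_1)"
proof -
  have out: "out_arcs Y (coset c, u) = Pair (coset c) ` out_arcs X u"
    using assms by (auto simp: Y_simps)
  have inj: "coset c = coset d \<longleftrightarrow> c = d" if "c < N" "d < N" for c d
    using layer(2) that by (auto dest: inj_onD)
  have "laplacian Y (coset c, u) (coset d, v)
      = (\<Sum>e\<in>out_arcs X u. of_bool ((coset c, u) = (coset d, v)) - of_bool (head Y (coset c, e) = (coset d, v)) :: 'c)"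
    unfolding laplacian_def out by (subst sum.reindex) (auto simp: inj_on_def)
  also have "\<dots> = (\<Sum>e\<in>out_arcs X u. of_bool ((d + N - c) mod N = 0 \<and> u = v)
        - of_bool ((d + N - c) mod N = r (\<alpha> e) \<and> head X e = v))"
  proof (intro sum.cong refl arg_cong2[where f = minus] arg_cong[where f = of_bool])
    fix e assume e: "e \<in> out_arcs X u"
    show "((coset c, u) = (coset d, v)) = ((d + N - c) mod N = 0 \<and> u = v)"
      using assms N_pos by (auto simp: inj cyclic_diff_eq_iff)
    have "coset ((c + r (\<alpha> e)) mod N) = coset d \<longleftrightarrow> (d + N - c) mod N = r (\<alpha> e)"
      using assms N_pos e \<alpha>_carrier[of e] r_less[of "\<alpha> e"] by (auto simp: inj cyclic_diff_eq_iff)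
    then show "(head Y (coset c, e) = (coset d, v)) = ((d + N - c) mod N = r (\<alpha> e) \<and> head X e = v)"
      using assms e by (simp add: Y_simps)
  qed
  finally show ?thesis .
qed

text \<open>
  The entry of the Laplacian of the derived graph at \<open>(a, u)\<close> and \<open>(b, v)\<close> depends on the residues only
  through \<open>b - a\<close>. Adding the constant 1 to all entries keeps this, and by \<open>fdet_laplacian_add_constant\<close>
  the determinant counts spanning trees. In its factorisation over the roots of unity, the
  constants sum up to \<open>N\<close> at \<open>z = 1\<close>, which gives the spanning trees of \<open>X\<close>, and cancel at all other
  \<open>z\<close>.
\<close>

theorem spanning_trees_of_derived_graph:
  assumes "verts X \<noteq> {}"
  shows "of_nat N * of_nat (num_spanning_trees (derived_arev p \<Gamma> X arev \<alpha> n) Y)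
     = of_nat (num_spanning_trees arev X)
       * (\<Prod>z\<in>{z. z ^ N = 1} - {1}. ev (voltage_det (\<lambda>e. r (\<alpha> e))) z)"
proof -
  interpret Y: serre_graph Y "derived_arev p \<Gamma> X arev \<alpha> n" by (rule serre_graph_Y)
  define k where "k = (of_nat (card (verts X)) :: complex)"
  have k: "k \<noteq> 0" using assms by (simp add: k_def)
  define M :: "nat \<Rightarrow> 'v \<Rightarrow> 'v \<Rightarrow> complex" where
    "M c u v = (\<Sum>e\<in>out_arcs X u. of_bool (c = 0 \<and> u = v) - of_bool (c = r (\<alpha> e) \<and> head X e = v)) + 1"
    for c u v
  have cardY: "card (verts Y) = N * card (verts X)"
    using layer(2) by (simp add: Y_simps card_cartesian_product card_image)
  have neY: "verts Y \<noteq> {}" using assms N_pos by (auto simp: Y_simps)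
  have bij: "bij_betw (\<lambda>(c, v). (coset c, v)) ({..<N} \<times> verts X) (verts Y)"
    using layer(2) by (auto simp: bij_betw_def inj_on_def Y_simps)
  have Msum: "(\<Sum>c<N. M c u v * z ^ c)
      = (\<Sum>e\<in>out_arcs X u. of_bool (u = v) - of_bool (head X e = v) * z ^ r (\<alpha> e)) + (\<Sum>c<N. z ^ c)"
    for u v z
  proof -
    have "(\<Sum>c<N. M c u v * z ^ c)
        = (\<Sum>c<N. \<Sum>e\<in>out_arcs X u. (of_bool (c = 0 \<and> u = v) - of_bool (c = r (\<alpha> e) \<and> head X e = v)) * z ^ c)
          + (\<Sum>c<N. z ^ c)"
      by (simp add: M_def distrib_right sum.distrib sum_distrib_right)
    also have "(\<Sum>c<N. \<Sum>e\<in>out_arcs X u. (of_bool (c = 0 \<and> u = v) - of_bool (c = r (\<alpha> e) \<and> head X e = v)) * z ^ c)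
        = (\<Sum>e\<in>out_arcs X u. \<Sum>c<N. (of_bool (c = 0 \<and> u = v) - of_bool (c = r (\<alpha> e) \<and> head X e = v)) * z ^ c)"
      by (rule sum.swap)
    also have "\<dots> = (\<Sum>e\<in>out_arcs X u. of_bool (u = v) - of_bool (head X e = v) * z ^ r (\<alpha> e))"
    proof (intro sum.cong refl)
      fix e assume e: "e \<in> out_arcs X u"
      have "r (\<alpha> e) < N" using e \<alpha>_carrier r_less by auto
      have "(\<Sum>c<N. (of_bool (c = 0 \<and> u = v) - of_bool (c = r (\<alpha> e) \<and> head X e = v)) * z ^ c)
          = (\<Sum>c<N. if c = 0 then of_bool (u = v) else 0) - (\<Sum>c<N. if c = r (\<alpha> e) then of_bool (head X e = v) * z ^ r (\<alpha> e) else 0)"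
        unfolding sum_subtractf[symmetric] by (intro sum.cong) (auto simp: algebra_simps)
      then show "(\<Sum>c<N. (of_bool (c = 0 \<and> u = v) - of_bool (c = r (\<alpha> e) \<and> head X e = v)) * z ^ c)
          = of_bool (u = v) - of_bool (head X e = v) * z ^ r (\<alpha> e)"
        using N_pos \<open>r (\<alpha> e) < N\<close> by (simp add: sum.delta)
    qed
    finally show ?thesis .
  qed
  have at_one: "fdet (verts X) (\<lambda>u v. \<Sum>c<N. M c u v * 1 ^ c)
      = of_nat N * k ^ 2 * of_nat (num_spanning_trees arev X)"
    using fdet_laplacian_add_constant[OF assms, of "of_nat N :: complex"]
    unfolding Msum by (simp add: laplacian_def k_def)
  have at_root: "fdet (verts X) (\<lambda>u v. \<Sum>c<N. M c u v * z ^ c) = ev (voltage_det (\<lambda>e. r (\<alpha> e))) z"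
    if "z ^ N = 1" "z \<noteq> 1" for z
    unfolding Msum using root_of_unity_sum[OF that] by (simp add: ev_voltage_det)
  have "1 * of_nat (card (verts Y)) ^ 2 * of_nat (num_spanning_trees (derived_arev p \<Gamma> X arev \<alpha> n) Y)
      = fdet (verts Y) (\<lambda>x y. laplacian Y x y + 1 :: complex)"
    by (rule Y.fdet_laplacian_add_constant[OF neY, symmetric])
  also have "\<dots> = fdet ({..<N} \<times> verts X)
      (\<lambda>x y. laplacian Y (case x of (c, v) \<Rightarrow> (coset c, v)) (case y of (c, v) \<Rightarrow> (coset c, v)) + 1)"
    by (rule fdet_reindex[OF bij]) simp
  also have "\<dots> = fdet ({..<N} \<times> verts X) (\<lambda>x y. M ((fst y + N - fst x) mod N) (snd x) (snd y))"
    by (rule fdet_cong) (auto simp: M_def laplacian_Y)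
  also have "\<dots> = (\<Prod>z | z ^ N = 1. fdet (verts X) (\<lambda>u v. \<Sum>c<N. M c u v * z ^ c))"
    by (rule fdet_block_circulant[OF N_pos]) simp
  also have "\<dots> = fdet (verts X) (\<lambda>u v. \<Sum>c<N. M c u v * 1 ^ c)
      * (\<Prod>z\<in>{z. z ^ N = 1} - {1}. fdet (verts X) (\<lambda>u v. \<Sum>c<N. M c u v * z ^ c))"
    by (rule prod.remove) (use finite_roots_unity[of N] N_pos in \<open>auto simp: Suc_leI\<close>)
  also have "\<dots> = of_nat N * k ^ 2 * of_nat (num_spanning_trees arev X)
      * (\<Prod>z\<in>{z. z ^ N = 1} - {1}. ev (voltage_det (\<lambda>e. r (\<alpha> e))) z)"
    unfolding at_one by (intro arg_cong2[where f = "(*)"] prod.cong refl at_root) auto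
  finally show ?thesis
    using k N_pos by (simp add: cardY k_def power_mult_distrib power2_eq_square)
qed

end


section \<open>Growth of the number of spanning trees\<close>

text \<open>
  The difference of the two right-hand sides is \<open>a * n + b * p ^ n\<close> up to a constant; if it
  vanishes eventually, comparing successive differences gives \<open>b = 0\<close> and then \<open>a = 0\<close>.
\<close>

lemma iwasawa_lambda_unique:
  fixes l l' m m' p :: nat and \<nu> \<nu>' :: int and f :: "nat \<Rightarrow> int"
  assumes "p \<ge> 2"
    and 1: "\<forall>\<^sub>F n in sequentially. f n = int l * int n + int m * int p ^ n + \<nu>"
    and 2: "\<forall>\<^sub>F n in sequentially. f n = int l' * int n + int m' * int p ^ n + \<nu>'"
  shows "l = l'"
proof -
  obtain M where M: "\<And>n. n \<ge> M \<Longrightarrow> int l * int n + int m * int p ^ n + \<nu> = int l' * int n + int m' * int p ^ n + \<nu>'"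
    using eventually_conj[OF 1 2] unfolding eventually_sequentially by metis
  define a b where "a = int l - int l'" and "b = int m - int m'"
  have eq: "a * int n + b * int p ^ n = \<nu>' - \<nu>" if "n \<ge> M" for n
    using M[OF that] by (simp add: a_def b_def algebra_simps)
  have d: "a = - b * int p ^ n * (int p - 1)" if "n \<ge> M" for n
    using eq[of n] eq[of "Suc n"] that by (simp add: algebra_simps)
  have "b * int p ^ M * (int p - 1) = b * int p ^ M * (int p - 1) * int p"
    using d[of M] d[of "Suc M"] by (simp add: algebra_simps)
  then have "b * int p ^ M * (int p - 1) * (int p - 1) = 0" by (simp add: algebra_simps)
  then have "b = 0" using \<open>p \<ge> 2\<close> by auto
  then show ?thesis using d[of M] by (simp add: a_def)
qed

lemma multiplicity_int:
  assumes "prime p" "x > 0"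
  shows "multiplicity (int p) (int x) = multiplicity p x"
proof (rule multiplicity_eqI)
  have "p ^ multiplicity p x dvd x" by (rule multiplicity_dvd)
  then show "int p ^ multiplicity p x dvd int x"
    by (simp only: of_nat_power[symmetric] of_nat_dvd_iff)
  have "\<not> p ^ Suc (multiplicity p x) dvd x"
    using assms by (subst power_dvd_iff_le_multiplicity) (auto simp: prime_nat_iff)
  then show "\<not> int p ^ Suc (multiplicity p x) dvd int x"
    by (simp only: of_nat_power[symmetric] of_nat_dvd_iff not_False_eq_True)
qed

lemma multiplicity_from_unit_equation:
  fixes u v :: int and x y p k :: nat
  assumes p: "prime p" and "x > 0" "y > 0" and uv: "\<not> int p dvd u" "\<not> int p dvd v"
    and eq: "u * (int p * int x) = v * int y * int p ^ k"
  shows "Suc (multiplicity p x) = multiplicity p y + k"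
proof -
  have pp: "prime_elem (int p)" using p by simp
  have nz: "u \<noteq> 0" "v \<noteq> 0" "int p \<noteq> 0" using uv p by auto
  have "multiplicity (int p) (u * (int p * int x)) = Suc (multiplicity p x)"
    using nz \<open>x > 0\<close> uv pp
    by (simp add: prime_elem_multiplicity_mult_distrib not_dvd_imp_multiplicity_0 multiplicity_int[OF p])
  moreover have "multiplicity (int p) (v * int y * int p ^ k) = multiplicity p y + k"
    using nz \<open>y > 0\<close> uv pp
    by (simp add: prime_elem_multiplicity_mult_distrib not_dvd_imp_multiplicity_0 multiplicity_int[OF p])
  ultimately show ?thesis using eq by simp
qed

lemma omega_pcompose:
  "pcompose (omega N) ([:1, 1:] ^ k - 1) = omega (k * N)"
proof -
  have one: "pcompose 1 s = 1" for s :: "int poly" by (simp add: one_pCons)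
  have "pcompose [:1, 1:] ([:1, 1:] ^ k - 1) = ([:1, 1:] ^ k :: int poly)"
    by (simp add: pcompose_pCons pCons_one)
  then show ?thesis
    unfolding omega_def pcompose_diff pcompose_power one by (simp only: power_mult)
qed

lemma symmetry_of_reduced_poly:
  assumes p: "prime p" and d: "d = [:int p:] ^ \<mu> * g + omega N * s" and N: "N > 0"
    and sym: "omega N dvd pcompose d ([:1, 1:] ^ (N - 1) - 1) - d"
  shows "omega N dvd pcompose g ([:1, 1:] ^ (N - 1) - 1) - g"
proof -
  let ?S = "[:1, 1:] ^ (N - 1) - 1 :: int poly"
  have P: "[:int p:] ^ \<mu> = [:int p ^ \<mu>:]" by (simp add: poly_const_pow)
  have "[:int p:] ^ \<mu> * (pcompose g ?S - g)
      = (pcompose d ?S - d) - omega ((N - 1) * N) * pcompose s ?S + omega N * s"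
    unfolding d pcompose_add pcompose_mult omega_pcompose P by (simp add: algebra_simps pcompose_smult smult_diff_right)
  moreover have "omega N dvd omega ((N - 1) * N)" by (rule omega_dvd_omega) simp
  ultimately have "omega N dvd [:int p:] ^ \<mu> * (pcompose g ?S - g)"
    using sym by (simp add: dvd_add dvd_diff)
  then show ?thesis by (rule monic_dvd_cancel_prime_power[OF p monic_omega(2)[OF N]])
qed

text \<open>
  The roots of unity of order dividing \<open>p ^ n\<close> contribute the same factors to the formulas for \<open>\<kappa> n\<close>
  and \<open>\<kappa> (Suc n)\<close>.
\<close>

lemma kappa_step:
  fixes d :: "nat \<Rightarrow> int poly" and \<kappa> :: "nat \<Rightarrow> nat"
  assumes p: "prime p"
    and \<kappa>: "\<And>n. of_nat (p ^ n) * of_nat (\<kappa> n) = of_nat k0 * (\<Prod>z\<in>{z. z ^ (p ^ n) = 1} - {1}. ev (d n) z)"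
    and compat: "omega (p ^ n) dvd d (Suc n) - d n"
  shows "of_nat p * of_nat (\<kappa> (Suc n)) = of_nat (\<kappa> n) * (\<Prod>z\<in>primitive_roots p n. ev (d (Suc n)) z)"
proof -
  have "{z :: complex. z ^ (p ^ Suc n) = 1} - {1} = ({z. z ^ (p ^ n) = 1} - {1}) \<union> primitive_roots p n"
    unfolding roots_of_unity_Suc(1)[OF p] by (auto simp: primitive_roots_def)
  then have "(\<Prod>z \<in> {z :: complex. z ^ (p ^ Suc n) = 1} - {1}. ev (d (Suc n)) z)
      = (\<Prod>z \<in> {z :: complex. z ^ (p ^ n) = 1} - {1}. ev (d (Suc n)) z) * (\<Prod>z\<in>primitive_roots p n. ev (d (Suc n)) z)"
    using roots_of_unity_Suc[OF p, of n] by (simp only:) (intro prod.union_disjoint; auto)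
  moreover have "(\<Prod>z \<in> {z :: complex. z ^ (p ^ n) = 1} - {1}. ev (d (Suc n)) z)
      = (\<Prod>z \<in> {z :: complex. z ^ (p ^ n) = 1} - {1}. ev (d n) z)"
    by (intro prod.cong refl ev_eq_if_omega_dvd[OF compat]) auto
  ultimately have "of_nat (p ^ Suc n) * of_nat (\<kappa> (Suc n))
      = of_nat (p ^ n) * of_nat (\<kappa> n) * (\<Prod>z\<in>primitive_roots p n. ev (d (Suc n)) z)"
    using \<kappa>[of "Suc n"] \<kappa>[of n] by (simp add: mult.assoc)
  then show ?thesis using prime_gt_0_nat[OF p] by simp
qed

text \<open>
  The numbers \<open>\<kappa> n\<close> only enter through the product formula, so the argument is independent of
  graphs from here on. Positivity of \<open>\<kappa>\<close> is what excludes that the polynomials vanish in the limit.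
\<close>

lemma iwasawa_formula_of_polys:
  fixes d :: "nat \<Rightarrow> int poly" and \<kappa> :: "nat \<Rightarrow> nat"
  assumes p: "prime p" and pos: "\<And>n. \<kappa> n > 0"
    and \<kappa>: "\<And>n. of_nat (p ^ n) * of_nat (\<kappa> n) = of_nat k0 * (\<Prod>z\<in>{z. z ^ (p ^ n) = 1} - {1}. ev (d n) z)"
    and compat: "\<And>m n. m \<le> n \<Longrightarrow> omega (p ^ m) dvd d n - d m"
    and sym: "\<And>n. omega (p ^ n) dvd pcompose (d n) ([:1, 1:] ^ (p ^ n - 1) - 1) - d n"
    and zero: "\<And>n. coeff (d n) 0 = 0"
  obtains l \<mu> \<nu> where "odd l"
    "\<forall>\<^sub>F n in sequentially. int (multiplicity p (\<kappa> n)) = int l * int n + int \<mu> * int p ^ n + \<nu>"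
proof -
  have p2: "p \<ge> 2" using p by (rule prime_ge_2_nat)
  have step: "of_nat p * of_nat (\<kappa> (Suc n)) = of_nat (\<kappa> n) * (\<Prod>z\<in>primitive_roots p n. ev (d (Suc n)) z)" for n
    using p \<kappa> compat by (rule kappa_step) simp
  have nz: "\<not> omega (p ^ 1) dvd d 1"
  proof
    assume "omega (p ^ 1) dvd d 1"
    then have "ev (d 1) z = 0" if "z \<in> primitive_roots p 0" for z
      using ev_eq_if_omega_dvd[of "p ^ 1" "d 1" 0 z] that by (simp add: primitive_roots_def)
    moreover have "primitive_roots p 0 \<noteq> {}"
      using card_primitive_roots[OF p, of 0] p2 by auto
    ultimately have "(\<Prod>z\<in>primitive_roots p 0. ev (d 1) z) = 0"
      using roots_of_unity_Suc(4)[OF p, of 0] by (intro prod_zero) auto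
    then show False using step[of 0] pos[of 1] p2 by simp
  qed
  obtain \<mu> l n1 where dat: "\<And>n. n \<ge> n1 \<Longrightarrow>
    l < p ^ n \<and> (\<exists>g s. d n = [:int p:] ^ \<mu> * g + omega (p ^ n) * s \<and>
       (\<forall>i<l. int p dvd coeff g i) \<and> \<not> int p dvd coeff g l)"
  proof -
    show thesis
      by (rule iwasawa_invariants_of_compatible_polys[OF p compat nz]) (assumption, rule that, assumption)
  qed
  have pn: "p ^ n > 0" for n using p2 by simp
  have "l \<noteq> 0 \<and> even l"
  proof -
    \<comment> \<open>Large enough for \<open>l + 2 \<le> p ^ n\<close>, so that the coefficients at \<open>T ^ l\<close> and \<open>T ^ (l + 1)\<close> survive modulo \<open>T ^ p ^ n\<close>.\<close>
    define n where "n = Suc (n1 + l)"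
    have "n + 1 \<le> 2 ^ n" by (induction n) auto
    also have "(2 :: nat) ^ n \<le> p ^ n" using p2 by (intro power_mono) auto
    finally have l2: "l + 2 \<le> p ^ n" by (simp add: n_def)
    obtain g s where g: "d n = [:int p:] ^ \<mu> * g + omega (p ^ n) * s"
      "\<And>i. i < l \<Longrightarrow> int p dvd coeff g i" "\<not> int p dvd coeff g l"
      using dat[of n] by (auto simp: n_def)
    have "even l"
      by (rule even_if_symmetric[OF p _ l2 g(2,3) symmetry_of_reduced_poly[OF p g(1) pn sym]])
         (auto simp: n_def)
    moreover have "l \<noteq> 0"
    proof
      assume "l = 0"
      have "coeff (omega (p ^ n)) 0 = 0" by (simp add: omega_def coeff_0_power)
      then have "0 = int p ^ \<mu> * coeff g 0"
        using zero[of n] unfolding g(1) by (simp add: coeff_mult_0 coeff_0_power)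
      then have "coeff g 0 = 0" using p2 by simp
      then show False using g(3) \<open>l = 0\<close> by simp
    qed
    ultimately show ?thesis by simp
  qed
  then obtain l' where l': "l = Suc l'" "odd l'" by (cases l) auto
  have mult_step: "Suc (multiplicity p (\<kappa> (Suc n))) = multiplicity p (\<kappa> n) + (\<mu> * (p ^ Suc n - p ^ n) + l)"
    if n: "n \<ge> n1" for n
  proof -
    obtain g s where g: "d (Suc n) = [:int p:] ^ \<mu> * g + omega (p ^ Suc n) * s"
      "\<And>i. i < l \<Longrightarrow> int p dvd coeff g i" "\<not> int p dvd coeff g l"
      using dat[of "Suc n"] n by auto
    have "2 * p ^ n \<le> p ^ Suc n" using p2 by simp
    moreover have "l < p ^ n" using dat[OF n] by blast
    ultimately have "l < p ^ Suc n - p ^ n" by linarith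
    from prod_primitive_ev_valuation[OF p this g(2,3)] obtain u v where
      uv: "\<not> int p dvd u" "\<not> int p dvd v"
      "of_int u * (\<Prod>z\<in>primitive_roots p n. ev g z) = of_int v * of_nat p ^ l" by blast
    have "ev (d (Suc n)) z = of_nat p ^ \<mu> * ev g z" if "z \<in> primitive_roots p n" for z
      using that unfolding g(1) by (simp add: ev_omega primitive_roots_def)
    then have "(\<Prod>z\<in>primitive_roots p n. ev (d (Suc n)) z)
        = (\<Prod>z\<in>primitive_roots p n. of_nat p ^ \<mu> * ev g z)" by (rule prod.cong[OF refl])
    also have "\<dots> = of_nat p ^ (\<mu> * (p ^ Suc n - p ^ n)) * (\<Prod>z\<in>primitive_roots p n. ev g z)"
      by (simp only: prod.distrib prod_constant card_primitive_roots[OF p] power_mult)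
    finally have "of_int u * (of_nat p * of_nat (\<kappa> (Suc n)))
        = of_nat (\<kappa> n) * of_nat p ^ (\<mu> * (p ^ Suc n - p ^ n)) * (of_int u * (\<Prod>z\<in>primitive_roots p n. ev g z))"
      unfolding step by (simp only: mult_ac)
    also have "\<dots> = of_int v * of_nat (\<kappa> n) * of_nat p ^ (\<mu> * (p ^ Suc n - p ^ n) + l)"
      unfolding uv(3) power_add by (simp only: mult_ac)
    finally have "complex_of_int (u * (int p * int (\<kappa> (Suc n))))
        = of_int (v * int (\<kappa> n) * int p ^ (\<mu> * (p ^ Suc n - p ^ n) + l))" by simp
    then have "u * (int p * int (\<kappa> (Suc n))) = v * int (\<kappa> n) * int p ^ (\<mu> * (p ^ Suc n - p ^ n) + l)"
      by (simp only: of_int_eq_iff)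
    then show ?thesis by (rule multiplicity_from_unit_equation[OF p pos pos uv(1,2)])
  qed
  define \<nu> where "\<nu> = int (multiplicity p (\<kappa> n1)) - int l' * int n1 - int \<mu> * int p ^ n1"
  have "int (multiplicity p (\<kappa> n)) = int l' * int n + int \<mu> * int p ^ n + \<nu>" if "n \<ge> n1" for n
    using that
  proof (induction n rule: dec_induct)
    case base
    show ?case by (simp add: \<nu>_def)
  next
    case (step n)
    have "p ^ n \<le> p ^ Suc n" using p2 by simp
    then have "int (p ^ Suc n - p ^ n) = int p ^ Suc n - int p ^ n" by (simp only: of_nat_diff of_nat_power)
    then have "int (multiplicity p (\<kappa> (Suc n)))
        = int (multiplicity p (\<kappa> n)) + int \<mu> * (int p ^ Suc n - int p ^ n) + int l'"
      using arg_cong[OF mult_step[OF step(1)], of int] by (simp add: l'(1))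
    then show ?case using step by (simp add: algebra_simps)
  qed
  then show ?thesis
    using that[OF l'(2)] unfolding eventually_sequentially by blast
qed


section \<open>The parity of lambda\<close>

theorem proposition3p1:
  fixes p :: nat
    and \<Gamma> :: "'g monoid" and T :: "'g topology"
    and X :: "('v, 'e) pre_digraph" and arev :: "'e \<Rightarrow> 'e" and \<alpha> :: "'e \<Rightarrow> 'g"
  assumes "prime p"
    and "unramified_Zp_covering p \<Gamma> T X arev \<alpha>"
  shows "odd (iwasawa_lambda p \<Gamma> X arev \<alpha>)"
proof -
  have p0: "p > 0" and p2: "p \<ge> 2" using assms(1) by (simp_all add: prime_gt_0_nat prime_ge_2_nat)
  have cov: "fin_digraph X" "bidirected_digraph X arev" "isomorphic_to_Zp p \<Gamma> T"
    "\<And>e. e \<in> arcs X \<Longrightarrow> \<alpha> e \<in> carrier \<Gamma>"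
    "\<And>e. e \<in> arcs X \<Longrightarrow> \<alpha> (arev e) = inv\<^bsub>\<Gamma>\<^esub> (\<alpha> e)"
    "\<And>n. Digraph_Component.connected (derived_graph p \<Gamma> X \<alpha> n)"
    using assms(2) by (auto simp: unramified_Zp_covering_def)
  have grp: "group \<Gamma>" using cov(3) by (simp add: isomorphic_to_Zp_def)
  interpret serre_graph X arev using cov(1,2) by (rule serre_graph.intro)
  obtain r :: "nat \<Rightarrow> 'g \<Rightarrow> nat" where r:
    "\<And>n \<gamma>. \<gamma> \<in> carrier \<Gamma> \<Longrightarrow> r n \<gamma> < p ^ n"
    "\<And>n \<gamma>. \<gamma> \<in> carrier \<Gamma> \<Longrightarrow> r (Suc n) \<gamma> mod p ^ n = r n \<gamma>"
    "\<And>n \<gamma> \<delta>. \<gamma> \<in> carrier \<Gamma> \<Longrightarrow> \<delta> \<in> carrier \<Gamma> \<Longrightarrow> r n (\<gamma> \<otimes>\<^bsub>\<Gamma>\<^esub> \<delta>) = (r n \<gamma> + r n \<delta>) mod p ^ n"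
    "\<And>n c. c < p ^ n \<Longrightarrow> \<exists>\<gamma>\<in>carrier \<Gamma>. r n \<gamma> = c"
    "\<And>n. power_subgroup \<Gamma> (p ^ n) = {\<gamma> \<in> carrier \<Gamma>. r n \<gamma> = 0}"
    using Zp_residues[OF cov(3) p0] by blast
  have layer: "voltage_layer X arev \<Gamma> p n (p ^ n) (r n) \<alpha>" for n
    using serre_graph_axioms grp p0 r cov(4,5)
    by (intro voltage_layer.intro voltage_layer_axioms.intro) auto
  define d where "d n = voltage_det (\<lambda>e. r n (\<alpha> e))" for n
  define \<kappa> where "\<kappa> = covering_kappa p \<Gamma> X arev \<alpha>"
  have "verts (derived_graph p \<Gamma> X \<alpha> 0) \<noteq> {}" using cov(6)[of 0] by (simp add: connected_conv)
  then have ne: "verts X \<noteq> {}" by (auto simp: derived_graph_def)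
  have r_mod: "r n \<gamma> mod p ^ m = r m \<gamma>" if "m \<le> n" "\<gamma> \<in> carrier \<Gamma>" for m n \<gamma>
    using that(1)
  proof (induction n rule: dec_induct)
    case base
    show ?case using r(1)[OF that(2)] by simp
  next
    case (step n)
    have "r (Suc n) \<gamma> mod p ^ m = r (Suc n) \<gamma> mod p ^ n mod p ^ m"
      using step(1) by (simp add: mod_mod_cancel le_imp_power_dvd)
    then show ?case using step(3) r(2)[OF that(2), of n] by simp
  qed
  obtain l \<mu> \<nu> where l: "odd l"
    "\<forall>\<^sub>F n in sequentially. int (multiplicity p (\<kappa> n)) = int l * int n + int \<mu> * int p ^ n + \<nu>"
  proof (rule iwasawa_formula_of_polys[of p \<kappa> "num_spanning_trees arev X" d])
    fix n
    interpret L: voltage_layer X arev \<Gamma> p n "p ^ n" "r n" \<alpha> by (rule layer)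
    interpret Y: serre_graph "derived_graph p \<Gamma> X \<alpha> n" "derived_arev p \<Gamma> X arev \<alpha> n"
      by (rule L.serre_graph_Y)
    show "\<kappa> n > 0"
      using Y.num_spanning_trees_pos[OF cov(6)] by (simp add: \<kappa>_def covering_kappa_def)
    show "of_nat (p ^ n) * of_nat (\<kappa> n)
        = of_nat (num_spanning_trees arev X) * (\<Prod>z\<in>{z. z ^ (p ^ n) = 1} - {1}. ev (d n) z)"
      using L.spanning_trees_of_derived_graph[OF ne] by (simp add: \<kappa>_def covering_kappa_def d_def)
    show "omega (p ^ n) dvd pcompose (d n) ([:1, 1:] ^ (p ^ n - 1) - 1) - d n"
      unfolding d_def by (rule voltage_det_symmetric) (use p0 L.voltage_inverse in auto)
    show "coeff (d n) 0 = 0" unfolding d_def by (rule coeff_voltage_det_0[OF ne])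
  next
    fix m n :: nat assume "m \<le> n"
    then show "omega (p ^ m) dvd d n - d m"
      unfolding d_def using r_mod cov(4) by (intro voltage_det_cong) simp
  qed (use assms(1) in auto)
  have "iwasawa_lambda p \<Gamma> X arev \<alpha> = l"
    unfolding iwasawa_lambda_def
  proof (rule the_equality)
    show "\<exists>m \<nu>. iwasawa_invariants p \<Gamma> X arev \<alpha> l m \<nu>"
      using l(2) unfolding iwasawa_invariants_def \<kappa>_def by blast
    fix l' assume "\<exists>m \<nu>. iwasawa_invariants p \<Gamma> X arev \<alpha> l' m \<nu>"
    then obtain m' \<nu>' where "\<forall>\<^sub>F n in sequentially. int (multiplicity p (\<kappa> n)) = int l' * int n + int m' * int p ^ n + \<nu>'"
      unfolding iwasawa_invariants_def \<kappa>_def by blast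
    then show "l' = l" using l(2) by (rule iwasawa_lambda_unique[OF p2])
  qed
  then show ?thesis using l(1) by simp
qed

end
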